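(* There exists $C\in(0,\infty)$ such that for any Borel set $E\subseteq K$, any open neighborhood $E'$ of the closure $\overline{E}$ in $K$ and any $u\in\mathcal{F}_{p,\mathrm{loc}}(E')$, $$\Gamma_{\mathcal{E}_p}\langle u\rangle(E)\le C\lim_{\delta\downarrow0}\liminf_{s\downarrow0}\int_{(E)_\delta}\frac{1}{m(B(x,s))}\int_{B(x,s)}\frac{|u(x)-u(y)|^p}{s^{d_{\mathrm f,p}+p-1}}\,m(dy)\,m(dx),$$ where $(E)_\delta=\bigcup_{x\in E}B(x,\delta)$. Furthermore, with the same $C$, for any $f\in L^p(K,m)$, $$\mathcal{E}_p(f)\le C\liminf_{s\downarrow0}\int_K\frac{1}{m(B(x,s))}\int_{B(x,s)}\frac{|f(x)-f(y)|^p}{s^{d_{\mathrm f,p}+p-1}}\,m(dy)\,m(dx),$$ where $\mathcal{E}_p(f):=\infty$ for $f\in L^p(K,m)\setminus\mathcal{F}_p$.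
   Context: Self-similar structure. $K$ is a compact metrizable space, $S$ a finite set with $\#S\ge2$, $F_i\colon K\to K$ ($i\in S$) continuous injections, $K_i=F_i(K)$. $\mathcal{L}=(K,S,\{F_i\}_{i\in S})$ is a self-similar structure if there is a continuous surjection $\chi\colon S^{\mathbb{N}}\to K$ with $F_i\circ\chi=\chi\circ\sigma_i$, $\sigma_i(\omega_1\omega_2\dots)=i\omega_1\omega_2\dots$. It is post-critically finite (p.-c.f.) if $\bigcup_{n\ge1}\sigma^n(\mathcal{C})$ is finite, where $\mathcal{C}=\chi^{-1}(\bigcup_{i\ne j}K_i\cap K_j)$ and $\sigma$ is the left shift. A self-similar measure with weight $(\theta_i)$ ($\theta_i\in(0,1)$, $\sum\theta_i=1$) is a Borel probability measure $m$ with $m=\sum_i\theta_i(F_i)_*m$. $p$-resistance form on $K$: a pair $(\mathcal{E},\mathcal{F})$ with $\mathcal{F}\subseteq\mathbb{R}^K$ a linear subspace containing $\mathbb{R}\mathbf{1}_K$, $\mathcal{E}\colon\mathcal{F}\to[0,\infty)$ with $\mathcal{E}^{1/p}$ a seminorm with null space $\mathbb{R}\mathbf{1}_K$; $(\mathcal{F}/\mathbb{R}\mathbf{1}_K,\mathcal{E}^{1/p})$ is Banach; $\mathcal{F}$ separates points; $R_{\mathcal{E}}(x,y)=\sup\{|u(x)-u(y)|^p/\mathcal{E}(u):u\in\mathcal{F}\setminus\mathbb{R}\mathbf{1}_K\}<\infty$ for all $x,y$; and $(\mathrm{GC})_p$: whenever $n_1,n_2\in\mathbb{N}$, $q_1\in(0,p]$,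 $q_2\in[p,\infty]$, $T\colon\mathbb{R}^{n_1}\to\mathbb{R}^{n_2}$, $T(0)=0$ and $\|T(x)-T(y)\|_{\ell^{q_2}}\le\|x-y\|_{\ell^{q_1}}$ for all $x,y$, then for all $\boldsymbol{u}\in\mathcal{F}^{n_1}$, $T(\boldsymbol{u})\in\mathcal{F}^{n_2}$ and $\|(\mathcal{E}(T_l(\boldsymbol{u}))^{1/p})_l\|_{\ell^{q_2}}\le\|(\mathcal{E}(u_k)^{1/p})_k\|_{\ell^{q_1}}$ ($\|x\|_{\ell^q}=(\sum|x_k|^q)^{1/q}$ for $q<\infty$, $\|x\|_{\ell^\infty}=\max|x_k|$). Under $(\mathrm{GC})_p$, $\mathcal{E}(u;v):=\frac1p\frac{d}{dt}\mathcal{E}(u+tv)|_{t=0}$ exists. Standing assumption. $p\in(1,\infty)$; $\mathcal{L}$ is a p.-c.f. self-similar structure with $\#S\ge2$ and $K$ connected; $(\mathcal{E}_p,\mathcal{F}_p)$ is a self-similar $p$-resistance form on $\mathcal{L}$ with weight $(\rho_{p,i})_{i\in S}\in(0,\infty)^S$, i.e. a $p$-resistance form on $K$ with $\mathcal{F}_p\subseteq C(K)$, $\mathcal{F}_p=\{u\in C(K):u\circ F_i\in\mathcal{F}_p\ \forall i\}$, $\mathcal{E}_p(u)=\sum_i\rho_{p,i}\mathcal{E}_p(u\circ F_i)$ for $u\in\mathcal{F}_p$; and $\min_i\rho_{p,i}>1$. $d_{\mathrm f,p}>0$ satisfies $\sum_i\rho_{p,i}^{-d_{\mathrm f,p}/(p-1)}=1$;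 $m$ is the self-similar measure with weight $(\rho_{p,i}^{-d_{\mathrm f,p}/(p-1)})_{i\in S}$. $\widehat R_p(x,y)=R_{\mathcal{E}_p}(x,y)^{1/(p-1)}$ is the $p$-resistance metric (known to be a metric giving the topology of $K$), and $B(x,s)=\{y\in K:\widehat R_p(x,y)<s\}$. Continuous functions are identified with their $m$-classes. $p$-energy measures. For $u\in\mathcal{F}_p$, $\Gamma_{\mathcal{E}_p}\langle u\rangle$ is the unique positive Radon measure on $K$ (known to exist) with $\int_K\varphi\,d\Gamma_{\mathcal{E}_p}\langle u\rangle=\mathcal{E}_p(u;u\varphi)-(\frac{p-1}{p})^{p-1}\mathcal{E}_p(|u|^{p/(p-1)};\varphi)$ for all $\varphi\in\mathcal{F}_p$. It is known that $\Gamma_{\mathcal{E}_p}\langle u\rangle(A)=\Gamma_{\mathcal{E}_p}\langle v\rangle(A)$ if $u-v$ is constant on the Borel set $A$. For a non-empty open $U\subseteq K$, $\mathcal{F}_{p,\mathrm{loc}}(U)$ is the set of $f\in C(U)$ such that for each relatively compact open subset $A$ of $U$ there is $f^{\#}\in\mathcal{F}_p$ with $f|_A=f^{\#}|_A$. For such $f$, $\Gamma_{\mathcal{E}_p}\langle f\rangle$ is the Radon measure on $U$ with $\Gamma_{\mathcal{E}_p}\langle f\rangle(E)=\Gamma_{\mathcal{E}_p}\langle f^{\#}\rangle(E)$ for every relatively compact Borel $E\subseteq U$, where $A$ is any relatively compact open subset of $U$ with $A\supseteq E$ and $f^{\#}\in\mathcal{F}_p$ is any function with $f|_A=f^{\#}|_A$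 (the value does not depend on the choice of $A$ and $f^{\#}$). *)

theory Defs
  imports "HOL-Analysis.Analysis"
begin

text \<open>
  The compact metrizable space \<open>K\<close> is the universe of a type of class \<^class>\<open>polish_space\<close>
  together with the assumption \<^prop>\<open>compact (UNIV :: 'a::polish_space set)\<close>. A compact metric is
  complete and separable, so the class costs no generality. The metric \<^const>\<open>dist\<close> of the class
  only witnesses metrizability and is not used below; the balls in the statement are those of the
  resistance metric.
\<close>

section \<open>Self-similar structures\<close>

text \<open>Words \<open>S^\<nat>\<close> are the functions in \<open>UNIV \<rightarrow> S\<close> with the product of discrete topologies;
  \<open>case_nat i \<omega>\<close> is the word \<open>i \<omega>\<^sub>1 \<omega>\<^sub>2 ...\<close>.\<close>

definition coding_map :: "'i set \<Rightarrow> ('i \<Rightarrow> 'a::topological_space \<Rightarrow> 'a) \<Rightarrow> ((nat \<Rightarrow> 'i) \<Rightarrow> 'a) \<Rightarrow> bool" where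
  "coding_map S F \<pi> \<longleftrightarrow>
     continuous_map (product_topology (\<lambda>_::nat. discrete_topology S) UNIV) euclidean \<pi> \<and>
     \<pi> ` (UNIV \<rightarrow> S) = UNIV \<and>
     (\<forall>i\<in>S. \<forall>\<omega>\<in>(UNIV \<rightarrow> S). F i (\<pi> \<omega>) = \<pi> (case_nat i \<omega>))"

definition self_similar_structure :: "'i set \<Rightarrow> ('i \<Rightarrow> 'a::polish_space \<Rightarrow> 'a) \<Rightarrow> bool" where
  "self_similar_structure S F \<longleftrightarrow>
     compact (UNIV :: 'a set) \<and> finite S \<and> card S \<ge> 2 \<and>
     (\<forall>i\<in>S. continuous_on UNIV (F i) \<and> inj (F i)) \<and>
     (\<exists>\<pi>. coding_map S F \<pi>)"

definition critical_set :: "'i set \<Rightarrow> ('i \<Rightarrow> 'a \<Rightarrow> 'a) \<Rightarrow> ((nat \<Rightarrow> 'i) \<Rightarrow> 'a) \<Rightarrow> (nat \<Rightarrow> 'i) set" where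
  "critical_set S F \<pi> =
     {\<omega> \<in> (UNIV \<rightarrow> S). \<exists>i\<in>S. \<exists>j\<in>S. i \<noteq> j \<and> \<pi> \<omega> \<in> range (F i) \<inter> range (F j)}"

definition left_shift :: "(nat \<Rightarrow> 'i) \<Rightarrow> nat \<Rightarrow> 'i" where
  "left_shift \<omega> = (\<lambda>n. \<omega> (Suc n))"

definition post_critical_set :: "'i set \<Rightarrow> ('i \<Rightarrow> 'a \<Rightarrow> 'a) \<Rightarrow> ((nat \<Rightarrow> 'i) \<Rightarrow> 'a) \<Rightarrow> (nat \<Rightarrow> 'i) set" where
  "post_critical_set S F \<pi> = (\<Union>n\<in>{1..}. (left_shift ^^ n) ` critical_set S F \<pi>)"

text \<open>The coding map is unique on \<open>S^\<nat>\<close>, so the existential quantifier over it in the following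
  definition is harmless.\<close>

definition pcf_self_similar_structure :: "'i set \<Rightarrow> ('i \<Rightarrow> 'a::polish_space \<Rightarrow> 'a) \<Rightarrow> bool" where
  "pcf_self_similar_structure S F \<longleftrightarrow>
     self_similar_structure S F \<and>
     (\<exists>\<pi>. coding_map S F \<pi> \<and> finite (post_critical_set S F \<pi>))"

definition self_similar_measure ::
    "'i set \<Rightarrow> ('i \<Rightarrow> 'a::topological_space \<Rightarrow> 'a) \<Rightarrow> ('i \<Rightarrow> real) \<Rightarrow> 'a measure \<Rightarrow> bool" where
  "self_similar_measure S F \<theta> m \<longleftrightarrow>
     (\<forall>i\<in>S. 0 < \<theta> i \<and> \<theta> i < 1) \<and> (\<Sum>i\<in>S. \<theta> i) = 1 \<and>
     sets m = sets borel \<and> emeasure m (space m) = 1 \<and>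
     (\<forall>A\<in>sets borel. emeasure m A = (\<Sum>i\<in>S. ennreal (\<theta> i) * emeasure (distr m borel (F i)) A))"

section \<open>Resistance forms\<close>

definition lq_norm :: "ereal \<Rightarrow> nat \<Rightarrow> (nat \<Rightarrow> real) \<Rightarrow> real" where
  "lq_norm q n x =
     (if q = \<infinity> then Max ((\<lambda>k. \<bar>x k\<bar>) ` {..<n})
      else (\<Sum>k<n. \<bar>x k\<bar> powr real_of_ereal q) powr (1 / real_of_ereal q))"

text \<open>
  Generalized contraction property. A vector of \<open>\<real>^n\<close> is a function on \<^typ>\<open>nat\<close> of which only the
  values at \<open>0, ..., n - 1\<close> are looked at. The Lipschitz condition makes the first \<open>n2\<close> components
  of \<open>T x\<close> depend only on the first \<open>n1\<close> components of \<open>x\<close>, so that \<open>T\<close> amounts to a map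
  from \<open>\<real>^n1\<close> to \<open>\<real>^n2\<close>.
\<close>

definition generalized_contraction ::
    "real \<Rightarrow> (('a \<Rightarrow> real) \<Rightarrow> real) \<Rightarrow> ('a \<Rightarrow> real) set \<Rightarrow> bool" where
  "generalized_contraction p \<E> \<F> \<longleftrightarrow>
     (\<forall>(n1::nat) (n2::nat) (q1::real) (q2::ereal) (T :: (nat \<Rightarrow> real) \<Rightarrow> nat \<Rightarrow> real).
        n1 \<ge> 1 \<longrightarrow> n2 \<ge> 1 \<longrightarrow> 0 < q1 \<longrightarrow> q1 \<le> p \<longrightarrow> ereal p \<le> q2 \<longrightarrow>
        (\<forall>l<n2. T (\<lambda>_. 0) l = 0) \<longrightarrow>
        (\<forall>x y. lq_norm q2 n2 (\<lambda>l. T x l - T y l) \<le> lq_norm (ereal q1) n1 (\<lambda>k. x k - y k)) \<longrightarrow>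
        (\<forall>u :: nat \<Rightarrow> 'a \<Rightarrow> real. (\<forall>k<n1. u k \<in> \<F>) \<longrightarrow>
           (\<forall>l<n2. (\<lambda>x. T (\<lambda>k. u k x) l) \<in> \<F>) \<and>
           lq_norm q2 n2 (\<lambda>l. \<E> (\<lambda>x. T (\<lambda>k. u k x) l) powr (1 / p))
             \<le> lq_norm (ereal q1) n1 (\<lambda>k. \<E> (u k) powr (1 / p))))"

definition constant_functions :: "('a \<Rightarrow> real) set" where
  "constant_functions = {u. \<exists>c. u = (\<lambda>_. c)}"

definition resistance ::
    "real \<Rightarrow> (('a \<Rightarrow> real) \<Rightarrow> real) \<Rightarrow> ('a \<Rightarrow> real) set \<Rightarrow> 'a \<Rightarrow> 'a \<Rightarrow> ennreal" where
  "resistance p \<E> \<F> x y =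
     (SUP u \<in> \<F> - constant_functions. ennreal (\<bar>u x - u y\<bar> powr p / \<E> u))"

text \<open>The clause on Cauchy sequences is completeness of \<open>\<F> / \<real>1\<close> under \<open>\<E>^(1/p)\<close>, written with
  representatives. Values of \<open>\<E>\<close> outside \<open>\<F>\<close> are irrelevant.\<close>

definition p_resistance_form ::
    "real \<Rightarrow> (('a \<Rightarrow> real) \<Rightarrow> real) \<Rightarrow> ('a \<Rightarrow> real) set \<Rightarrow> bool" where
  "p_resistance_form p \<E> \<F> \<longleftrightarrow>
     constant_functions \<subseteq> \<F> \<and>
     (\<forall>u\<in>\<F>. \<forall>v\<in>\<F>. (\<lambda>x. u x + v x) \<in> \<F>) \<and>
     (\<forall>u\<in>\<F>. \<forall>a. (\<lambda>x. a * u x) \<in> \<F>) \<and>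
     (\<forall>u\<in>\<F>. \<E> u \<ge> 0) \<and>
     (\<forall>u\<in>\<F>. \<forall>a. \<E> (\<lambda>x. a * u x) powr (1 / p) = \<bar>a\<bar> * \<E> u powr (1 / p)) \<and>
     (\<forall>u\<in>\<F>. \<forall>v\<in>\<F>. \<E> (\<lambda>x. u x + v x) powr (1 / p) \<le> \<E> u powr (1 / p) + \<E> v powr (1 / p)) \<and>
     {u \<in> \<F>. \<E> u powr (1 / p) = 0} = constant_functions \<and>
     (\<forall>u :: nat \<Rightarrow> 'a \<Rightarrow> real.
        (\<forall>n. u n \<in> \<F>) \<longrightarrow>
        (\<forall>\<epsilon>>0. \<exists>N. \<forall>k\<ge>N. \<forall>n\<ge>N. \<E> (\<lambda>x. u k x - u n x) powr (1 / p) < \<epsilon>) \<longrightarrow>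
        (\<exists>v\<in>\<F>. (\<lambda>n. \<E> (\<lambda>x. u n x - v x) powr (1 / p)) \<longlonglongrightarrow> 0)) \<and>
     (\<forall>x y. x \<noteq> y \<longrightarrow> (\<exists>u\<in>\<F>. u x \<noteq> u y)) \<and>
     (\<forall>x y. resistance p \<E> \<F> x y < \<infinity>) \<and>
     generalized_contraction p \<E> \<F>"

definition self_similar_p_resistance_form ::
    "real \<Rightarrow> 'i set \<Rightarrow> ('i \<Rightarrow> 'a::topological_space \<Rightarrow> 'a) \<Rightarrow> ('i \<Rightarrow> real) \<Rightarrow>
     (('a \<Rightarrow> real) \<Rightarrow> real) \<Rightarrow> ('a \<Rightarrow> real) set \<Rightarrow> bool" where
  "self_similar_p_resistance_form p S F \<rho> \<E> \<F> \<longleftrightarrow>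
     p_resistance_form p \<E> \<F> \<and>
     (\<forall>i\<in>S. \<rho> i > 0) \<and>
     \<F> = {u. continuous_on UNIV u \<and> (\<forall>i\<in>S. u \<circ> F i \<in> \<F>)} \<and>
     (\<forall>u\<in>\<F>. \<E> u = (\<Sum>i\<in>S. \<rho> i * \<E> (u \<circ> F i)))"

definition resistance_metric ::
    "real \<Rightarrow> (('a \<Rightarrow> real) \<Rightarrow> real) \<Rightarrow> ('a \<Rightarrow> real) set \<Rightarrow> 'a \<Rightarrow> 'a \<Rightarrow> real" where
  "resistance_metric p \<E> \<F> x y = enn2real (resistance p \<E> \<F> x y) powr (1 / (p - 1))"

definition resistance_ball ::
    "real \<Rightarrow> (('a \<Rightarrow> real) \<Rightarrow> real) \<Rightarrow> ('a \<Rightarrow> real) set \<Rightarrow> 'a \<Rightarrow> real \<Rightarrow> 'a set" where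
  "resistance_ball p \<E> \<F> x s = {y. resistance_metric p \<E> \<F> x y < s}"

section \<open>Energy measures\<close>

text \<open>\<open>energy_form p \<E> u v\<close> is \<open>\<E>(u; v)\<close>.\<close>

definition energy_form ::
    "real \<Rightarrow> (('a \<Rightarrow> real) \<Rightarrow> real) \<Rightarrow> ('a \<Rightarrow> real) \<Rightarrow> ('a \<Rightarrow> real) \<Rightarrow> real" where
  "energy_form p \<E> u v = 1 / p * deriv (\<lambda>t. \<E> (\<lambda>x. u x + t * v x)) 0"

text \<open>Radon measures on an open subset \<open>U\<close> of a compact metrizable space: Borel measures that are
  finite on compact sets (regularity is then automatic).\<close>

definition radon_measure_on :: "'a::topological_space set \<Rightarrow> 'a measure \<Rightarrow> bool" where
  "radon_measure_on U \<mu> \<longleftrightarrow>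
     space \<mu> = U \<and> sets \<mu> = sets (restrict_space borel U) \<and>
     (\<forall>C. compact C \<longrightarrow> C \<subseteq> U \<longrightarrow> emeasure \<mu> C < \<infinity>)"

definition is_energy_measure ::
    "real \<Rightarrow> (('a \<Rightarrow> real) \<Rightarrow> real) \<Rightarrow> ('a::topological_space \<Rightarrow> real) set \<Rightarrow>
     ('a \<Rightarrow> real) \<Rightarrow> 'a measure \<Rightarrow> bool" where
  "is_energy_measure p \<E> \<F> u \<mu> \<longleftrightarrow>
     radon_measure_on UNIV \<mu> \<and>
     (\<forall>\<phi>\<in>\<F>. (\<integral>x. \<phi> x \<partial>\<mu>) =
        energy_form p \<E> u (\<lambda>x. u x * \<phi> x)
        - ((p - 1) / p) powr (p - 1) * energy_form p \<E> (\<lambda>x. \<bar>u x\<bar> powr (p / (p - 1))) \<phi>)"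

definition relatively_compact_in :: "'a::topological_space set \<Rightarrow> 'a set \<Rightarrow> bool" where
  "relatively_compact_in A U \<longleftrightarrow> compact (closure A) \<and> closure A \<subseteq> U"

text \<open>Functions on \<open>U\<close> are represented by functions on the whole space whose values outside
  \<open>U\<close> are irrelevant.\<close>

definition local_domain ::
    "('a::topological_space \<Rightarrow> real) set \<Rightarrow> 'a set \<Rightarrow> ('a \<Rightarrow> real) set" where
  "local_domain \<F> U =
     {f. continuous_on U f \<and>
         (\<forall>A. open A \<longrightarrow> relatively_compact_in A U \<longrightarrow> (\<exists>g\<in>\<F>. \<forall>x\<in>A. f x = g x))}"

definition is_local_energy_measure ::
    "(('a::topological_space \<Rightarrow> real) \<Rightarrow> 'a measure) \<Rightarrow> ('a \<Rightarrow> real) set \<Rightarrow> 'a set \<Rightarrow>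
     ('a \<Rightarrow> real) \<Rightarrow> 'a measure \<Rightarrow> bool" where
  "is_local_energy_measure \<Gamma> \<F> U f \<mu> \<longleftrightarrow>
     radon_measure_on U \<mu> \<and>
     (\<forall>E A g. E \<in> sets borel \<longrightarrow> relatively_compact_in E U \<longrightarrow>
        open A \<longrightarrow> relatively_compact_in A U \<longrightarrow> E \<subseteq> A \<longrightarrow>
        g \<in> \<F> \<longrightarrow> (\<forall>x\<in>A. f x = g x) \<longrightarrow> emeasure \<mu> E = emeasure (\<Gamma> g) E)"

section \<open>Korevaar-Schoen functional and extended energy\<close>

text \<open>The double integral over \<open>x \<in> A\<close> and \<open>y\<close> in the resistance ball \<open>B(x, s)\<close>; \<open>d\<close> is the
  dimension \<open>d\<^sub>f\<close>.\<close>

definition ks_functional ::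
    "real \<Rightarrow> (('a \<Rightarrow> real) \<Rightarrow> real) \<Rightarrow> ('a \<Rightarrow> real) set \<Rightarrow> real \<Rightarrow> 'a measure \<Rightarrow>
     'a set \<Rightarrow> ('a \<Rightarrow> real) \<Rightarrow> real \<Rightarrow> ennreal" where
  "ks_functional p \<E> \<F> d m A f s =
     (\<integral>\<^sup>+x\<in>A. (1 / emeasure m (resistance_ball p \<E> \<F> x s) *
        (\<integral>\<^sup>+y\<in>resistance_ball p \<E> \<F> x s.
           ennreal (\<bar>f x - f y\<bar> powr p / s powr (d + p - 1)) \<partial>m)) \<partial>m)"

text \<open>The energy of the \<open>m\<close>-class of \<open>f\<close> is that of its representative in \<open>\<F>\<close>, if there is one.
  Elements of \<open>\<F>\<close> are continuous and \<open>m\<close> has full support, so the representative is unique.\<close>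

definition extended_energy ::
    "'a measure \<Rightarrow> (('a \<Rightarrow> real) \<Rightarrow> real) \<Rightarrow> ('a \<Rightarrow> real) set \<Rightarrow> ('a \<Rightarrow> real) \<Rightarrow> ennreal" where
  "extended_energy m \<E> \<F> f =
     (if \<exists>u\<in>\<F>. AE x in m. f x = u x
      then ennreal (\<E> (SOME u. u \<in> \<F> \<and> (AE x in m. f x = u x)))
      else \<infinity>)"

end

theory Submission
  imports Defs
begin

text \<open>
  Both inequalities say that the Korevaar-Schoen functional at small scales controls the energy,
  locally on cells. The proof is a discretization.

  Fix a small scale \<open>s\<close> and partition \<open>K\<close> into cells \<open>K\<^sub>w = F\<^sub>w(K)\<close> of resistance diameter about \<open>s\<close>
  (\<open>cells\<close>). Two facts about this partition come from the finiteness of the post-critical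
  set: distinct cells meet only in vertices, the images of the finite set \<open>V0\<close>
  (\<open>cells_intersect\<close>), and every cell has a bounded number of neighbours (\<open>card_neighbours\<close>).
  By the first, functions prescribed at the vertices can be glued from scaled copies of
  finitely many model functions (\<open>glue\<close>). This yields cutoff functions of controlled energy, so leaving
  the neighbourhood of a cell costs a definite resistance (\<open>close_points_neighbours\<close>), and a ball of
  radius \<open>s\<close> has mass at most of order \<open>s powr d\<close> (\<open>ball_measure_upper\<close>). Bounding the denominators in the
  functional accordingly and restricting the double integral to adjacent cells, one finds that \<open>s powr (p - 1)\<close> times the functional
  dominates the sum of the mean p-th powers of \<open>f(x) - f(y)\<close>, \<open>x\<close> and \<open>y\<close> in adjacent
  cells (\<open>cell_differences_le_ks\<close>).

  Now replace \<open>f\<close> by the glued function \<open>h\<close> whose value at a vertex is \<open>f(F\<^sub>w(y))\<close>, where \<open>w\<close> is a cell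
  containing the vertex and \<open>y\<close> is one point of \<open>K\<close>, the same for all cells and at least as good as the
  average point (\<open>good_base_point\<close>). The energy of \<open>h\<close> on a cell is bounded by differences between
  adjacent cells divided by \<open>s powr (p - 1)\<close>, hence in total by the functional, while the p-th power of the
  distance from \<open>f\<close> in \<open>L\<^sup>p\<close> carries an additional factor \<open>s powr (p - 1)\<close> and tends to zero (\<open>ks_approximation\<close>).
  Lower semicontinuity of the energy in \<open>L\<^sup>p\<close> (\<open>energy_lower_semicontinuous\<close>) then gives the estimate
  on every set of cells of a fixed partition (\<open>local_energy_le_ks\<close>); for the trivial partition
  this is the global inequality.

  Lower semicontinuity rests on uniform convexity: by the generalized contraction
  property the energy inherits it from \<open>\<real>\<^sup>2\<close>, so almost minimal elements of
  decreasing convex sets are Cauchy (\<open>nested_convex_minimizers\<close>), and energy convergence implies uniform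
  convergence up to constants because the resistance is bounded (\<open>res_bounded\<close>).

  For the local inequality it remains to bound the energy measure of \<open>E\<close> by the energies on the cells near
  \<open>E\<close> (\<open>\<Gamma>_le_energy\<close>). The generalized contraction property also makes the energy
  differentiable (\<open>energy_differentiable\<close>), so the formula that defines the energy measures is
  self-similar. Testing it with a cutoff function that is 1 on the cells meeting \<open>E\<close> and 0 off their
  neighbours gives the bound, since an energy measure has total mass equal to the energy.
\<close>

section \<open>Inequalities for powers of real numbers\<close>

lemma powr_convex_nonneg:
  fixes a b t p :: real
  assumes "1 \<le> p" "0 \<le> a" "0 \<le> b" "0 \<le> t" "t \<le> 1"
  shows "((1 - t) * a + t * b) powr p \<le> (1 - t) * a powr p + t * b powr p"
proof -
  have aux: "(r * c) powr p \<le> r * c powr p" if "0 \<le> r" "r \<le> 1" "0 \<le> c" for r c :: real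
  proof -
    have "r powr p \<le> r"
      using that assms(1) powr_le_one_le[of r p] by (cases "r = 0") auto
    then show ?thesis using that by (simp add: powr_mult mult_right_mono)
  qed
  consider "a = 0" | "b = 0" | "0 < a" "0 < b" using assms by linarith
  then show ?thesis
  proof cases
    case 1 then show ?thesis using aux[of t b] assms by simp
  next
    case 2 then show ?thesis using aux[of "1 - t" a] assms by simp
  next
    case 3
    then show ?thesis
      using convex_onD[OF powr_convex[OF assms(1)], of t a b] assms by auto
  qed
qed

lemma powr_sum_le_card:
  fixes f :: "'b \<Rightarrow> real"
  assumes "finite A" "1 \<le> p" "\<And>i. i \<in> A \<Longrightarrow> 0 \<le> f i"
  shows "(\<Sum>i\<in>A. f i) powr p \<le> real (card A) powr p * (\<Sum>i\<in>A. f i powr p)"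
proof (cases "A = {}")
  case False
  define M where "M = Max (f ` A)"
  have M: "f i \<le> M" if "i \<in> A" for i
    using that assms(1) by (auto simp: M_def)
  obtain j where j: "j \<in> A" "M = f j"
    using Max_in[of "f ` A"] False assms(1) unfolding M_def by blast
  have "(\<Sum>i\<in>A. f i) \<le> real (card A) * M"
    using sum_bounded_above[of A f M] M by simp
  then have "(\<Sum>i\<in>A. f i) powr p \<le> (real (card A) * M) powr p"
    using assms by (intro powr_mono2) (auto intro!: sum_nonneg)
  also have "\<dots> = real (card A) powr p * f j powr p"
    using j assms by (simp add: powr_mult)
  also have "f j powr p \<le> (\<Sum>i\<in>A. f i powr p)"
    using j assms by (intro member_le_sum) auto
  finally show ?thesis by (simp add: mult_left_mono)
qed auto

lemma powr_add_le_two: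
  fixes a b p :: real
  assumes "1 \<le> p" "0 \<le> a" "0 \<le> b"
  shows "(a + b) powr p \<le> 2 powr p * (a powr p + b powr p)"
  using powr_sum_le_card[of "{False, True}" p "\<lambda>i. if i then a else b"] assms
  by (auto simp: add.commute split: if_splits)

lemma powr_add_superadditive:
  fixes a b q :: real
  assumes "1 \<le> q" "0 \<le> a" "0 \<le> b"
  shows "a powr q + b powr q \<le> (a + b) powr q"
proof (cases "a + b = 0")
  case False
  then have pos: "a + b > 0" using assms by linarith
  have *: "c powr q \<le> c / (a + b) * (a + b) powr q" if "0 \<le> c" "c \<le> a + b" for c
  proof -
    have "(c / (a + b)) powr q \<le> c / (a + b)"
      using that pos assms(1) powr_le_one_le[of "c / (a + b)" q] by (cases "c = 0") auto
    then show ?thesis using that pos by (simp add: powr_divide pos_divide_le_eq)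
  qed
  have "a powr q + b powr q \<le> a / (a + b) * (a + b) powr q + b / (a + b) * (a + b) powr q"
    using assms by (intro add_mono *) auto
  also have "\<dots> = (a + b) powr q"
    using pos by (simp add: add_divide_distrib[symmetric] distrib_right[symmetric])
  finally show ?thesis .
qed (use assms in \<open>auto simp: add_nonneg_eq_0_iff\<close>)

lemma powr_add_subadditive:
  fixes a b q :: real
  assumes "0 < q" "q \<le> 1" "0 \<le> a" "0 \<le> b"
  shows "(a + b) powr q \<le> a powr q + b powr q"
proof -
  have "(a powr q) powr (1/q) + (b powr q) powr (1/q) \<le> (a powr q + b powr q) powr (1/q)"
    using assms by (intro powr_add_superadditive) auto
  then have "a + b \<le> (a powr q + b powr q) powr (1/q)"
    using assms by (simp add: powr_powr)
  then have "(a + b) powr q \<le> ((a powr q + b powr q) powr (1/q)) powr q"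
    using assms by (intro powr_mono2) auto
  then show ?thesis using assms by (simp add: powr_powr)
qed

lemma bernoulli_powr:
  fixes x q :: real
  assumes "1 \<le> q" "0 \<le> x"
  shows "1 + x \<le> (1 + x) powr q"
  using powr_mono[of 1 q "1 + x"] assms by simp

lemma abs_powr_eq_square: "\<bar>z::real\<bar> powr p = (z\<^sup>2) powr (p / 2)"
proof -
  have "z\<^sup>2 = \<bar>z\<bar> powr 2" by (simp add: powr_numeral)
  then show ?thesis by (simp only: powr_powr) simp
qed

text \<open>Second-order Taylor bounds with crude constants, from applying the mean value theorem first to
  the second difference and then to its derivative. The direction flips at \<open>p = 2\<close> because there
  \<open>z powr (p - 2)\<close> changes its monotonicity.\<close>

lemma second_difference_powr:
  fixes p t :: real
  assumes p: "1 < p" and t: "0 \<le> t" "t \<le> 1"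
  shows "2 \<le> p \<Longrightarrow> (1 + t) powr p + (1 - t) powr p \<le> 2 + p * (p - 1) * 2 powr (p - 1) * t\<^sup>2"
    and "p \<le> 2 \<Longrightarrow> 2 + p * (p - 1) * 2 powr (p - 2) * t\<^sup>2 \<le> (1 + t) powr p + (1 - t) powr p"
proof -
  define g where "g = (\<lambda>s::real. (1 + s) powr p + (1 - s) powr p)"
  have cont: "continuous_on {0..t} g"
    unfolding g_def using p t by (intro continuous_intros continuous_on_powr') auto
  have deriv: "(g has_real_derivative p * ((1 + s) powr (p - 1) - (1 - s) powr (p - 1))) (at s)"
    if "0 < s" "s < t" for s
    unfolding g_def using that t by (auto intro!: derivative_eq_intros simp: algebra_simps)
  have key: "\<exists>s z. 0 < s \<and> s < t \<and> 0 < z \<and> z < 2 \<and> g t = 2 + t * (p * (p - 1) * (2 * s) * z powr (p - 2))" if t0: "t > 0"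
  proof -
    obtain l s where s: "0 < s" "s < t" "(g has_real_derivative l) (at s)" "g t - g 0 = (t - 0) * l"
      using MVT[OF t0 cont] deriv by (metis real_differentiable_def)
    have l: "l = p * ((1 + s) powr (p - 1) - (1 - s) powr (p - 1))"
      using DERIV_unique[OF s(3) deriv[OF s(1,2)]] .
    have "\<exists>z>1 - s. z < 1 + s \<and> (1 + s) powr (p - 1) - (1 - s) powr (p - 1)
        = (1 + s - (1 - s)) * ((p - 1) * z powr (p - 1 - 1))"
      using s t by (intro MVT2) (auto intro!: derivative_eq_intros)
    then obtain z where z: "z > 1 - s" "z < 1 + s"
        "(1 + s) powr (p - 1) - (1 - s) powr (p - 1) = (2 * s) * ((p - 1) * z powr (p - 2))"
      by (auto simp: algebra_simps)
    have "g t = 2 + t * (p * (p - 1) * (2 * s) * z powr (p - 2))"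
      using s(4) unfolding l z(3) by (simp add: g_def algebra_simps)
    then show ?thesis using s z t by (intro exI[of _ s] exI[of _ z]) auto
  qed
  show "(1 + t) powr p + (1 - t) powr p \<le> 2 + p * (p - 1) * 2 powr (p - 1) * t\<^sup>2" if p2: "2 \<le> p"
  proof (cases "t = 0")
    case False
    then obtain s z where sz: "0 < s" "s < t" "0 < z" "z < 2"
        "g t = 2 + t * (p * (p - 1) * (2 * s) * z powr (p - 2))" using key t by auto
    have "z powr (p - 2) \<le> 2 powr (p - 2)" using sz p2 by (intro powr_mono2) auto
    then have "t * (p * (p - 1) * (2 * s) * z powr (p - 2)) \<le> t * (p * (p - 1) * (2 * t) * 2 powr (p - 2))"
      using sz p t by (intro mult_left_mono mult_mono) auto
    also have "\<dots> = p * (p - 1) * (2 powr 1 * 2 powr (p - 2)) * t\<^sup>2"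
      by (simp add: power2_eq_square)
    also have "2 powr 1 * 2 powr (p - 2) = (2::real) powr (p - 1)"
      by (subst powr_add[symmetric]) (simp add: algebra_simps)
    finally show ?thesis using sz(5) unfolding g_def by simp
  qed simp
  show "2 + p * (p - 1) * 2 powr (p - 2) * t\<^sup>2 \<le> (1 + t) powr p + (1 - t) powr p" if p2: "p \<le> 2"
  proof -
    define h where "h = (\<lambda>s::real. g s - p * (p - 1) * 2 powr (p - 2) * s\<^sup>2)"
    have "h 0 \<le> h t"
    proof (rule DERIV_nonneg_imp_increasing_open[where f = h])
      fix s :: real assume s: "0 < s" "s < t"
      have "\<exists>z>1 - s. z < 1 + s \<and> (1 + s) powr (p - 1) - (1 - s) powr (p - 1)
        = (1 + s - (1 - s)) * ((p - 1) * z powr (p - 1 - 1))"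
        using s t by (intro MVT2) (auto intro!: derivative_eq_intros)
      then obtain z where z: "z > 1 - s" "z < 1 + s"
        "(1 + s) powr (p - 1) - (1 - s) powr (p - 1) = (2 * s) * ((p - 1) * z powr (p - 2))"
        by (auto simp: algebra_simps)
      have "2 powr (p - 2) \<le> z powr (p - 2)" using z s t p2 by (intro powr_mono2') auto
      then have ge: "p * (p - 1) * 2 powr (p - 2) * (2 * s) \<le> p * ((2 * s) * ((p - 1) * z powr (p - 2)))"
        using mult_left_mono[of "2 powr (p - 2)" "z powr (p - 2)" "p * (p - 1) * (2 * s)"] s p
        by (simp add: mult_ac)
      have "(h has_real_derivative p * ((1 + s) powr (p - 1) - (1 - s) powr (p - 1))
           - p * (p - 1) * 2 powr (p - 2) * (2 * s)) (at s)"
        unfolding h_def by (rule derivative_eq_intros deriv[OF s] refl | simp)+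
      then show "\<exists>y. (h has_real_derivative y) (at s) \<and> 0 \<le> y"
        using ge unfolding z(3) by fastforce
    next
      show "continuous_on {0..t} h" unfolding h_def by (intro continuous_intros cont)
    qed (use t in auto)
    then show ?thesis by (simp add: h_def g_def)
  qed
qed

text \<open>The right-hand side exceeds \<open>2 * \<bar>x\<bar> powr p\<close> only by a term of order \<open>\<bar>y\<bar>\<close> to the power \<open>min p 2 > 1\<close>, which is what
  makes the energy differentiable. For \<open>p \<le> 2\<close> the power mean inequality gives \<open>k = 1\<close>.
  For \<open>p > 2\<close> homogeneity reduces the claim to \<open>x = 1\<close>; small increments are covered by the second-order
  bound and large ones by choosing \<open>k\<close> small.\<close>

lemma smoothness_inequality:
  fixes p :: real
  assumes p: "1 < p"
  shows "\<exists>k>0. \<forall>x y::real. \<bar>x + k * y\<bar> powr p + \<bar>x - k * y\<bar> powr p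
           \<le> 2 * (\<bar>x\<bar> powr min p 2 + \<bar>y\<bar> powr min p 2) powr (p / min p 2)"
proof (cases "p \<le> 2")
  case True
  have "\<bar>x + y\<bar> powr p + \<bar>x - y\<bar> powr p \<le> 2 * (\<bar>x\<bar> powr p + \<bar>y\<bar> powr p)" for x y :: real
  proof -
    define a b where "a = \<bar>x + y\<bar> powr p" and "b = \<bar>x - y\<bar> powr p"
    have "((1 - 1/2) * a + 1/2 * b) powr (2/p) \<le> (1 - 1/2) * a powr (2/p) + 1/2 * b powr (2/p)"
      using p True by (intro powr_convex_nonneg) (auto simp: a_def b_def)
    also have "a powr (2/p) = (x + y)\<^sup>2"
      using p by (simp add: a_def powr_powr powr_numeral)
    also have "b powr (2/p) = (x - y)\<^sup>2"
      using p by (simp add: b_def powr_powr powr_numeral)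
    finally have "((a + b) / 2) powr (2/p) \<le> x\<^sup>2 + y\<^sup>2" by (simp add: power2_eq_square algebra_simps add_divide_distrib)
    then have "(((a + b) / 2) powr (2/p)) powr (p/2) \<le> (x\<^sup>2 + y\<^sup>2) powr (p/2)"
      using p by (intro powr_mono2) auto
    then have "(a + b) / 2 \<le> (x\<^sup>2 + y\<^sup>2) powr (p/2)"
      using p by (simp add: powr_powr a_def b_def)
    also have "\<dots> \<le> (x\<^sup>2) powr (p/2) + (y\<^sup>2) powr (p/2)"
      using p True by (intro powr_add_subadditive) auto
    also have "\<dots> = \<bar>x\<bar> powr p + \<bar>y\<bar> powr p"
      by (simp only: abs_powr_eq_square)
    finally show ?thesis by (simp add: a_def b_def)
  qed
  then show ?thesis using True p by (intro exI[of _ 1]) (auto simp: min_def)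
next
  case False
  then have p2: "2 \<le> p" by simp
  define C where "C = 1 + p * (p - 1) * 2 powr (p - 1)"
  have C: "C \<ge> 1" using p by (simp add: C_def)
  \<comment> \<open>the bound \<open>k\<^sup>2 * C \<le> 1\<close> serves increments up to 1, the bound \<open>k \<le> 1/2\<close> larger ones\<close>
  define k where "k = min (1/2) (1 / sqrt C)"
  have k: "0 < k" "k \<le> 1/2" "k\<^sup>2 * C \<le> 1"
  proof -
    have "k\<^sup>2 \<le> (1 / sqrt C)\<^sup>2" using C by (intro power_mono) (auto simp: k_def)
    then show "k\<^sup>2 * C \<le> 1" using C by (simp add: power_divide field_simps)
  qed (use C in \<open>auto simp: k_def\<close>)
  have one: "\<bar>1 + s\<bar> powr p + \<bar>1 - s\<bar> powr p \<le> 2 * (1 + (s/k)\<^sup>2) powr (p/2)" for s :: real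
  proof -
    have *: "\<bar>1 + s\<bar> powr p + \<bar>1 - s\<bar> powr p \<le> 2 * (1 + (s/k)\<^sup>2) powr (p/2)" if s: "0 \<le> s" for s
    proof (cases "s \<le> 1")
      case True
      have "\<bar>1 + s\<bar> powr p + \<bar>1 - s\<bar> powr p \<le> 2 + (C - 1) * s\<^sup>2"
        using second_difference_powr(1)[OF p s True p2] True s by (simp add: C_def)
      also have "\<dots> \<le> 2 * (1 + (s/k)\<^sup>2)"
      proof -
        have "k\<^sup>2 * C * s\<^sup>2 \<le> 1 * s\<^sup>2" using k by (intro mult_right_mono) auto
        then have "C * s\<^sup>2 \<le> (s/k)\<^sup>2" using k by (simp add: power_divide field_simps)
        moreover have "(C - 1) * s\<^sup>2 \<le> C * s\<^sup>2" by (intro mult_right_mono) auto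
        moreover have "0 \<le> (s/k)\<^sup>2" by simp
        moreover have "2 * (1 + (s/k)\<^sup>2) = 2 + 2 * (s/k)\<^sup>2" by simp
        ultimately show ?thesis by linarith
      qed
      also have "\<dots> \<le> 2 * (1 + (s/k)\<^sup>2) powr (p/2)"
        using bernoulli_powr[of "p/2" "(s/k)\<^sup>2"] p2 by simp
      finally show ?thesis .
    next
      case False
      have "\<bar>1 + s\<bar> powr p \<le> (2 * s) powr p" using False p by (intro powr_mono2) auto
      moreover have "\<bar>1 - s\<bar> powr p \<le> (2 * s) powr p" using False p by (intro powr_mono2) auto
      moreover have "(2 * s) powr p \<le> (1 + (s/k)\<^sup>2) powr (p/2)"
      proof -
        have "2 * s \<le> s / k" using k False by (simp add: field_simps)
        then have "(2 * s) powr p \<le> (s / k) powr p" using False p by (intro powr_mono2) auto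
        also have "(s/k) powr p = ((s/k)\<^sup>2) powr (p/2)"
          using False k abs_powr_eq_square[of "s/k" p] by simp
        also have "\<dots> \<le> (1 + (s/k)\<^sup>2) powr (p/2)" using p by (intro powr_mono2) auto
        finally show ?thesis .
      qed
      ultimately show ?thesis by linarith
    qed
    show ?thesis using *[of s] *[of "-s"] by (cases "0 \<le> s") (auto simp: add.commute)
  qed
  have "\<bar>x + k * y\<bar> powr p + \<bar>x - k * y\<bar> powr p \<le> 2 * (x\<^sup>2 + y\<^sup>2) powr (p/2)" for x y :: real
  proof (cases "x = 0")
    case True
    have "k powr p \<le> 1" using k p by (intro powr_le1) auto
    then have "\<bar>k * y\<bar> powr p \<le> 1 * \<bar>y\<bar> powr p"
      using k by (simp add: abs_mult powr_mult mult_left_le_one_le)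
    also have "\<bar>y\<bar> powr p = (y\<^sup>2) powr (p/2)"
      by (simp only: abs_powr_eq_square)
    finally show ?thesis using True by simp
  next
    case False
    define s where "s = k * y / x"
    have e: "x + k * y = x * (1 + s)" "x - k * y = x * (1 - s)" using False by (simp_all add: s_def algebra_simps)
    have "\<bar>x + k * y\<bar> powr p + \<bar>x - k * y\<bar> powr p = \<bar>x\<bar> powr p * (\<bar>1 + s\<bar> powr p + \<bar>1 - s\<bar> powr p)"
      unfolding e abs_mult by (simp add: powr_mult algebra_simps)
    also have "\<dots> \<le> \<bar>x\<bar> powr p * (2 * (1 + (s/k)\<^sup>2) powr (p/2))"
      by (intro mult_left_mono one) auto
    also have "\<bar>x\<bar> powr p = (x\<^sup>2) powr (p/2)"
      by (simp only: abs_powr_eq_square)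
    also have "(x\<^sup>2) powr (p/2) * (2 * (1 + (s/k)\<^sup>2) powr (p/2)) = 2 * (x\<^sup>2 * (1 + (s/k)\<^sup>2)) powr (p/2)"
      by (simp add: powr_mult)
    also have "x\<^sup>2 * (1 + (s/k)\<^sup>2) = x\<^sup>2 + y\<^sup>2"
      using False k by (simp add: s_def field_simps)
    finally show ?thesis .
  qed
  then show ?thesis using p2 k by (intro exI[of _ k]) (auto simp: min_def powr_numeral)
qed

text \<open>Uniform convexity of the plane with the \<open>\<ell>\<^sup>p\<close> norm, with a constant that leaves no slack at \<open>x = y\<close>. For
  \<open>p > 2\<close> it is superadditivity of \<open>t powr (p / 2)\<close>. For \<open>p \<le> 2\<close> put \<open>a = (x + y)/2\<close> and \<open>b = (x - y)/2\<close>; the larger of the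
  two may be taken to be 1, and the lower second-order bound applies.\<close>

lemma uniform_convexity_inequality:
  fixes p :: real
  assumes p: "1 < p"
  shows "\<exists>k>0. \<forall>x y::real. \<bar>x + y\<bar> powr max p 2 + \<bar>k * (x - y)\<bar> powr max p 2
           \<le> (2 powr (1 - 1 / min p 2)) powr max p 2
               * (\<bar>x\<bar> powr min p 2 + \<bar>y\<bar> powr min p 2) powr (max p 2 / min p 2)"
proof (cases "p \<le> 2")
  case False
  have "\<bar>x + y\<bar> powr p + \<bar>x - y\<bar> powr p \<le> (2 powr (1/2)) powr p * (x\<^sup>2 + y\<^sup>2) powr (p/2)" for x y :: real
  proof -
    have e: "\<bar>z\<bar> powr p = (z\<^sup>2) powr (p/2)" for z :: real
      by (simp only: abs_powr_eq_square)
    have "\<bar>x + y\<bar> powr p + \<bar>x - y\<bar> powr p \<le> ((x + y)\<^sup>2 + (x - y)\<^sup>2) powr (p/2)"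
      unfolding e using False by (intro powr_add_superadditive) auto
    also have "(x + y)\<^sup>2 + (x - y)\<^sup>2 = 2 * (x\<^sup>2 + y\<^sup>2)" by (simp add: power2_eq_square algebra_simps)
    also have "(2 * (x\<^sup>2 + y\<^sup>2)) powr (p/2) = (2 powr (1/2)) powr p * (x\<^sup>2 + y\<^sup>2) powr (p/2)"
      by (subst powr_mult) (simp_all add: powr_powr)
    finally show ?thesis .
  qed
  then show ?thesis using False by (intro exI[of _ 1]) (auto simp: min_def max_def powr_numeral)
next
  case True
  define c where "c = min 1 (p * (p - 1) * 2 powr (p - 2) / 2)"
  have c: "0 < c" "c \<le> 1" "2 * c \<le> p * (p - 1) * 2 powr (p - 2)" using p by (auto simp: c_def)
  have one: "1 + c * t\<^sup>2 \<le> ((\<bar>1 + t\<bar> powr p + \<bar>1 - t\<bar> powr p) / 2) powr (2/p)" if "\<bar>t\<bar> \<le> 1" for t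
  proof -
    have *: "1 + c * t\<^sup>2 \<le> ((\<bar>1 + t\<bar> powr p + \<bar>1 - t\<bar> powr p) / 2) powr (2/p)" if t: "0 \<le> t" "t \<le> 1" for t
    proof -
      have "2 * (1 + c * t\<^sup>2) = 2 + 2 * c * t\<^sup>2" by simp
      also have "\<dots> \<le> 2 + p * (p - 1) * 2 powr (p - 2) * t\<^sup>2" using c by (intro add_mono mult_right_mono) auto
      also have "\<dots> \<le> \<bar>1 + t\<bar> powr p + \<bar>1 - t\<bar> powr p"
        using second_difference_powr(2)[OF p t True] t by simp
      finally have "1 + c * t\<^sup>2 \<le> (\<bar>1 + t\<bar> powr p + \<bar>1 - t\<bar> powr p) / 2" by simp
      then have "(1 + c * t\<^sup>2) powr (2/p) \<le> ((\<bar>1 + t\<bar> powr p + \<bar>1 - t\<bar> powr p) / 2) powr (2/p)"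
        using p c by (intro powr_mono2) auto
      moreover have "1 + c * t\<^sup>2 \<le> (1 + c * t\<^sup>2) powr (2/p)"
        using p True c by (intro bernoulli_powr) auto
      ultimately show ?thesis by linarith
    qed
    show ?thesis using *[of t] *[of "-t"] that by (cases "0 \<le> t") (auto simp: add.commute)
  qed
  have two: "a\<^sup>2 + c * b\<^sup>2 \<le> ((\<bar>a + b\<bar> powr p + \<bar>a - b\<bar> powr p) / 2) powr (2/p)" for a b :: real
  proof -
    have *: "a\<^sup>2 + c * b\<^sup>2 \<le> ((\<bar>a + b\<bar> powr p + \<bar>a - b\<bar> powr p) / 2) powr (2/p)" if ab: "\<bar>b\<bar> \<le> \<bar>a\<bar>" "a \<noteq> 0" for a b
    proof -
      have e: "a + b = a * (1 + b/a)" "a - b = a * (1 - b/a)" using ab by (simp_all add: algebra_simps)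
      have "(\<bar>a + b\<bar> powr p + \<bar>a - b\<bar> powr p) / 2 = \<bar>a\<bar> powr p * ((\<bar>1 + b/a\<bar> powr p + \<bar>1 - b/a\<bar> powr p) / 2)"
        unfolding e abs_mult by (simp add: powr_mult algebra_simps)
      then have "((\<bar>a + b\<bar> powr p + \<bar>a - b\<bar> powr p) / 2) powr (2/p)
         = a\<^sup>2 * ((\<bar>1 + b/a\<bar> powr p + \<bar>1 - b/a\<bar> powr p) / 2) powr (2/p)"
        using p by (simp only: powr_mult powr_powr) (simp add: powr_numeral)
      moreover have "a\<^sup>2 * (1 + c * (b/a)\<^sup>2) \<le> a\<^sup>2 * ((\<bar>1 + b/a\<bar> powr p + \<bar>1 - b/a\<bar> powr p) / 2) powr (2/p)"
        using ab by (intro mult_left_mono one) auto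
      moreover have "a\<^sup>2 * (1 + c * (b/a)\<^sup>2) = a\<^sup>2 + c * b\<^sup>2" using ab by (simp add: field_simps)
      ultimately show ?thesis by simp
    qed
    consider "\<bar>b\<bar> \<le> \<bar>a\<bar>" "a \<noteq> 0" | "\<bar>a\<bar> \<le> \<bar>b\<bar>" "b \<noteq> 0" | "a = 0" "b = 0" by linarith
    then show ?thesis
    proof cases
      case 2
      have "c * (b\<^sup>2 - a\<^sup>2) \<le> 1 * (b\<^sup>2 - a\<^sup>2)" using c 2 by (intro mult_right_mono) (auto simp: abs_le_square_iff)
      then have "a\<^sup>2 + c * b\<^sup>2 \<le> b\<^sup>2 + c * a\<^sup>2" by (simp add: algebra_simps)
      then show ?thesis using *[OF 2] by (simp add: abs_minus_commute add.commute)
    qed (use * in auto)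
  qed
  have "\<bar>x + y\<bar>\<^sup>2 + \<bar>sqrt c * (x - y)\<bar>\<^sup>2 \<le> (2 powr (1 - 1/p))\<^sup>2 * (\<bar>x\<bar> powr p + \<bar>y\<bar> powr p) powr (2/p)" for x y
  proof -
    have "((x + y)/2)\<^sup>2 + c * ((x - y)/2)\<^sup>2 \<le> ((\<bar>x\<bar> powr p + \<bar>y\<bar> powr p) / 2) powr (2/p)"
      using two[of "(x + y)/2" "(x - y)/2"] by (simp add: field_simps)
    then have "\<bar>x + y\<bar>\<^sup>2 + \<bar>sqrt c * (x - y)\<bar>\<^sup>2 \<le> 4 * ((\<bar>x\<bar> powr p + \<bar>y\<bar> powr p) / 2) powr (2/p)"
      using c by (simp add: power_mult_distrib power_divide)
    also have "\<dots> = 4 * (1/2) powr (2/p) * (\<bar>x\<bar> powr p + \<bar>y\<bar> powr p) powr (2/p)"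
      by (simp add: powr_divide)
    also have "4 * (1/2) powr (2/p) = (2 powr (1 - 1/p))\<^sup>2"
    proof -
      have "(2 powr (1 - 1/p))\<^sup>2 = (2 powr (1 - 1/p)) powr 2" by (simp add: powr_numeral)
      also have "\<dots> = (2::real) powr (2 + - (2/p))" by (simp add: powr_powr algebra_simps)
      also have "\<dots> = 4 * (1/2) powr (2/p)" by (subst powr_add) (simp add: powr_divide powr_minus_divide)
      finally show ?thesis by simp
    qed
    finally show ?thesis .
  qed
  then show ?thesis using c True p by (intro exI[of _ "sqrt c"]) (auto simp: min_def max_def powr_numeral)
qed

section \<open>Consequences of the generalized contraction property\<close>

lemma lq_norm_one: "lq_norm (ereal q) 1 x = \<bar>x 0\<bar>" if "q > 0"
  using that by (simp add: lq_norm_def powr_powr)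

lemma lq_norm_two:
  "lq_norm (ereal q) 2 x = (\<bar>x 0\<bar> powr q + \<bar>x 1\<bar> powr q) powr (1 / q)"
  by (simp add: lq_norm_def numeral_2_eq_2)

text \<open>The slopes of a convex function at 0 are monotone, so they converge from the right; a second
  difference of order \<open>o(t)\<close> forces the slopes from the left to the same limit.\<close>

lemma midpoint_slopes_differentiable:
  fixes D :: "real \<Rightarrow> real"
  assumes cvx: "convex_on UNIV D"
    and smooth: "((\<lambda>t. (D t + D (-t) - 2 * D 0) / t) \<longlongrightarrow> 0) (at_right 0)"
  shows "D differentiable (at 0)"
proof -
  define sl where "sl = (\<lambda>t. (D t - D 0) / t)"
  have mono: "sl s \<le> sl t" if st: "s < t" "s \<noteq> 0" "t \<noteq> 0" for s t
  proof -
    have three: "(D y - D x) / (y - x) \<le> (D z - D x) / (z - x) \<and> (D z - D x) / (z - x) \<le> (D z - D y) / (z - y)"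
      if "x < y" "y < z" for x y z
    proof -
      have flip: "(D b - D a) / (b - a) = (D a - D b) / (a - b)" for a b
        by (metis minus_diff_eq minus_divide_divide)
      show ?thesis
        using convex_on_slope_le[OF cvx, of x z y] that by (simp add: flip[of y x] flip[of z x] flip[of z y])
    qed
    consider "0 < s" | "s < 0" "0 < t" | "t < 0" using st by linarith
    then show ?thesis
    proof cases
      case 1 then show ?thesis using three[of 0 s t] st by (simp add: sl_def)
    next
      case 2
      then show ?thesis using three[of s 0 t] by (simp add: sl_def field_simps)
    next
      case 3
      have "(D 0 - D s) / (0 - s) \<le> (D 0 - D t) / (0 - t)" using three[of s t 0] st 3 by simp
      then show ?thesis by (simp add: sl_def minus_divide_right[symmetric] diff_divide_distrib)
    qed
  qed
  define l where "l = Inf (sl ` {0<..})"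
  have bdd: "bdd_below (sl ` {0<..})"
    using mono[of "-1"] by (intro bdd_belowI[of _ "sl (-1)"]) auto
  have right: "(sl \<longlongrightarrow> l) (at_right 0)"
  proof (rule order_tendstoI)
    fix a assume "a < l"
    moreover have "l \<le> sl t" if "t > 0" for t
      unfolding l_def using bdd that by (intro cInf_lower) auto
    ultimately show "\<forall>\<^sub>F t in at_right 0. a < sl t"
      by (intro eventually_at_rightI[of 0 1]) (auto intro: less_le_trans)
  next
    fix a assume "l < a"
    then obtain t where "t > 0" "sl t < a"
      unfolding l_def using cInf_lessD[of "sl ` {0<..}" a] by auto
    then show "\<forall>\<^sub>F t in at_right 0. sl t < a"
      using le_less_trans[OF mono] by (intro eventually_at_rightI[of 0 t]) auto
  qed
  have "((\<lambda>t. sl t - (D t + D (-t) - 2 * D 0) / t) \<longlongrightarrow> l - 0) (at_right 0)"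
    by (intro tendsto_diff right smooth)
  moreover have "\<forall>\<^sub>F t in at_right 0. sl t - (D t + D (-t) - 2 * D 0) / t = sl (-t)"
    by (intro eventually_at_rightI[of 0 1]) (auto simp: sl_def field_simps)
  ultimately have "((\<lambda>t. sl (-t)) \<longlongrightarrow> l) (at_right 0)"
    using tendsto_cong by fastforce
  then have "(sl \<longlongrightarrow> l) (at_left 0)"
    by (subst filterlim_at_left_to_right) simp
  with right have "(sl \<longlongrightarrow> l) (at 0)"
    by (simp add: filterlim_split_at)
  then have "(D has_real_derivative l) (at 0)"
    by (simp add: has_field_derivative_iff sl_def)
  then show ?thesis by (auto simp: real_differentiable_def)
qed

locale resistance_form =
  fixes p :: real and \<E> :: "('a \<Rightarrow> real) \<Rightarrow> real" and \<F> :: "('a \<Rightarrow> real) set"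
  assumes p_gt_1: "1 < p" and form: "p_resistance_form p \<E> \<F>"
begin

definition seminorm :: "('a \<Rightarrow> real) \<Rightarrow> real" where
  "seminorm u = \<E> u powr (1 / p)"

lemma const_mem: "(\<lambda>_. c) \<in> \<F>"
  using form by (auto simp: p_resistance_form_def constant_functions_def)

lemma add_mem: "u \<in> \<F> \<Longrightarrow> v \<in> \<F> \<Longrightarrow> (\<lambda>x. u x + v x) \<in> \<F>"
  using form by (auto simp: p_resistance_form_def)

lemma scale_mem: "u \<in> \<F> \<Longrightarrow> (\<lambda>x. a * u x) \<in> \<F>"
  using form by (auto simp: p_resistance_form_def)

lemma diff_mem: "u \<in> \<F> \<Longrightarrow> v \<in> \<F> \<Longrightarrow> (\<lambda>x. u x - v x) \<in> \<F>"
  using add_mem[OF _ scale_mem[of v "-1"]] by simp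

lemma sum_mem: "finite I \<Longrightarrow> (\<And>i. i \<in> I \<Longrightarrow> u i \<in> \<F>) \<Longrightarrow> (\<lambda>x. \<Sum>i\<in>I. u i x) \<in> \<F>"
  by (induction I rule: finite_induct) (auto intro: const_mem add_mem)

lemma energy_nonneg: "u \<in> \<F> \<Longrightarrow> 0 \<le> \<E> u"
  using form by (auto simp: p_resistance_form_def)

lemma seminorm_nonneg: "0 \<le> seminorm u"
  by (simp add: seminorm_def)

lemma energy_eq_seminorm: "u \<in> \<F> \<Longrightarrow> \<E> u = seminorm u powr p"
  using energy_nonneg p_gt_1 by (simp add: seminorm_def powr_powr)

lemma seminorm_scale: "u \<in> \<F> \<Longrightarrow> seminorm (\<lambda>x. a * u x) = \<bar>a\<bar> * seminorm u"
  using form by (auto simp: p_resistance_form_def seminorm_def)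

lemma seminorm_triangle: "u \<in> \<F> \<Longrightarrow> v \<in> \<F> \<Longrightarrow> seminorm (\<lambda>x. u x + v x) \<le> seminorm u + seminorm v"
  using form by (auto simp: p_resistance_form_def seminorm_def)

lemma seminorm_const: "seminorm (\<lambda>_. c) = 0"
proof -
  have "{u \<in> \<F>. \<E> u powr (1 / p) = 0} = constant_functions"
    using form by (auto simp: p_resistance_form_def)
  moreover have "(\<lambda>_. c) \<in> (constant_functions :: ('a \<Rightarrow> real) set)"
    by (auto simp: constant_functions_def)
  ultimately show ?thesis by (auto simp: seminorm_def)
qed

lemma energy_const: "\<E> (\<lambda>_. c) = 0"
  using energy_eq_seminorm[OF const_mem] seminorm_const p_gt_1 by simp

lemma seminorm_sum:
  "finite I \<Longrightarrow> (\<And>i. i \<in> I \<Longrightarrow> u i \<in> \<F>) \<Longrightarrow> seminorm (\<lambda>x. \<Sum>i\<in>I. u i x) \<le> (\<Sum>i\<in>I. seminorm (u i))"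
proof (induction I rule: finite_induct)
  case (insert i I)
  have "seminorm (\<lambda>x. u i x + (\<Sum>i\<in>I. u i x)) \<le> seminorm (u i) + seminorm (\<lambda>x. \<Sum>i\<in>I. u i x)"
    using insert by (intro seminorm_triangle sum_mem) auto
  then show ?case using insert by force
qed (simp add: seminorm_const)

lemma seminorm_add_const: "u \<in> \<F> \<Longrightarrow> seminorm (\<lambda>x. u x + c) = seminorm u"
  using seminorm_triangle[of u "\<lambda>_. c"] seminorm_triangle[of "\<lambda>x. u x + c" "\<lambda>_. -c"]
    const_mem add_mem[of u "\<lambda>_. c"] by (simp add: seminorm_const)

lemma energy_add_const: "u \<in> \<F> \<Longrightarrow> \<E> (\<lambda>x. u x + c) = \<E> u"
  using energy_eq_seminorm seminorm_add_const add_mem[OF _ const_mem] by simp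

lemma energy_scale: "u \<in> \<F> \<Longrightarrow> \<E> (\<lambda>x. a * u x) = \<bar>a\<bar> powr p * \<E> u"
  using seminorm_scale[of u a] by (simp add: energy_eq_seminorm scale_mem powr_mult seminorm_nonneg)

lemma energy_zero_iff: "u \<in> \<F> \<Longrightarrow> \<E> u = 0 \<longleftrightarrow> u \<in> constant_functions"
  using form by (fastforce simp: p_resistance_form_def)

lemma seminorm_complete:
  assumes "\<And>n. u n \<in> \<F>"
    and "\<And>\<epsilon>. \<epsilon> > 0 \<Longrightarrow> \<exists>N. \<forall>k\<ge>N. \<forall>n\<ge>N. seminorm (\<lambda>x. u k x - u n x) < \<epsilon>"
  shows "\<exists>v\<in>\<F>. (\<lambda>n::nat. seminorm (\<lambda>x. u n x - v x)) \<longlonglongrightarrow> 0"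
  using form assms unfolding p_resistance_form_def seminorm_def by blast

lemma separates: "x \<noteq> y \<Longrightarrow> \<exists>u\<in>\<F>. u x \<noteq> u y"
  using form by (auto simp: p_resistance_form_def)

lemma contraction:
  assumes "n1 \<ge> 1" "n2 \<ge> 1" "0 < q1" "q1 \<le> p" "p \<le> q2"
    and "\<And>l. l < n2 \<Longrightarrow> T (\<lambda>_. 0) l = 0"
    and "\<And>x y. lq_norm (ereal q2) n2 (\<lambda>l. T x l - T y l) \<le> lq_norm (ereal q1) n1 (\<lambda>k. x k - y k)"
    and "\<And>k. k < n1 \<Longrightarrow> u k \<in> \<F>"
  shows "l < n2 \<Longrightarrow> (\<lambda>x. T (\<lambda>k. u k x) l) \<in> \<F>"
    and "lq_norm (ereal q2) n2 (\<lambda>l. seminorm (\<lambda>x. T (\<lambda>k. u k x) l)) \<le> lq_norm (ereal q1) n1 (\<lambda>k. seminorm (u k))"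
proof -
  have "generalized_contraction p \<E> \<F>" using form by (simp add: p_resistance_form_def)
  note * = this[unfolded generalized_contraction_def, rule_format, of n1 n2 q1 "ereal q2" T u]
  have **: "(\<forall>l<n2. (\<lambda>x. T (\<lambda>k. u k x) l) \<in> \<F>) \<and>
           lq_norm (ereal q2) n2 (\<lambda>l. \<E> (\<lambda>x. T (\<lambda>k. u k x) l) powr (1 / p))
             \<le> lq_norm (ereal q1) n1 (\<lambda>k. \<E> (u k) powr (1 / p))"
    using assms by (intro *) auto
  then show "l < n2 \<Longrightarrow> (\<lambda>x. T (\<lambda>k. u k x) l) \<in> \<F>" by blast
  show "lq_norm (ereal q2) n2 (\<lambda>l. seminorm (\<lambda>x. T (\<lambda>k. u k x) l)) \<le> lq_norm (ereal q1) n1 (\<lambda>k. seminorm (u k))"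
    using ** by (simp add: seminorm_def)
qed

text \<open>A homogeneous inequality between two linear forms in two real variables, with exponents on
  either side of p, is inherited by the seminorm.\<close>

lemma linear_contraction:
  assumes q: "0 < q1" "q1 \<le> p" "p \<le> q2" and K: "0 < K"
    and ineq: "\<And>x y::real. \<bar>a * x + b * y\<bar> powr q2 + \<bar>c * x + d * y\<bar> powr q2
           \<le> K powr q2 * (\<bar>x\<bar> powr q1 + \<bar>y\<bar> powr q1) powr (q2 / q1)"
    and uv: "u \<in> \<F>" "v \<in> \<F>"
  shows "seminorm (\<lambda>x. a * u x + b * v x) powr q2 + seminorm (\<lambda>x. c * u x + d * v x) powr q2
           \<le> K powr q2 * (seminorm u powr q1 + seminorm v powr q1) powr (q2 / q1)"
proof -
  define T :: "(nat \<Rightarrow> real) \<Rightarrow> nat \<Rightarrow> real" where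
    "T = (\<lambda>x l. inverse K * (if l = 0 then a * x 0 + b * x 1 else c * x 0 + d * x 1))"
  have q2: "q2 > 0" using q p_gt_1 by simp
  have root: "(X / K powr q2) powr (1 / q2) = X powr (1 / q2) / K" if "0 \<le> X" for X
    using that K q2 by (simp add: powr_divide powr_powr)
  have norm_T: "(\<bar>inverse K * X\<bar> powr q2 + \<bar>inverse K * Y\<bar> powr q2) powr (1 / q2) = (\<bar>X\<bar> powr q2 + \<bar>Y\<bar> powr q2) powr (1 / q2) / K" for X Y :: real
  proof -
    have "\<bar>inverse K * X\<bar> powr q2 = \<bar>X\<bar> powr q2 / K powr q2" for X
      using K by (simp add: abs_mult powr_mult inverse_eq_divide powr_divide)
    then show ?thesis by (simp add: root add_divide_distrib[symmetric])
  qed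
  have lip: "lq_norm (ereal q2) 2 (\<lambda>l. T x l - T y l) \<le> lq_norm (ereal q1) 2 (\<lambda>k. x k - y k)" for x y
  proof -
    define X Y where "X = x 0 - y 0" and "Y = x 1 - y 1"
    have T0: "T x 0 - T y 0 = inverse K * (a * X + b * Y)" "T x 1 - T y 1 = inverse K * (c * X + d * Y)"
      by (simp_all add: T_def X_def Y_def algebra_simps)
    have "(\<bar>a * X + b * Y\<bar> powr q2 + \<bar>c * X + d * Y\<bar> powr q2) powr (1 / q2)
       \<le> (K powr q2 * (\<bar>X\<bar> powr q1 + \<bar>Y\<bar> powr q1) powr (q2 / q1)) powr (1 / q2)"
      using ineq q2 by (intro powr_mono2) auto
    also have "\<dots> = K * (\<bar>X\<bar> powr q1 + \<bar>Y\<bar> powr q1) powr (1 / q1)"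
      using K q2 q by (simp add: powr_mult powr_powr)
    finally show ?thesis
      unfolding lq_norm_two T0 norm_T X_def[symmetric] Y_def[symmetric] using K by (simp add: field_simps)
  qed
  define w where "w = (\<lambda>k::nat. if k = 0 then u else v)"
  have "lq_norm (ereal q2) 2 (\<lambda>l. seminorm (\<lambda>x. T (\<lambda>k. w k x) l)) \<le> lq_norm (ereal q1) 2 (\<lambda>k. seminorm (w k))"
    using q uv lip by (intro contraction(2)) (auto simp: T_def w_def)
  moreover have "(\<lambda>x. T (\<lambda>k. w k x) l) = (\<lambda>x. inverse K * (if l = 0 then a * u x + b * v x else c * u x + d * v x))" for l
    by (simp add: T_def w_def fun_eq_iff)
  ultimately have "lq_norm (ereal q2) 2 (\<lambda>l. seminorm (\<lambda>x. inverse K * (if l = 0 then a * u x + b * v x else c * u x + d * v x)))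
     \<le> (seminorm u powr q1 + seminorm v powr q1) powr (1 / q1)"
    by (simp add: lq_norm_two w_def seminorm_nonneg)
  moreover have mem: "(\<lambda>x. a * u x + b * v x) \<in> \<F>" "(\<lambda>x. c * u x + d * v x) \<in> \<F>"
    using uv by (auto intro: add_mem scale_mem)
  ultimately have "(\<bar>inverse K * seminorm (\<lambda>x. a * u x + b * v x)\<bar> powr q2
      + \<bar>inverse K * seminorm (\<lambda>x. c * u x + d * v x)\<bar> powr q2) powr (1 / q2)
     \<le> (seminorm u powr q1 + seminorm v powr q1) powr (1 / q1)"
    using K by (simp add: lq_norm_two seminorm_scale)
  then have "(seminorm (\<lambda>x. a * u x + b * v x) powr q2 + seminorm (\<lambda>x. c * u x + d * v x) powr q2) powr (1 / q2)
     \<le> K * (seminorm u powr q1 + seminorm v powr q1) powr (1 / q1)" (is "?A powr _ \<le> _")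
    unfolding norm_T using K by (simp add: field_simps seminorm_nonneg)
  then have "(?A powr (1 / q2)) powr q2 \<le> (K * (seminorm u powr q1 + seminorm v powr q1) powr (1 / q1)) powr q2"
    using q2 by (intro powr_mono2) auto
  then show ?thesis using q2 K by (simp add: powr_powr powr_mult)
qed

text \<open>The smoothness inequality of the plane, inherited by the energy.\<close>

lemma energy_second_difference:
  "\<exists>k>0. \<forall>u\<in>\<F>. \<forall>v\<in>\<F>. \<E> (\<lambda>x. u x + k * v x) + \<E> (\<lambda>x. u x - k * v x)
     \<le> 2 * (seminorm u powr min p 2 + seminorm v powr min p 2) powr (p / min p 2)"
proof -
  obtain k where k: "k > 0" "\<And>x y::real. \<bar>x + k * y\<bar> powr p + \<bar>x - k * y\<bar> powr p
           \<le> 2 * (\<bar>x\<bar> powr min p 2 + \<bar>y\<bar> powr min p 2) powr (p / min p 2)"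
    using smoothness_inequality[OF p_gt_1] by blast
  have "\<E> (\<lambda>x. u x + k * v x) + \<E> (\<lambda>x. u x - k * v x)
     \<le> 2 * (seminorm u powr min p 2 + seminorm v powr min p 2) powr (p / min p 2)" if "u \<in> \<F>" "v \<in> \<F>" for u v
    using linear_contraction[of "min p 2" p "2 powr (1/p)" 1 k 1 "-k" u v] k p_gt_1 that
    by (simp add: powr_powr energy_eq_seminorm add_mem scale_mem diff_mem)
  then show ?thesis using k by blast
qed

text \<open>If \<open>u\<close> and \<open>v\<close> lie in the ball of radius \<open>a\<close> and their midpoint is close to its boundary, then \<open>u - v\<close> is small.\<close>

lemma uniform_convexity:
  "\<exists>k>0. \<forall>u\<in>\<F>. \<forall>v\<in>\<F>. \<forall>a. seminorm u \<le> a \<longrightarrow> seminorm v \<le> a \<longrightarrow>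
     seminorm (\<lambda>x. u x + v x) powr max p 2 + (k * seminorm (\<lambda>x. u x - v x)) powr max p 2 \<le> (2 * a) powr max p 2"
proof -
  define q Q where "q = min p 2" and "Q = max p 2"
  have qQ: "0 < q" "q \<le> p" "p \<le> Q" "0 < Q" using p_gt_1 by (auto simp: q_def Q_def)
  obtain k where k: "k > 0" "\<And>x y::real. \<bar>x + y\<bar> powr Q + \<bar>k * (x - y)\<bar> powr Q
           \<le> (2 powr (1 - 1 / q)) powr Q * (\<bar>x\<bar> powr q + \<bar>y\<bar> powr q) powr (Q / q)"
    using uniform_convexity_inequality[OF p_gt_1] unfolding q_def Q_def by blast
  have "seminorm (\<lambda>x. u x + v x) powr Q + (k * seminorm (\<lambda>x. u x - v x)) powr Q \<le> (2 * a) powr Q"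
    if uv: "u \<in> \<F>" "v \<in> \<F>" and a: "seminorm u \<le> a" "seminorm v \<le> a" for u v a
  proof -
    have a0: "0 \<le> a" using a seminorm_nonneg[of u] by linarith
    have e: "(\<lambda>x. k * u x + - k * v x) = (\<lambda>x. k * (u x - v x))" by (auto simp: algebra_simps)
    have "seminorm (\<lambda>x. u x + v x) powr Q + (k * seminorm (\<lambda>x. u x - v x)) powr Q
      \<le> (2 powr (1 - 1 / q)) powr Q * (seminorm u powr q + seminorm v powr q) powr (Q / q)"
      using linear_contraction[of q Q "2 powr (1 - 1/q)" 1 1 k "-k" u v] k qQ uv
      unfolding e seminorm_scale[OF diff_mem[OF uv]] by (simp add: right_diff_distrib)
    also have "\<dots> \<le> (2 powr (1 - 1 / q)) powr Q * (a powr q + a powr q) powr (Q / q)"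
      using a qQ by (intro mult_left_mono powr_mono2 add_mono) (auto simp: seminorm_nonneg)
    also have "\<dots> = (2 powr (Q - Q / q)) * (2 powr (Q / q) * a powr Q)"
      using qQ a0 powr_mult[of 2 "a powr q" "Q/q"] by (simp add: powr_powr left_diff_distrib)
    also have "\<dots> = (2 * a) powr Q"
      using a0 by (simp add: powr_mult mult.assoc[symmetric] powr_add[symmetric])
    finally show ?thesis .
  qed
  then show ?thesis using k(1) unfolding Q_def by blast
qed

lemma energy_convex:
  assumes uv: "u \<in> \<F>" "v \<in> \<F>"
  shows "convex_on UNIV (\<lambda>t. \<E> (\<lambda>x. u x + t * v x))"
proof (rule convex_onI)
  fix t x y :: real assume t: "0 < t" "t < 1"
  define f where "f = (\<lambda>s z. u z + s * v z)"
  have f: "f s \<in> \<F>" for s unfolding f_def using uv by (intro add_mem scale_mem)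
  have e: "f ((1 - t) *\<^sub>R x + t *\<^sub>R y) = (\<lambda>z. (1 - t) * f x z + t * f y z)"
    by (auto simp: f_def algebra_simps)
  have "seminorm (f ((1 - t) *\<^sub>R x + t *\<^sub>R y)) \<le> (1 - t) * seminorm (f x) + t * seminorm (f y)"
    unfolding e using seminorm_triangle[OF scale_mem[OF f] scale_mem[OF f], of "1 - t" x t y] t
    by (simp add: seminorm_scale f)
  then have "seminorm (f ((1 - t) *\<^sub>R x + t *\<^sub>R y)) powr p \<le> ((1 - t) * seminorm (f x) + t * seminorm (f y)) powr p"
    using p_gt_1 by (intro powr_mono2) (auto simp: seminorm_nonneg)
  also have "\<dots> \<le> (1 - t) * seminorm (f x) powr p + t * seminorm (f y) powr p"
    using p_gt_1 t by (intro powr_convex_nonneg) (auto simp: seminorm_nonneg)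
  finally show "\<E> (\<lambda>z. u z + ((1 - t) *\<^sub>R x + t *\<^sub>R y) * v z) \<le> (1 - t) * \<E> (\<lambda>z. u z + x * v z) + t * \<E> (\<lambda>z. u z + y * v z)"
    using energy_eq_seminorm[OF f] unfolding f_def by simp
qed auto

text \<open>The second difference is of order \<open>t powr q\<close> with \<open>q = min p 2 > 1\<close>, because \<open>(\<alpha> + r * \<beta>) powr (p / q)\<close> is convex in
  \<open>r = t powr q\<close> and hence lies below its chord over \<open>[0, 1]\<close>.\<close>

lemma energy_differentiable:
  assumes uv: "u \<in> \<F>" "v \<in> \<F>"
  shows "(\<lambda>t. \<E> (\<lambda>x. u x + t * v x)) differentiable (at 0)"
proof (rule midpoint_slopes_differentiable)
  let ?D = "\<lambda>t. \<E> (\<lambda>x. u x + t * v x)"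
  show cvx: "convex_on UNIV ?D" by (rule energy_convex[OF uv])
  define q where "q = min p 2"
  have q: "1 < q" "q \<le> p" using p_gt_1 by (auto simp: q_def)
  obtain k where k: "k > 0" and smooth: "\<And>u v. u \<in> \<F> \<Longrightarrow> v \<in> \<F> \<Longrightarrow> \<E> (\<lambda>x. u x + k * v x) + \<E> (\<lambda>x. u x - k * v x)
     \<le> 2 * (seminorm u powr q + seminorm v powr q) powr (p / q)"
    using energy_second_difference unfolding q_def by blast
  define \<alpha> \<beta> where "\<alpha> = seminorm u powr q" and "\<beta> = (seminorm v / k) powr q"
  define C where "C = 2 * ((\<alpha> + \<beta>) powr (p / q) - \<alpha> powr (p / q))"
  have upper: "(?D t + ?D (-t) - 2 * ?D 0) / t \<le> C * t powr (q - 1)" if t: "0 < t" "t < 1" for t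
  proof -
    have "?D t + ?D (-t) \<le> 2 * (\<alpha> + seminorm (\<lambda>x. t / k * v x) powr q) powr (p / q)"
      using smooth[OF uv(1) scale_mem[OF uv(2), of "t / k"]] k by (simp add: \<alpha>_def)
    also have "seminorm (\<lambda>x. t / k * v x) powr q = t powr q * \<beta>"
      unfolding seminorm_scale[OF uv(2)] \<beta>_def using t k by (simp add: powr_mult powr_divide)
    also have "(\<alpha> + t powr q * \<beta>) powr (p / q) = ((1 - t powr q) * \<alpha> + t powr q * (\<alpha> + \<beta>)) powr (p / q)"
      by (simp add: algebra_simps)
    also have "\<dots> \<le> (1 - t powr q) * \<alpha> powr (p / q) + t powr q * (\<alpha> + \<beta>) powr (p / q)"
      using q t p_gt_1 by (intro powr_convex_nonneg) (auto simp: \<alpha>_def \<beta>_def intro!: powr_le1)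
    finally have "?D t + ?D (-t) \<le> 2 * \<alpha> powr (p / q) + C * t powr q"
      by (simp add: C_def algebra_simps)
    moreover have "?D 0 = \<alpha> powr (p / q)"
      using q uv by (simp add: \<alpha>_def powr_powr energy_eq_seminorm)
    ultimately have "(?D t + ?D (-t) - 2 * ?D 0) / t \<le> C * t powr q / t"
      using t by (intro divide_right_mono) auto
    also have "\<dots> = C * t powr (q - 1)" using t by (simp add: powr_diff)
    finally show ?thesis .
  qed
  have lower: "0 \<le> (?D t + ?D (-t) - 2 * ?D 0) / t" if "0 < t" for t
    using convex_onD[OF cvx, of "1/2" t "-t"] that by simp
  have lim: "((\<lambda>t. C * t powr (q - 1)) \<longlongrightarrow> C * 0) (at_right 0)"
  proof (intro tendsto_mult_left)
    have "((\<lambda>t::real. t powr (q - 1)) \<longlongrightarrow> 0 powr (q - 1)) (at_right 0)"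
      using q by (intro tendsto_powr' tendsto_intros) (auto simp: eventually_at_filter)
    then show "((\<lambda>t::real. t powr (q - 1)) \<longlongrightarrow> 0) (at_right 0)" by simp
  qed
  show "((\<lambda>t. (?D t + ?D (-t) - 2 * ?D 0) / t) \<longlongrightarrow> 0) (at_right 0)"
  proof (rule tendsto_sandwich[OF _ _ tendsto_const lim[simplified]])
    show "\<forall>\<^sub>F t in at_right 0. 0 \<le> (?D t + ?D (-t) - 2 * ?D 0) / t"
      using lower by (intro eventually_at_rightI[of 0 1]) auto
    show "\<forall>\<^sub>F t in at_right 0. (?D t + ?D (-t) - 2 * ?D 0) / t \<le> C * t powr (q - 1)"
      using upper by (intro eventually_at_rightI[of 0 1]) auto
  qed
qed

lemma energy_form_self: "u \<in> \<F> \<Longrightarrow> energy_form p \<E> u u = \<E> u"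
proof -
  assume u: "u \<in> \<F>"
  have "\<E> (\<lambda>x. u x + t * u x) = \<bar>1 + t\<bar> powr p * \<E> u" for t
    using energy_scale[OF u, of "1 + t"] by (simp add: algebra_simps)
  moreover have "((\<lambda>t. \<bar>1 + t\<bar> powr p * \<E> u) has_real_derivative p * \<E> u) (at 0)"
  proof -
    have "((\<lambda>t. (1 + t) powr p * \<E> u) has_real_derivative p * \<E> u) (at 0)"
      by (auto intro!: derivative_eq_intros)
    then show ?thesis
      by (rule DERIV_cong_ev[THEN iffD1, rotated 3])
        (auto simp: eventually_nhds intro!: exI[of _ "{-1<..<1}"])
  qed
  ultimately show ?thesis
    using p_gt_1 by (simp add: energy_form_def DERIV_imp_deriv)
qed

lemma energy_form_const: "u \<in> \<F> \<Longrightarrow> energy_form p \<E> u (\<lambda>_. c) = 0"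
  by (simp add: energy_form_def energy_add_const)

text \<open>Clamping both arguments to \<open>[-M, M]\<close> makes \<open>\<Phi>\<close> globally Lipschitz for the \<open>\<ell>\<^sup>1\<close> norm; after subtracting
  its value at the origin and dividing by \<open>L\<close> it is a contraction of the kind covered by the generalized
  contraction property. Products, powers with exponent above 1 and truncations are instances.\<close>

lemma lipschitz_compose_mem:
  fixes \<Phi> :: "real \<Rightarrow> real \<Rightarrow> real"
  assumes uv: "u \<in> \<F>" "v \<in> \<F>"
    and bound: "\<And>x. \<bar>u x\<bar> \<le> M" "\<And>x. \<bar>v x\<bar> \<le> M"
    and L: "L > 0"
    and lip: "\<And>a b c d. \<bar>a\<bar> \<le> M \<Longrightarrow> \<bar>b\<bar> \<le> M \<Longrightarrow> \<bar>c\<bar> \<le> M \<Longrightarrow> \<bar>d\<bar> \<le> M \<Longrightarrow>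
      \<bar>\<Phi> a b - \<Phi> c d\<bar> \<le> L * (\<bar>a - c\<bar> + \<bar>b - d\<bar>)"
  shows "(\<lambda>x. \<Phi> (u x) (v x)) \<in> \<F>"
proof -
  have M0: "0 \<le> M" using bound(1)[of undefined] by linarith
  define cl where "cl = (\<lambda>s. max (-M) (min M s))"
  have cl: "\<bar>cl s\<bar> \<le> M" "\<bar>cl s - cl t\<bar> \<le> \<bar>s - t\<bar>" "\<bar>s\<bar> \<le> M \<Longrightarrow> cl s = s" for s t
    using M0 unfolding cl_def by arith+
  define T :: "(nat \<Rightarrow> real) \<Rightarrow> nat \<Rightarrow> real" where
    "T = (\<lambda>x l. (\<Phi> (cl (x 0)) (cl (x 1)) - \<Phi> 0 0) / L)"
  define w where "w = (\<lambda>k::nat. if k = 0 then u else v)"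
  have "lq_norm (ereal p) 1 (\<lambda>l. T x l - T y l) \<le> lq_norm (ereal 1) 2 (\<lambda>k. x k - y k)" for x y
  proof -
    have "lq_norm (ereal p) 1 (\<lambda>l. T x l - T y l) = \<bar>\<Phi> (cl (x 0)) (cl (x 1)) - \<Phi> (cl (y 0)) (cl (y 1))\<bar> / L"
      using L p_gt_1 by (subst lq_norm_one) (auto simp: T_def diff_divide_distrib[symmetric])
    also have "\<dots> \<le> (L * (\<bar>cl (x 0) - cl (y 0)\<bar> + \<bar>cl (x 1) - cl (y 1)\<bar>)) / L"
      using L by (intro divide_right_mono lip cl) auto
    also have "\<dots> \<le> \<bar>x 0 - y 0\<bar> + \<bar>x 1 - y 1\<bar>"
      using L cl(2)[of "x 0" "y 0"] cl(2)[of "x 1" "y 1"] by simp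
    also have "\<dots> = lq_norm (ereal 1) 2 (\<lambda>k. x k - y k)"
      by (simp add: lq_norm_two)
    finally show ?thesis .
  qed
  moreover have "cl 0 = 0" using M0 by (intro cl) auto
  ultimately have "(\<lambda>x. T (\<lambda>k. w k x) 0) \<in> \<F>"
    using p_gt_1 uv by (intro contraction(1)[where T = T and u = w and ?n1.0 = 2 and ?n2.0 = 1 and ?q1.0 = 1 and ?q2.0 = p]) (auto simp: T_def w_def)
  then have "(\<lambda>x. L * T (\<lambda>k. w k x) 0 + \<Phi> 0 0) \<in> \<F>"
    by (intro add_mem scale_mem const_mem)
  also have "(\<lambda>x. L * T (\<lambda>k. w k x) 0 + \<Phi> 0 0) = (\<lambda>x. \<Phi> (u x) (v x))"
    using L cl(3) bound by (simp add: T_def w_def)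
  finally show ?thesis .
qed

lemma mult_mem:
  assumes uv: "u \<in> \<F>" "v \<in> \<F>" and bound: "\<And>x. \<bar>u x\<bar> \<le> M" "\<And>x. \<bar>v x\<bar> \<le> M"
  shows "(\<lambda>x. u x * v x) \<in> \<F>"
proof (rule lipschitz_compose_mem[OF uv bound, of "M + 1"])
  show "0 < M + 1" using bound(1)[of undefined] by linarith
  fix a b c d :: real assume "\<bar>a\<bar> \<le> M" "\<bar>b\<bar> \<le> M" "\<bar>c\<bar> \<le> M" "\<bar>d\<bar> \<le> M"
  have "\<bar>a * b - c * d\<bar> = \<bar>(a - c) * b + c * (b - d)\<bar>" by (simp add: algebra_simps)
  also have "\<dots> \<le> \<bar>a - c\<bar> * \<bar>b\<bar> + \<bar>c\<bar> * \<bar>b - d\<bar>"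
    using abs_triangle_ineq[of "(a - c) * b" "c * (b - d)"] by (simp add: abs_mult)
  also have "\<dots> \<le> \<bar>a - c\<bar> * (M + 1) + (M + 1) * \<bar>b - d\<bar>"
    using \<open>\<bar>b\<bar> \<le> M\<close> \<open>\<bar>c\<bar> \<le> M\<close> by (intro add_mono mult_left_mono mult_right_mono) auto
  finally show "\<bar>a * b - c * d\<bar> \<le> (M + 1) * (\<bar>a - c\<bar> + \<bar>b - d\<bar>)" by (simp add: algebra_simps)
qed

lemma truncate_mem:
  assumes u: "u \<in> \<F>" and bound: "\<And>x. \<bar>u x\<bar> \<le> M"
  shows "(\<lambda>x. max 0 (min 1 (u x))) \<in> \<F>"
proof (rule lipschitz_compose_mem[OF u u bound bound, of 1 "\<lambda>a _. max 0 (min 1 a)"])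
  fix a b c d :: real
  have "\<bar>max 0 s - max 0 t\<bar> \<le> \<bar>s - t\<bar>" "\<bar>min 1 s - min 1 t\<bar> \<le> \<bar>s - t\<bar>" for s t :: real
    by (auto simp: max_def min_def)
  then have "\<bar>max 0 (min 1 a) - max 0 (min 1 c)\<bar> \<le> \<bar>a - c\<bar>"
    by (meson order_trans)
  then show "\<bar>max 0 (min 1 a) - max 0 (min 1 c)\<bar> \<le> 1 * (\<bar>a - c\<bar> + \<bar>b - d\<bar>)"
    by (simp add: add_increasing2)
qed simp

lemma abs_powr_mem:
  assumes u: "u \<in> \<F>" and bound: "\<And>x. \<bar>u x\<bar> \<le> M" and q: "1 < q"
  shows "(\<lambda>x. \<bar>u x\<bar> powr q) \<in> \<F>"
proof (rule lipschitz_compose_mem[OF u u bound bound, of "q * (M + 1) powr (q - 1)" "\<lambda>a _. \<bar>a\<bar> powr q"])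
  have M: "0 \<le> M" using bound[of undefined] by linarith
  show "0 < q * (M + 1) powr (q - 1)" using M q by simp
  have lip: "t powr q - s powr q \<le> q * (M + 1) powr (q - 1) * (t - s)" if "0 \<le> s" "s < t" "t \<le> M" for s t
  proof -
    have "\<exists>l z. s < z \<and> z < t \<and> DERIV (\<lambda>x. x powr q) z :> l \<and> t powr q - s powr q = (t - s) * l"
    proof (rule MVT)
      show "continuous_on {s..t} (\<lambda>x. x powr q)" using that q by (intro continuous_intros continuous_on_powr') auto
      fix x assume "s < x" "x < t"
      then have "DERIV (\<lambda>x. x powr q) x :> q * x powr (q - 1)" using that by (auto intro!: derivative_eq_intros)
      then show "(\<lambda>x. x powr q) differentiable (at x)" by (auto simp: real_differentiable_def)
    qed (use that in auto)
    then obtain l z where z: "s < z" "z < t" "DERIV (\<lambda>x. x powr q) z :> l" "t powr q - s powr q = (t - s) * l" by blast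
    have "DERIV (\<lambda>x. x powr q) z :> q * z powr (q - 1)" using that z by (auto intro!: derivative_eq_intros)
    then have "l = q * z powr (q - 1)" using z(3) DERIV_unique by blast
    also have "\<dots> \<le> q * (M + 1) powr (q - 1)" using that z q by (intro mult_left_mono powr_mono2) auto
    finally show ?thesis using z(4) that by (simp add: mult.commute mult_left_mono)
  qed
  fix a b c d :: real assume *: "\<bar>a\<bar> \<le> M" "\<bar>c\<bar> \<le> M"
  define G where "G = q * (M + 1) powr (q - 1)"
  have G: "0 \<le> G" using q by (simp add: G_def)
  have "\<bar>\<bar>a\<bar> powr q - \<bar>c\<bar> powr q\<bar> \<le> G * \<bar>\<bar>a\<bar> - \<bar>c\<bar>\<bar>"
  proof -
    consider "\<bar>a\<bar> < \<bar>c\<bar>" | "\<bar>c\<bar> < \<bar>a\<bar>" | "\<bar>a\<bar> = \<bar>c\<bar>" by linarith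
    then show ?thesis
    proof cases
      case 1
      then have "\<bar>a\<bar> powr q \<le> \<bar>c\<bar> powr q" using q by (intro powr_mono2) auto
      then show ?thesis using lip[of "\<bar>a\<bar>" "\<bar>c\<bar>"] 1 * by (simp add: G_def)
    next
      case 2
      then have "\<bar>c\<bar> powr q \<le> \<bar>a\<bar> powr q" using q by (intro powr_mono2) auto
      then show ?thesis using lip[of "\<bar>c\<bar>" "\<bar>a\<bar>"] 2 * by (simp add: G_def)
    qed simp
  qed
  also have "\<dots> \<le> G * (\<bar>a - c\<bar> + \<bar>b - d\<bar>)" using G by (intro mult_left_mono) auto
  finally show "\<bar>\<bar>a\<bar> powr q - \<bar>c\<bar> powr q\<bar> \<le> q * (M + 1) powr (q - 1) * (\<bar>a - c\<bar> + \<bar>b - d\<bar>)"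
    by (simp add: G_def)
qed

text \<open>Nearly minimal elements of a decreasing sequence of convex sets form a Cauchy sequence, by
  uniform convexity. This replaces weak compactness of energy balls.\<close>

lemma nested_convex_minimizers:
  assumes sub: "\<And>n. C n \<subseteq> \<F>" and dec: "\<And>n k. n \<le> k \<Longrightarrow> C k \<subseteq> C n"
    and mid: "\<And>n f g. f \<in> C n \<Longrightarrow> g \<in> C n \<Longrightarrow> (\<lambda>x. (f x + g x) / 2) \<in> C n"
    and bound: "\<And>n::nat. \<exists>g\<in>C n. \<E> g \<le> M"
  shows "\<exists>g. \<exists>v\<in>\<F>. (\<forall>n. g n \<in> C n) \<and> (\<lambda>n. seminorm (\<lambda>x. g n x - v x)) \<longlonglongrightarrow> 0 \<and> \<E> v \<le> M"
proof -
  define B where "B = M powr (1 / p)"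
  define a where "a = (\<lambda>n. Inf (seminorm ` C n))"
  have ne: "C n \<noteq> {}" for n using bound[of n] by blast
  have bdd: "bdd_below (seminorm ` C n)" for n
    by (rule bdd_belowI[of _ 0]) (auto simp: seminorm_nonneg)
  have a_le: "a n \<le> seminorm g" if "g \<in> C n" for n g
    unfolding a_def using that bdd by (intro cInf_lower) auto
  have a_nonneg: "0 \<le> a n" for n
    unfolding a_def using ne by (intro cInf_greatest) (auto simp: seminorm_nonneg)
  have M0: "0 \<le> M" using bound[of 0] sub energy_nonneg by (meson order_trans subsetD)
  have a_B: "a n \<le> B" for n
  proof -
    obtain g where g: "g \<in> C n" "\<E> g \<le> M" using bound by blast
    have "seminorm g \<le> B" unfolding seminorm_def B_def
      using g sub energy_nonneg p_gt_1 by (intro powr_mono2) auto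
    then show ?thesis using a_le[OF g(1)] by linarith
  qed
  have "incseq a"
    unfolding incseq_def a_def using dec ne bdd by (intro allI impI cInf_superset_mono image_mono) auto
  then obtain l where l: "a \<longlonglongrightarrow> l" "\<And>n. a n \<le> l"
    using incseq_convergent[of a B] a_B by blast
  have lB: "l \<le> B" using LIMSEQ_le_const2[OF l(1), of B] a_B by blast
  have "\<exists>g\<in>C n. seminorm g < a n + 1 / real (Suc n)" for n
    using cInf_lessD[of "seminorm ` C n" "a n + 1 / real (Suc n)"] ne unfolding a_def by force
  then obtain g where g: "\<And>n. g n \<in> C n" "\<And>n. seminorm (g n) < a n + 1 / real (Suc n)" by metis
  have gF: "g n \<in> \<F>" for n using g sub by blast
  obtain k where k: "k > 0" and uc: "\<And>u v a. u \<in> \<F> \<Longrightarrow> v \<in> \<F> \<Longrightarrow> seminorm u \<le> a \<Longrightarrow> seminorm v \<le> a \<Longrightarrow>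
     seminorm (\<lambda>x. u x + v x) powr max p 2 + (k * seminorm (\<lambda>x. u x - v x)) powr max p 2 \<le> (2 * a) powr max p 2"
    using uniform_convexity by blast
  define Q where "Q = max p 2"
  have Q: "Q > 0" by (simp add: Q_def)
  define b where "b = (\<lambda>n. l + 1 / real (Suc n))"
  \<comment> \<open>midpoints have seminorm at least \<open>a n\<close>, so uniform convexity bounds the differences by \<open>\<eta> n\<close>\<close>
  define \<eta> where "\<eta> = (\<lambda>n. ((2 * b n) powr Q - (2 * a n) powr Q) powr (1 / Q) / k)"
  have close: "seminorm (\<lambda>x. g n x - g j x) \<le> \<eta> n" if nj: "n \<le> j" for n j
  proof -
    have "1 / real (Suc j) \<le> 1 / real (Suc n)" using nj by (simp add: field_simps)
    then have "seminorm (g n) \<le> b n" "seminorm (g j) \<le> b n"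
      using g(2)[of n] g(2)[of j] l(2)[of n] l(2)[of j] by (auto simp: b_def)
    note uc[OF gF gF this]
    moreover have "(2 * a n) powr Q \<le> seminorm (\<lambda>x. g n x + g j x) powr Q"
    proof (intro powr_mono2)
      have "(\<lambda>x. (g n x + g j x) / 2) \<in> C n" using g dec[OF nj] by (intro mid) auto
      then have "a n \<le> seminorm (\<lambda>x. 1/2 * (g n x + g j x))" using a_le by simp
      also have "\<dots> = 1/2 * seminorm (\<lambda>x. g n x + g j x)" by (subst seminorm_scale) (auto intro: add_mem gF)
      finally show "2 * a n \<le> seminorm (\<lambda>x. g n x + g j x)" by simp
    qed (use Q a_nonneg in auto)
    ultimately have "(k * seminorm (\<lambda>x. g n x - g j x)) powr Q \<le> (2 * b n) powr Q - (2 * a n) powr Q"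
      unfolding Q_def by linarith
    then have "((k * seminorm (\<lambda>x. g n x - g j x)) powr Q) powr (1 / Q) \<le> ((2 * b n) powr Q - (2 * a n) powr Q) powr (1 / Q)"
      using Q by (intro powr_mono2) auto
    then show ?thesis using Q k seminorm_nonneg by (simp add: powr_powr \<eta>_def field_simps)
  qed
  have b_lim: "b \<longlonglongrightarrow> l + 0"
    unfolding b_def by (intro tendsto_add tendsto_const LIMSEQ_Suc[OF lim_1_over_n])
  have "\<eta> \<longlonglongrightarrow> ((2 * (l + 0)) powr Q - (2 * l) powr Q) powr (1 / Q) / k"
    unfolding \<eta>_def
  proof (intro tendsto_divide tendsto_powr' tendsto_diff tendsto_mult tendsto_const l b_lim)
    have nn: "0 \<le> b n" "0 \<le> 2 * a n" "(2 * a n) powr Q \<le> (2 * b n) powr Q" for n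
    proof -
      have "a n \<le> b n" using l(2)[of n] by (simp add: b_def add_increasing2)
      then show "0 \<le> b n" "0 \<le> 2 * a n" "(2 * a n) powr Q \<le> (2 * b n) powr Q"
        using a_nonneg[of n] Q by (auto intro!: powr_mono2)
    qed
    show "2 * (l + 0) \<noteq> 0 \<or> 0 < Q \<and> (\<forall>\<^sub>F n in sequentially. 0 \<le> 2 * b n)" using Q nn by simp
    show "2 * l \<noteq> 0 \<or> 0 < Q \<and> (\<forall>\<^sub>F n in sequentially. 0 \<le> 2 * a n)" using Q nn by simp
    show "(2 * (l + 0)) powr Q - (2 * l) powr Q \<noteq> 0 \<or>
      0 < 1 / Q \<and> (\<forall>\<^sub>F n in sequentially. 0 \<le> (2 * b n) powr Q - (2 * a n) powr Q)" using Q nn by simp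
  qed (use k Q in auto)
  then have \<eta>: "\<eta> \<longlonglongrightarrow> 0" by simp
  have "\<exists>v\<in>\<F>. (\<lambda>n. seminorm (\<lambda>x. g n x - v x)) \<longlonglongrightarrow> 0"
  proof (rule seminorm_complete[OF gF])
    fix \<epsilon> :: real assume "\<epsilon> > 0"
    then obtain N where N: "\<And>n. n \<ge> N \<Longrightarrow> \<eta> n < \<epsilon>"
      using order_tendstoD(2)[OF \<eta>, of \<epsilon>] by (auto simp: eventually_sequentially)
    have sym: "seminorm (\<lambda>x. g j x - g n x) = seminorm (\<lambda>x. g n x - g j x)" for j n
      using seminorm_scale[OF diff_mem[OF gF gF], of "-1" n j] by simp
    show "\<exists>N. \<forall>k\<ge>N. \<forall>n\<ge>N. seminorm (\<lambda>x. g k x - g n x) < \<epsilon>"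
    proof (intro exI[of _ N] allI impI)
      fix i n assume "i \<ge> N" "n \<ge> N"
      then show "seminorm (\<lambda>x. g i x - g n x) < \<epsilon>"
        using close[of i n] close[of n i] N[of i] N[of n] sym[of i n] by (cases "i \<le> n") auto
    qed
  qed
  then obtain v where v: "v \<in> \<F>" "(\<lambda>n. seminorm (\<lambda>x. g n x - v x)) \<longlonglongrightarrow> 0" by blast
  have "seminorm v \<le> b n + seminorm (\<lambda>x. g n x - v x)" for n
  proof -
    have "seminorm v = seminorm (\<lambda>x. g n x + -1 * (g n x - v x))" by simp
    also have "\<dots> \<le> seminorm (g n) + seminorm (\<lambda>x. -1 * (g n x - v x))"
      by (intro seminorm_triangle gF scale_mem diff_mem v)
    also have "seminorm (\<lambda>x. -1 * (g n x - v x)) = seminorm (\<lambda>x. g n x - v x)"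
      by (subst seminorm_scale) (auto intro: diff_mem gF v)
    finally show ?thesis using g(2)[of n] l(2)[of n] by (simp add: b_def)
  qed
  then have "seminorm v \<le> (l + 0) + 0"
    by (intro LIMSEQ_le_const[OF tendsto_add[OF b_lim v(2)]]) auto
  then have "seminorm v powr p \<le> B powr p" using lB p_gt_1 by (intro powr_mono2) (auto simp: seminorm_nonneg)
  then have "\<E> v \<le> M" using M0 p_gt_1 v by (simp add: energy_eq_seminorm B_def powr_powr)
  then show ?thesis using g v by blast
qed

subsection \<open>Resistances\<close>

definition res :: "'a \<Rightarrow> 'a \<Rightarrow> real" where
  "res x y = enn2real (resistance p \<E> \<F> x y)"

lemma resistance_eq_res: "resistance p \<E> \<F> x y = ennreal (res x y)"
  using form by (auto simp: res_def p_resistance_form_def less_top)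

lemma res_nonneg: "0 \<le> res x y"
  by (simp add: res_def)

lemma energy_pos: "u \<in> \<F> \<Longrightarrow> u x \<noteq> u y \<Longrightarrow> 0 < \<E> u"
  using energy_zero_iff[of u] energy_nonneg[of u] by (auto simp: constant_functions_def less_le)

lemma diff_powr_le_res:
  assumes "u \<in> \<F>"
  shows "\<bar>u x - u y\<bar> powr p \<le> res x y * \<E> u"
proof (cases "u x = u y")
  case False
  then have pos: "0 < \<E> u" using energy_pos assms by blast
  have "u \<in> \<F> - constant_functions" using assms False by (auto simp: constant_functions_def)
  then have "ennreal (\<bar>u x - u y\<bar> powr p / \<E> u) \<le> resistance p \<E> \<F> x y"
    unfolding resistance_def by (rule SUP_upper)
  then have "\<bar>u x - u y\<bar> powr p / \<E> u \<le> res x y"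
    by (simp add: resistance_eq_res ennreal_le_iff res_nonneg)
  then show ?thesis using pos by (simp add: pos_divide_le_eq)
qed (use assms energy_nonneg res_nonneg p_gt_1 in auto)

lemma res_leI:
  assumes "0 \<le> c" "\<And>u. u \<in> \<F> \<Longrightarrow> \<bar>u x - u y\<bar> powr p \<le> c * \<E> u"
  shows "res x y \<le> c"
proof -
  have "resistance p \<E> \<F> x y \<le> ennreal c"
    unfolding resistance_def
  proof (rule SUP_least)
    fix u assume u: "u \<in> \<F> - constant_functions"
    then have "0 < \<E> u" using energy_zero_iff[of u] energy_nonneg[of u] by (auto simp: less_le)
    then show "ennreal (\<bar>u x - u y\<bar> powr p / \<E> u) \<le> ennreal c"
      using assms(2)[of u] u by (intro ennreal_leI) (auto simp: pos_divide_le_eq)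
  qed
  then show ?thesis using assms(1) by (simp add: resistance_eq_res)
qed

text \<open>Going from \<open>x\<close> to \<open>z\<close> in two steps costs at most a constant factor more than one step.\<close>

lemma res_triangle_bound:
  assumes "res x y \<le> c" "res y z \<le> c"
  shows "res x z \<le> 2 powr p * (2 * c)"
proof (rule res_leI)
  show c: "0 \<le> 2 powr p * (2 * c)" using assms res_nonneg[of x y] by simp
  fix u assume u: "u \<in> \<F>"
  have "\<bar>u x - u z\<bar> powr p \<le> (\<bar>u x - u y\<bar> + \<bar>u y - u z\<bar>) powr p" using p_gt_1 by (intro powr_mono2) auto
  also have "\<dots> \<le> 2 powr p * (\<bar>u x - u y\<bar> powr p + \<bar>u y - u z\<bar> powr p)"
    using p_gt_1 by (intro powr_add_le_two) auto
  also have "\<dots> \<le> 2 powr p * (res x y * \<E> u + res y z * \<E> u)"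
    by (intro mult_left_mono add_mono diff_powr_le_res u) auto
  also have "\<dots> \<le> 2 powr p * (c * \<E> u + c * \<E> u)"
    using assms u by (intro mult_left_mono add_mono mult_right_mono energy_nonneg) auto
  finally show "\<bar>u x - u z\<bar> powr p \<le> 2 powr p * (2 * c) * \<E> u" by (simp add: algebra_simps)
qed

lemma res_lower:
  assumes "u \<in> \<F>" "u x = 1" "u y = 0" "\<E> u \<le> c"
  shows "1 / c \<le> res x y"
proof -
  have pos: "0 < \<E> u" using energy_pos[of u x y] assms by simp
  have "1 \<le> res x y * \<E> u" using diff_powr_le_res[of u x y] assms by simp
  also have "\<dots> \<le> res x y * c" using assms by (intro mult_left_mono res_nonneg) auto
  finally show ?thesis using pos assms by (simp add: pos_divide_le_eq)
qed

lemma resistance_metric_less_iff: "s > 0 \<Longrightarrow> resistance_metric p \<E> \<F> x y < s \<longleftrightarrow> res x y < s powr (p - 1)"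
proof -
  assume s: "s > 0"
  have eq: "resistance_metric p \<E> \<F> x y = res x y powr (1 / (p - 1))"
    by (simp add: resistance_metric_def res_def)
  have "res x y powr (1 / (p - 1)) < s \<longleftrightarrow> res x y powr (1 / (p - 1)) < (s powr (p - 1)) powr (1 / (p - 1))"
    using s p_gt_1 by (simp add: powr_powr)
  also have "\<dots> \<longleftrightarrow> res x y < s powr (p - 1)"
    using p_gt_1 powr_mono2[of "1/(p-1)" "s powr (p - 1)" "res x y"] powr_less_mono2[of "1/(p-1)" "res x y" "s powr (p - 1)"]
    by (meson divide_pos_pos diff_gt_0_iff_gt leD leI less_imp_le powr_ge_zero res_nonneg zero_less_one)
  finally show ?thesis by (simp add: eq)
qed

end

section \<open>Words, cells and partitions\<close>

primrec word_map :: "('i \<Rightarrow> 'a \<Rightarrow> 'a) \<Rightarrow> 'i list \<Rightarrow> 'a \<Rightarrow> 'a" where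
  "word_map F [] = id"
| "word_map F (i # w) = F i \<circ> word_map F w"

primrec word_weight :: "('i \<Rightarrow> real) \<Rightarrow> 'i list \<Rightarrow> real" where
  "word_weight \<rho> [] = 1"
| "word_weight \<rho> (i # w) = \<rho> i * word_weight \<rho> w"

primrec prepend :: "'i list \<Rightarrow> (nat \<Rightarrow> 'i) \<Rightarrow> nat \<Rightarrow> 'i" where
  "prepend [] \<omega> = \<omega>"
| "prepend (i # w) \<omega> = case_nat i (prepend w \<omega>)"

text \<open>The partition of level \<open>T\<close> consists of the words at which the product of the weights
  reaches \<open>T\<close> for the first time. Peeling off the first letter divides the level by
  its weight, which makes the recursion below the natural one.\<close>

inductive stopping_word :: "'i set \<Rightarrow> ('i \<Rightarrow> real) \<Rightarrow> real \<Rightarrow> 'i list \<Rightarrow> bool" for S \<rho> where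
  Stop: "T \<le> 1 \<Longrightarrow> stopping_word S \<rho> T []"
| Go: "1 < T \<Longrightarrow> i \<in> S \<Longrightarrow> stopping_word S \<rho> (T / \<rho> i) w \<Longrightarrow> stopping_word S \<rho> T (i # w)"

lemma word_map_append: "word_map F (v @ w) = word_map F v \<circ> word_map F w"
  by (induction v) (auto simp: comp_assoc)

lemma word_weight_append: "word_weight \<rho> (v @ w) = word_weight \<rho> v * word_weight \<rho> w"
  by (induction v) auto

lemma left_shift_case_nat: "left_shift (case_nat i \<omega>) = \<omega>"
  by (auto simp: left_shift_def)

lemma case_nat_left_shift: "case_nat (\<omega> 0) (left_shift \<omega>) = \<omega>"
  by (auto simp: left_shift_def fun_eq_iff split: nat.split)

lemma left_shift_prepend: "(left_shift ^^ length w) (prepend w \<omega>) = \<omega>"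
proof (induction w)
  case (Cons i w)
  have "(left_shift ^^ length (i # w)) (prepend (i # w) \<omega>)
     = (left_shift ^^ length w) (left_shift (prepend (i # w) \<omega>))"
    by (simp only: list.size add_0_right add_Suc_right funpow_Suc_right o_apply)
  then show ?case using Cons by (simp add: left_shift_case_nat)
qed simp

lemma case_nat_Pi: "case_nat i \<omega> \<in> UNIV \<rightarrow> S \<longleftrightarrow> i \<in> S \<and> \<omega> \<in> UNIV \<rightarrow> S"
  by (auto simp: Pi_iff split: nat.split_asm nat.split)

lemma prepend_Pi: "prepend w \<omega> \<in> UNIV \<rightarrow> S \<longleftrightarrow> set w \<subseteq> S \<and> \<omega> \<in> UNIV \<rightarrow> S"
  by (induction w) (auto simp: case_nat_Pi)

lemma case_nat_inject: "case_nat i \<omega> = case_nat j \<tau> \<longleftrightarrow> i = j \<and> \<omega> = \<tau>"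
  by (metis left_shift_case_nat old.nat.simps(4))

locale self_similar_form = resistance_form p \<E> \<F>
  for p :: real and \<E> :: "('a::polish_space \<Rightarrow> real) \<Rightarrow> real" and \<F> +
  fixes S :: "'i set" and F :: "'i \<Rightarrow> 'a \<Rightarrow> 'a" and \<rho> :: "'i \<Rightarrow> real" and \<pi> :: "(nat \<Rightarrow> 'i) \<Rightarrow> 'a"
  assumes sss: "self_similar_structure S F"
    and coding: "coding_map S F \<pi>"
    and pcf: "finite (post_critical_set S F \<pi>)"
    and self_similar: "self_similar_p_resistance_form p S F \<rho> \<E> \<F>"
    and \<rho>_gt_1: "\<And>i. i \<in> S \<Longrightarrow> 1 < \<rho> i"
begin

abbreviation "Fw \<equiv> word_map F"
abbreviation "\<rho>w \<equiv> word_weight \<rho>"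

definition cells :: "real \<Rightarrow> 'i list set" where
  "cells T = {w. stopping_word S \<rho> T w}"

lemma compact_UNIV: "compact (UNIV :: 'a set)"
  and finite_S: "finite S" and S_nonempty: "S \<noteq> {}"
  and F_cont: "i \<in> S \<Longrightarrow> continuous_on UNIV (F i)" and F_inj: "i \<in> S \<Longrightarrow> inj (F i)"
  using sss by (auto simp: self_similar_structure_def)

lemma \<pi>_onto: "\<pi> ` (UNIV \<rightarrow> S) = UNIV"
  and F_\<pi>: "i \<in> S \<Longrightarrow> \<omega> \<in> UNIV \<rightarrow> S \<Longrightarrow> F i (\<pi> \<omega>) = \<pi> (case_nat i \<omega>)"
  using coding by (auto simp: coding_map_def)

lemma mem_iff: "u \<in> \<F> \<longleftrightarrow> continuous_on UNIV u \<and> (\<forall>i\<in>S. u \<circ> F i \<in> \<F>)"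
proof -
  have "\<F> = {u. continuous_on UNIV u \<and> (\<forall>i\<in>S. u \<circ> F i \<in> \<F>)}"
    using self_similar unfolding self_similar_p_resistance_form_def by blast
  then show ?thesis by blast
qed

lemma energy_step: "u \<in> \<F> \<Longrightarrow> \<E> u = (\<Sum>i\<in>S. \<rho> i * \<E> (u \<circ> F i))"
  using self_similar unfolding self_similar_p_resistance_form_def by blast

lemma mem_cont: "u \<in> \<F> \<Longrightarrow> continuous_on UNIV u"
  using mem_iff by blast

lemma mem_step: "u \<in> \<F> \<Longrightarrow> i \<in> S \<Longrightarrow> u \<circ> F i \<in> \<F>"
  using mem_iff by blast

lemma mem_bounded: "u \<in> \<F> \<Longrightarrow> \<exists>M. \<forall>x. \<bar>u x\<bar> \<le> M"
  using compact_imp_bounded[OF compact_continuous_image[OF mem_cont compact_UNIV], of u]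
  by (auto simp: bounded_iff)

lemma mult_closed: "u \<in> \<F> \<Longrightarrow> v \<in> \<F> \<Longrightarrow> (\<lambda>x. u x * v x) \<in> \<F>"
proof -
  assume uv: "u \<in> \<F>" "v \<in> \<F>"
  then obtain M N where "\<And>x. \<bar>u x\<bar> \<le> M" "\<And>x. \<bar>v x\<bar> \<le> N" using mem_bounded by meson
  then show ?thesis using uv by (intro mult_mem[of u v "max M N"]) (auto simp: le_max_iff_disj)
qed

lemma word_mem: "u \<in> \<F> \<Longrightarrow> set w \<subseteq> S \<Longrightarrow> u \<circ> Fw w \<in> \<F>"
  by (induction w arbitrary: u) (auto simp: comp_assoc[symmetric] intro: mem_step)

lemma Fw_cont: "set w \<subseteq> S \<Longrightarrow> continuous_on UNIV (Fw w)"
proof (induction w)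
  case (Cons i w)
  then show ?case using continuous_on_compose[of UNIV "Fw w" "F i"] F_cont[of i] continuous_on_subset[of UNIV "F i"]
    by (simp add: o_def)
qed (simp add: id_def)

lemma Fw_inj: "set w \<subseteq> S \<Longrightarrow> inj (Fw w)"
  by (induction w) (auto intro!: inj_compose F_inj)

lemma Fw_\<pi>: "set w \<subseteq> S \<Longrightarrow> \<omega> \<in> UNIV \<rightarrow> S \<Longrightarrow> Fw w (\<pi> \<omega>) = \<pi> (prepend w \<omega>)"
  by (induction w) (auto simp: F_\<pi> prepend_Pi)

lemma \<rho>w_ge_1: "set w \<subseteq> S \<Longrightarrow> 1 \<le> \<rho>w w"
proof (induction w)
  case (Cons i w)
  then have "1 * 1 \<le> \<rho> i * \<rho>w w" using \<rho>_gt_1[of i] by (intro mult_mono) auto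
  then show ?case by simp
qed simp

lemma \<rho>w_pos: "set w \<subseteq> S \<Longrightarrow> 0 < \<rho>w w"
  using \<rho>w_ge_1[of w] by linarith

subsection \<open>Partitions\<close>

lemma cells_stop: "T \<le> 1 \<Longrightarrow> cells T = {[]}"
  by (auto simp: cells_def stopping_word.simps[of S \<rho> T])

lemma cells_go: "1 < T \<Longrightarrow> cells T = (\<Union>i\<in>S. (#) i ` cells (T / \<rho> i))"
  by (auto simp: cells_def stopping_word.simps[of S \<rho> T])

text \<open>The level drops by a factor above 1 with every letter, so it falls to 1 after finitely many letters.\<close>

lemma level_induct:
  assumes stop: "\<And>T. T \<le> 1 \<Longrightarrow> P T"
    and go: "\<And>T. 1 < T \<Longrightarrow> (\<And>i. i \<in> S \<Longrightarrow> P (T / \<rho> i)) \<Longrightarrow> P T"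
  shows "P T"
proof -
  define b where "b = Min (\<rho> ` S)"
  have b: "1 < b" "\<And>i. i \<in> S \<Longrightarrow> b \<le> \<rho> i"
    using finite_S S_nonempty \<rho>_gt_1 by (auto simp: b_def)
  have "P T" if "T \<le> b ^ n" for n T using that
  proof (induction n arbitrary: T)
    case (Suc n)
    show ?case
    proof (cases "1 < T")
      case True
      show ?thesis
      proof (rule go[OF True])
        fix i assume i: "i \<in> S"
        have "T / \<rho> i \<le> T / b" using b(2)[OF i] b(1) True by (intro divide_left_mono) auto
        also have "\<dots> \<le> b ^ n" using Suc.prems b by (simp add: pos_divide_le_eq mult.commute)
        finally show "P (T / \<rho> i)" by (rule Suc.IH)
      qed
    qed (use stop in auto)
  qed (use stop in auto)
  moreover obtain n where "T < b ^ n" using real_arch_pow[OF b(1)] by blast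
  ultimately show ?thesis by (meson less_imp_le)
qed

lemma finite_cells: "finite (cells T)"
  by (induction T rule: level_induct) (auto simp: cells_stop cells_go finite_S)

lemma sum_cells_go:
  assumes "1 < T"
  shows "(\<Sum>w\<in>cells T. G w) = (\<Sum>i\<in>S. \<Sum>w\<in>cells (T / \<rho> i). G (i # w))"
proof -
  have "(\<Sum>w\<in>cells T. G w) = (\<Sum>i\<in>S. \<Sum>w\<in>(#) i ` cells (T / \<rho> i). G w)"
    unfolding cells_go[OF assms] by (rule sum.UNION_disjoint) (auto simp: finite_S finite_cells)
  then show ?thesis by (simp add: sum.reindex)
qed

lemma cells_set: "w \<in> cells T \<Longrightarrow> set w \<subseteq> S"
proof (induction T arbitrary: w rule: level_induct)
  case (2 T)
  then obtain i w' where "w = i # w'" "i \<in> S" "w' \<in> cells (T / \<rho> i)" by (auto simp: cells_go)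
  then show ?case using 2(2)[of i w'] by simp
qed (simp add: cells_stop)

lemma cells_weight_lower: "w \<in> cells T \<Longrightarrow> T \<le> \<rho>w w"
proof (induction T arbitrary: w rule: level_induct)
  case (2 T)
  then obtain i w' where w: "w = i # w'" "i \<in> S" "w' \<in> cells (T / \<rho> i)" by (auto simp: cells_go)
  have "T / \<rho> i \<le> \<rho>w w'" using 2(2)[OF w(2,3)] .
  then show ?case using w \<rho>_gt_1[of i] by (simp add: pos_divide_le_eq mult.commute)
qed (auto simp: cells_stop)

definition \<rho>max :: real where "\<rho>max = Max (\<rho> ` S)"

lemma \<rho>max: "i \<in> S \<Longrightarrow> \<rho> i \<le> \<rho>max" "1 < \<rho>max"
proof -
  show *: "i \<in> S \<Longrightarrow> \<rho> i \<le> \<rho>max" for i using finite_S by (auto simp: \<rho>max_def)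
  show "1 < \<rho>max" using * S_nonempty \<rho>_gt_1 by (meson all_not_in_conv less_le_trans)
qed

lemma cells_weight_upper: "w \<in> cells T \<Longrightarrow> \<rho>w w \<le> max 1 (T * \<rho>max)"
proof (induction T arbitrary: w rule: level_induct)
  case (2 T)
  then obtain i w' where w: "w = i # w'" "i \<in> S" "w' \<in> cells (T / \<rho> i)" by (auto simp: cells_go)
  have "\<rho>w w' \<le> max 1 (T / \<rho> i * \<rho>max)" using 2(2)[OF w(2,3)] .
  then have "\<rho> i * \<rho>w w' \<le> \<rho> i * max 1 (T / \<rho> i * \<rho>max)" using \<rho>_gt_1[OF w(2)] by (intro mult_left_mono) auto
  also have "\<dots> = max (\<rho> i) (T * \<rho>max)" using \<rho>_gt_1[OF w(2)] by (simp add: max_mult_distrib_left)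
  also have "\<dots> \<le> T * \<rho>max" using \<rho>max w \<open>1 < T\<close> \<rho>_gt_1[OF w(2)] mult_mono[of 1 T "\<rho> i" \<rho>max] by auto
  finally show ?case using w by simp
qed (auto simp: cells_stop)

text \<open>Partitions of higher level refine those of lower level.\<close>

lemma cells_split:
  assumes "w \<in> cells T'" "T \<le> T'"
  shows "\<exists>v\<in>cells T. \<exists>w'\<in>cells (T' / \<rho>w v). w = v @ w'"
  using assms
proof (induction T arbitrary: w T' rule: level_induct)
  case (1 T)
  then show ?case by (simp add: cells_stop)
next
  case (2 T)
  then obtain i w1 where w: "w = i # w1" "i \<in> S" "w1 \<in> cells (T' / \<rho> i)" by (auto simp: cells_go)
  have "T / \<rho> i \<le> T' / \<rho> i" using 2 \<rho>_gt_1[OF w(2)] by (intro divide_right_mono) auto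
  from 2(2)[OF w(2,3) this] obtain v w' where
    "v \<in> cells (T / \<rho> i)" "w' \<in> cells (T' / \<rho> i / \<rho>w v)" "w1 = v @ w'" by blast
  then show ?case using w \<open>1 < T\<close>
    by (intro bexI[of _ "i # v"] bexI[of _ w']) (auto simp: cells_go)
qed

lemma cells_append:
  assumes "v \<in> cells T" "w \<in> cells (T' / \<rho>w v)" "T \<le> T'"
  shows "v @ w \<in> cells T'"
  using assms
proof (induction T arbitrary: v T' rule: level_induct)
  case (2 T)
  then obtain i v1 where v: "v = i # v1" "i \<in> S" "v1 \<in> cells (T / \<rho> i)" by (auto simp: cells_go)
  have "T / \<rho> i \<le> T' / \<rho> i" using 2 \<rho>_gt_1[OF v(2)] by (intro divide_right_mono) auto
  with 2(2)[of i v1 "T' / \<rho> i"] v 2 have "v1 @ w \<in> cells (T' / \<rho> i)" by simp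
  then show ?case using v 2 by (auto simp: cells_go)
qed (simp add: cells_stop)

lemma cells_prefix_free:
  "v \<in> cells T \<Longrightarrow> w \<in> cells T \<Longrightarrow> prepend v \<omega> = prepend w \<tau> \<Longrightarrow> v = w"
proof (induction T arbitrary: v w rule: level_induct)
  case (2 T)
  then obtain i v1 j w1 where "v = i # v1" "i \<in> S" "v1 \<in> cells (T / \<rho> i)"
    "w = j # w1" "j \<in> S" "w1 \<in> cells (T / \<rho> j)" by (auto simp: cells_go)
  then show ?case using 2 by (auto simp: case_nat_inject)
qed (simp add: cells_stop)

lemma cells_append_inject:
  assumes "v \<in> cells T" "v' \<in> cells T" "v @ w = v' @ w'"
  shows "v = v' \<and> w = w'"
proof -
  have pre: "prepend (a @ b) \<omega> = prepend a (prepend b \<omega>)" for a b and \<omega> :: "nat \<Rightarrow> 'i"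
    by (induction a) auto
  have "prepend v (prepend w undefined) = prepend v' (prepend w' undefined)"
    using assms(3) by (simp add: pre[symmetric])
  then have "v = v'" using cells_prefix_free assms by blast
  then show ?thesis using assms by simp
qed

lemma cells_cover: "\<exists>w\<in>cells T. x \<in> range (Fw w)"
proof (induction T arbitrary: x rule: level_induct)
  case (2 T)
  obtain \<omega> where \<omega>: "\<omega> \<in> UNIV \<rightarrow> S" "x = \<pi> \<omega>" using \<pi>_onto by (metis UNIV_I imageE)
  then have \<omega>': "\<omega> 0 \<in> S" "left_shift \<omega> \<in> UNIV \<rightarrow> S" by (auto simp: left_shift_def)
  then have x: "x = F (\<omega> 0) (\<pi> (left_shift \<omega>))" using \<omega> by (simp add: F_\<pi> case_nat_left_shift)
  obtain w where w: "w \<in> cells (T / \<rho> (\<omega> 0))" "\<pi> (left_shift \<omega>) \<in> range (Fw w)" using 2(2)[OF \<omega>'(1)] by blast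
  show ?case using w x \<omega>' 2(1) by (intro bexI[of _ "\<omega> 0 # w"]) (auto simp: cells_go)
qed (simp add: cells_stop)

text \<open>The common core of all self-similarity identities for partitions: if a quantity attached to a word is the
  sum over its children, it is the sum over the words of any partition below it.\<close>

lemma additive_cells_sum:
  assumes add: "\<And>v. set v \<subseteq> S \<Longrightarrow> G v = (\<Sum>i\<in>S. G (v @ [i]))"
  shows "set v \<subseteq> S \<Longrightarrow> G v = (\<Sum>w\<in>cells T. G (v @ w))"
proof (induction T arbitrary: v rule: level_induct)
  case (2 T)
  have "(\<Sum>w\<in>cells T. G (v @ w)) = (\<Sum>i\<in>S. \<Sum>w\<in>cells (T / \<rho> i). G ((v @ [i]) @ w))"
    by (simp add: sum_cells_go[OF 2(1)])
  also have "\<dots> = (\<Sum>i\<in>S. G (v @ [i]))"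
  proof (intro sum.cong refl)
    fix i assume "i \<in> S"
    then show "(\<Sum>w\<in>cells (T / \<rho> i). G ((v @ [i]) @ w)) = G (v @ [i])"
      using 2(2)[of i "v @ [i]"] 2(3) by simp
  qed
  finally show ?case using add[OF 2(3)] by simp
qed (simp add: cells_stop)

lemma energy_cells: "u \<in> \<F> \<Longrightarrow> \<E> u = (\<Sum>w\<in>cells T. \<rho>w w * \<E> (u \<circ> Fw w))"
proof -
  assume u: "u \<in> \<F>"
  have "\<rho>w v * \<E> (u \<circ> Fw v) = (\<Sum>i\<in>S. \<rho>w (v @ [i]) * \<E> (u \<circ> Fw (v @ [i])))" if "set v \<subseteq> S" for v
    using energy_step[OF word_mem[OF u that]]
    by (simp add: word_map_append word_weight_append comp_assoc sum_distrib_left mult.assoc)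
  from additive_cells_sum[of "\<lambda>v. \<rho>w v * \<E> (u \<circ> Fw v)" "[]" T, OF this] show ?thesis by simp
qed

lemma energy_word_le: "u \<in> \<F> \<Longrightarrow> set w \<subseteq> S \<Longrightarrow> \<rho>w w * \<E> (u \<circ> Fw w) \<le> \<E> u"
proof (induction w arbitrary: u)
  case (Cons i w)
  then have i: "i \<in> S" "u \<circ> F i \<in> \<F>" by (auto intro: mem_step)
  have "\<rho> i * (\<rho>w w * \<E> (u \<circ> F i \<circ> Fw w)) \<le> \<rho> i * \<E> (u \<circ> F i)"
    using Cons.prems(2) \<rho>_gt_1[OF i(1)] by (intro mult_left_mono[OF Cons.IH[OF i(2)]]) simp_all
  also have "\<dots> \<le> (\<Sum>i\<in>S. \<rho> i * \<E> (u \<circ> F i))"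
      proof (rule member_le_sum[OF i(1)])
    fix j assume "j \<in> S - {i}"
    then have "j \<in> S" by blast
    then show "0 \<le> \<rho> j * \<E> (u \<circ> F j)"
      using \<rho>_gt_1[of j] energy_nonneg[OF mem_step[OF Cons.prems(1)]] by simp
  qed (rule finite_S)
  also have "\<dots> = \<E> u" using energy_step Cons by simp
  finally show ?case by (simp add: o_def mult.assoc)
qed simp

lemma mem_cells:
  "continuous_on UNIV u \<Longrightarrow> (\<And>w. w \<in> cells T \<Longrightarrow> u \<circ> Fw w \<in> \<F>) \<Longrightarrow> u \<in> \<F>"
proof (induction T arbitrary: u rule: level_induct)
  case (2 T)
  have "u \<circ> F i \<in> \<F>" if i: "i \<in> S" for i
  proof (rule 2(2)[OF i])
    show "continuous_on UNIV (u \<circ> F i)"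
      using 2(3) F_cont[OF i] by (intro continuous_on_compose) (auto intro: continuous_on_subset)
    fix w assume "w \<in> cells (T / \<rho> i)"
    then have "i # w \<in> cells T" using 2(1) i by (auto simp: cells_go)
    then show "u \<circ> F i \<circ> Fw w \<in> \<F>" using 2(4)[of "i # w"] by (simp add: o_def)
  qed
  then show ?case using mem_iff 2(3) by blast
qed (simp add: cells_stop)

subsection \<open>Boundedness of the resistance\<close>

text \<open>Continuity of the coding map: words that agree with \<open>\<omega>\<close> on longer and longer prefixes converge to it.\<close>

lemma prefix_limit:
  assumes "\<omega> \<in> UNIV \<rightarrow> S" "\<tau> \<in> UNIV \<rightarrow> S"
  shows "(\<lambda>n. Fw (map \<omega> [0..<n]) (\<pi> \<tau>)) \<longlonglongrightarrow> \<pi> \<omega>"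
proof -
  have pre: "prepend (map \<omega> [a..<a + n]) \<tau> k = \<omega> (a + k)" if "k < n" for a n k
    using that
  proof (induction n arbitrary: a k)
    case (Suc n)
    have "map \<omega> [a..<a + Suc n] = \<omega> a # map \<omega> [Suc a..<Suc a + n]" by (simp add: upt_rec)
    then show ?case using Suc.IH[of "k - 1" "Suc a"] Suc.prems by (cases k) auto
  qed simp
  have sub: "set (map \<omega> [0..<n]) \<subseteq> S" for n using assms by auto
  have "limitin (product_topology (\<lambda>_::nat. discrete_topology S) UNIV) (\<lambda>n. prepend (map \<omega> [0..<n]) \<tau>) \<omega> sequentially"
    unfolding limitin_componentwise
  proof (intro conjI ballI)
    show "\<forall>\<^sub>F n in sequentially. prepend (map \<omega> [0..<n]) \<tau> \<in> topspace (product_topology (\<lambda>_. discrete_topology S) UNIV)"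
      using assms sub prepend_Pi[of _ \<tau> S] by (intro always_eventually) (auto simp: PiE_UNIV_domain)
    fix k :: nat
    show "limitin (discrete_topology S) (\<lambda>n. prepend (map \<omega> [0..<n]) \<tau> k) (\<omega> k) sequentially"
      using assms pre[of k _ 0]
      by (intro limitin_eventually) (auto simp: eventually_sequentially intro!: exI[of _ "Suc k"])
  qed auto
  then have "limitin euclidean (\<pi> \<circ> (\<lambda>n. prepend (map \<omega> [0..<n]) \<tau>)) (\<pi> \<omega>) sequentially"
    using coding by (intro continuous_map_limit) (auto simp: coding_map_def)
  then have "(\<lambda>n. \<pi> (prepend (map \<omega> [0..<n]) \<tau>)) \<longlonglongrightarrow> \<pi> \<omega>" by (simp add: o_def)
  then show ?thesis using Fw_\<pi>[OF sub assms(2)] by simp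
qed

text \<open>The oscillation of a function over all of \<open>K\<close> is controlled by a geometric series: moving from
  a cell to one of its children costs a fixed resistance divided by the weight of the cell.\<close>

lemma res_bounded: "\<exists>R>0. \<forall>x y. res x y \<le> R"
proof -
  define b where "b = Min (\<rho> ` S)"
  have b: "1 < b" "\<And>i. i \<in> S \<Longrightarrow> b \<le> \<rho> i"
    using finite_S S_nonempty \<rho>_gt_1 by (auto simp: b_def)
  define q where "q = (1 / b) powr (1 / p)"
  have q: "0 < q" "q < 1"
    using b p_gt_1 powr_less_mono2[of "1/p" "1/b" 1] by (auto simp: q_def)
  have weight: "b ^ length w \<le> \<rho>w w" if "set w \<subseteq> S" for w using that
  proof (induction w)
    case (Cons i w)
    then have "b * b ^ length w \<le> \<rho> i * \<rho>w w" using b \<rho>_gt_1[of i] by (intro mult_mono) auto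
    then show ?case by simp
  qed simp
  obtain i0 where "i0 \<in> S" using S_nonempty by blast
  then obtain \<tau> :: "nat \<Rightarrow> 'i" where \<tau>: "\<tau> \<in> UNIV \<rightarrow> S" by (meson Pi_I)
  define z where "z = \<pi> \<tau>"
  define A where "A = 1 + (\<Sum>i\<in>S. res z (F i z))"
  have A: "0 < A" "\<And>i. i \<in> S \<Longrightarrow> res z (F i z) \<le> A"
    using finite_S by (auto simp: A_def res_nonneg sum_nonneg add_pos_nonneg intro!: add_increasing member_le_sum)
  define R where "R = (2 / (1 - q)) powr p * A"
  have "res x y \<le> R" for x y
  proof (rule res_leI)
    show "0 \<le> R" using A by (simp add: R_def)
    fix u assume u: "u \<in> \<F>"
    define X where "X = (A * \<E> u) powr (1 / p)"
    have X: "0 \<le> X" by (simp add: X_def)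
    have step: "\<bar>u (Fw w z) - u (Fw (w @ [i]) z)\<bar> \<le> X * q ^ length w" if w: "set w \<subseteq> S" and i: "i \<in> S" for w i
    proof -
      have uw: "u \<circ> Fw w \<in> \<F>" using u w by (rule word_mem)
      have "\<bar>u (Fw w z) - u (Fw (w @ [i]) z)\<bar> powr p \<le> res z (F i z) * \<E> (u \<circ> Fw w)"
        using diff_powr_le_res[OF uw, of z "F i z"] by (simp add: word_map_append)
      also have "\<dots> \<le> A * (\<E> u / b ^ length w)"
      proof (intro mult_mono A)
        have "b ^ length w * \<E> (u \<circ> Fw w) \<le> \<rho>w w * \<E> (u \<circ> Fw w)"
          using weight[OF w] uw by (intro mult_right_mono energy_nonneg)
        also have "\<dots> \<le> \<E> u" by (rule energy_word_le[OF u w])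
        finally show "\<E> (u \<circ> Fw w) \<le> \<E> u / b ^ length w" using b by (simp add: field_simps)
      qed (use A i uw energy_nonneg in auto)
      also have "\<dots> = A * \<E> u * (1 / b) ^ length w" by (simp add: power_one_over)
      finally have "(\<bar>u (Fw w z) - u (Fw (w @ [i]) z)\<bar> powr p) powr (1/p) \<le> (A * \<E> u * (1 / b) ^ length w) powr (1/p)"
        using p_gt_1 by (intro powr_mono2) auto
      also have "\<dots> = X * ((1 / b) ^ length w) powr (1/p)"
        using A u energy_nonneg by (simp add: powr_mult X_def)
      also have "((1 / b) ^ length w) powr (1/p) = q ^ length w"
        using b by (simp add: q_def powr_realpow[symmetric] powr_powr mult.commute)
      finally show ?thesis using p_gt_1 by (simp add: powr_powr)
    qed
    have partial: "\<bar>u z - u (Fw (map \<omega> [0..<n]) z)\<bar> \<le> X * (\<Sum>k<n. q ^ k)" if \<omega>: "\<omega> \<in> UNIV \<rightarrow> S" for \<omega> n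
    proof (induction n)
      case (Suc n)
      have "\<bar>u (Fw (map \<omega> [0..<n]) z) - u (Fw (map \<omega> [0..<n] @ [\<omega> n]) z)\<bar> \<le> X * q ^ n"
        using step[of "map \<omega> [0..<n]" "\<omega> n"] \<omega> by auto
      then show ?case using Suc by (simp add: distrib_left)
    qed simp
    have lim: "\<bar>u z - u (\<pi> \<omega>)\<bar> \<le> X / (1 - q)" if \<omega>: "\<omega> \<in> UNIV \<rightarrow> S" for \<omega>
    proof (rule LIMSEQ_le_const2)
      have "isCont u (\<pi> \<omega>)" using mem_cont[OF u] by (simp add: continuous_on_eq_continuous_at)
      then show "(\<lambda>n. \<bar>u z - u (Fw (map \<omega> [0..<n]) z)\<bar>) \<longlonglongrightarrow> \<bar>u z - u (\<pi> \<omega>)\<bar>"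
        unfolding z_def by (intro tendsto_intros isCont_tendsto_compose[of _ u] prefix_limit \<omega> \<tau>)
      have "(\<Sum>k<n. q ^ k) \<le> 1 / (1 - q)" for n
        using q by (simp add: sum_gp_strict divide_right_mono)
      then have "X * (\<Sum>k<n. q ^ k) \<le> X / (1 - q)" for n using mult_left_mono[OF _ X, of "\<Sum>k<n. q ^ k" "1 / (1 - q)"] by simp
      then show "\<exists>N. \<forall>n\<ge>N. \<bar>u z - u (Fw (map \<omega> [0..<n]) z)\<bar> \<le> X / (1 - q)"
        using order_trans[OF partial[OF \<omega>]] by blast
    qed
    have "\<bar>u z - u x\<bar> \<le> X / (1 - q)" for x
      using lim \<pi>_onto by (metis UNIV_I imageE)
    from this[of x] this[of y] have "\<bar>u x - u y\<bar> \<le> 2 / (1 - q) * X" by simp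
    then have "\<bar>u x - u y\<bar> powr p \<le> (2 / (1 - q) * X) powr p" using p_gt_1 by (intro powr_mono2) auto
    also have "\<dots> = (2 / (1 - q)) powr p * X powr p" using q by (intro powr_mult)
    also have "X powr p = A * \<E> u"
      using A u energy_nonneg p_gt_1 by (simp add: X_def powr_powr)
    also have "(2 / (1 - q)) powr p * (A * \<E> u) = R * \<E> u" by (simp add: R_def)
    finally show "\<bar>u x - u y\<bar> powr p \<le> R * \<E> u" .
  qed
  moreover have "0 < R" using A q by (simp add: R_def)
  ultimately show ?thesis by blast
qed

definition res_bound :: real where
  "res_bound = (SOME R. R > 0 \<and> (\<forall>x y. res x y \<le> R))"

lemma res_bound: "0 < res_bound" "res x y \<le> res_bound"
proof -
  have "res_bound > 0 \<and> (\<forall>x y. res x y \<le> res_bound)"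
    unfolding res_bound_def using someI_ex[OF res_bounded] .
  then show "0 < res_bound" "res x y \<le> res_bound" by auto
qed

lemma res_cell:
  assumes w: "set w \<subseteq> S"
  shows "res (Fw w x) (Fw w y) \<le> res_bound / \<rho>w w"
proof (rule res_leI)
  show "0 \<le> res_bound / \<rho>w w" using res_bound \<rho>w_pos[OF w] by (simp add: less_imp_le)
  fix u assume u: "u \<in> \<F>"
  have "\<bar>u (Fw w x) - u (Fw w y)\<bar> powr p \<le> res x y * \<E> (u \<circ> Fw w)"
    using diff_powr_le_res[OF word_mem[OF u w]] by simp
  also have "\<dots> \<le> res_bound * (\<E> u / \<rho>w w)"
    using res_bound energy_word_le[OF u w] \<rho>w_pos[OF w] word_mem[OF u w]
    by (intro mult_mono) (auto intro: energy_nonneg simp: field_simps less_imp_le)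
  finally show "\<bar>u (Fw w x) - u (Fw w y)\<bar> powr p \<le> res_bound / \<rho>w w * \<E> u" by simp
qed

lemma res_cells:
  assumes "w \<in> cells T" "0 < T" "x \<in> range (Fw w)" "y \<in> range (Fw w)"
  shows "res x y \<le> res_bound / T"
proof -
  obtain x' y' where xy: "x = Fw w x'" "y = Fw w y'" using assms by auto
  have "res x y \<le> res_bound / \<rho>w w" unfolding xy using res_cell cells_set assms by blast
  also have "\<dots> \<le> res_bound / T" using cells_weight_lower[OF assms(1)] assms(2) res_bound
    by (intro divide_left_mono) (auto simp: less_imp_le)
  finally show ?thesis .
qed

end

section \<open>Vertices, neighbouring cells and interpolation\<close>

context self_similar_form
begin

definition V0 :: "'a set" where
  "V0 = \<pi> ` post_critical_set S F \<pi>"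

lemma finite_V0: "finite V0"
  using pcf by (simp add: V0_def)

text \<open>At the first letter where the two words differ the common point becomes critical; the tail of its
  address behind \<open>w\<close> is therefore post-critical.\<close>

lemma cells_intersect:
  assumes "w \<in> cells T" "v \<in> cells T" "w \<noteq> v" "Fw w x = Fw v y"
  shows "x \<in> V0"
  using assms
proof (induction T arbitrary: w v rule: level_induct)
  case (2 T)
  obtain i w1 where w: "w = i # w1" "i \<in> S" "w1 \<in> cells (T / \<rho> i)" using 2 by (auto simp: cells_go)
  obtain j v1 where v: "v = j # v1" "j \<in> S" "v1 \<in> cells (T / \<rho> j)" using 2 by (auto simp: cells_go)
  show ?case
  proof (cases "i = j")
    case True
    then have "Fw w1 x = Fw v1 y" using 2(6) w v F_inj[OF w(2)] by (auto dest: injD)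
    then show ?thesis using 2(2)[OF w(2,3)] True v w 2(5) by auto
  next
    case False
    obtain \<omega> where \<omega>: "\<omega> \<in> UNIV \<rightarrow> S" "x = \<pi> \<omega>" using \<pi>_onto by (metis UNIV_I imageE)
    have sub: "set w \<subseteq> S" using cells_set 2 by blast
    have "\<pi> (prepend w \<omega>) = F i (Fw w1 x)" "\<pi> (prepend w \<omega>) = F j (Fw v1 y)"
      using 2(6) Fw_\<pi>[OF sub \<omega>(1)] w v \<omega> by simp_all
    then have "\<pi> (prepend w \<omega>) \<in> range (F i) \<inter> range (F j)"
      by (metis IntI rangeI)
    then have "prepend w \<omega> \<in> critical_set S F \<pi>"
      using False w v prepend_Pi[of w \<omega> S] sub \<omega> unfolding critical_set_def by blast
    then have "\<omega> \<in> (left_shift ^^ length w) ` critical_set S F \<pi>"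
      using left_shift_prepend by (metis imageI)
    moreover have "length w \<ge> 1" using w by simp
    ultimately show ?thesis using \<omega> by (auto simp: V0_def post_critical_set_def)
  qed
qed (simp add: cells_stop)

definition point_multiplicity :: nat where
  "point_multiplicity = max 1 (card (critical_set S F \<pi>))"

lemma finite_critical: "finite (critical_set S F \<pi>)"
proof (rule finite_subset)
  show "critical_set S F \<pi> \<subseteq> (\<lambda>(i, \<omega>). case_nat i \<omega>) ` (S \<times> post_critical_set S F \<pi>)"
  proof
    fix \<omega> assume \<omega>: "\<omega> \<in> critical_set S F \<pi>"
    then have "left_shift \<omega> \<in> (left_shift ^^ 1) ` critical_set S F \<pi>" by simp
    then have "left_shift \<omega> \<in> post_critical_set S F \<pi>" unfolding post_critical_set_def by blast
    moreover have "\<omega> 0 \<in> S" using \<omega> by (auto simp: critical_set_def)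
    ultimately show "\<omega> \<in> (\<lambda>(i, \<omega>). case_nat i \<omega>) ` (S \<times> post_critical_set S F \<pi>)"
      using case_nat_left_shift[of \<omega>] by (intro image_eqI[of _ _ "(\<omega> 0, left_shift \<omega>)"]) auto
  qed
qed (use finite_S pcf in auto)

text \<open>Cells of one partition that share a point either lie in a common first-level cell, where one
  argues by self-similarity, or each of them provides a critical word.\<close>

lemma card_cells_at_point: "card {w \<in> cells T. x \<in> range (Fw w)} \<le> point_multiplicity"
proof (induction T arbitrary: x rule: level_induct)
  case (1 T)
  then have "{w \<in> cells T. x \<in> range (Fw w)} \<subseteq> {[]}" by (auto simp: cells_stop)
  then have "card {w \<in> cells T. x \<in> range (Fw w)} \<le> 1" using card_mono[of "{[]}" "{w \<in> cells T. x \<in> range (Fw w)}"] by simp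
  then show ?case by (simp add: point_multiplicity_def)
next
  case (2 T)
  let ?W = "{w \<in> cells T. x \<in> range (Fw w)}"
  show ?case
  proof (cases "\<exists>i\<in>S. \<exists>j\<in>S. i \<noteq> j \<and> x \<in> range (F i) \<inter> range (F j)")
    case True
    have "\<exists>\<omega>. \<omega> \<in> UNIV \<rightarrow> S \<and> x = Fw w (\<pi> \<omega>)" if w: "w \<in> ?W" for w
    proof -
      obtain y where "x = Fw w y" using w by auto
      moreover obtain \<omega> where "\<omega> \<in> UNIV \<rightarrow> S" "y = \<pi> \<omega>" using \<pi>_onto by (metis UNIV_I imageE)
      ultimately show ?thesis by auto
    qed
    then have "\<forall>w\<in>?W. \<exists>\<omega>. \<omega> \<in> UNIV \<rightarrow> S \<and> x = Fw w (\<pi> \<omega>)" by blast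
    from bchoice[OF this] obtain \<omega> where
      \<omega>: "\<And>w. w \<in> ?W \<Longrightarrow> \<omega> w \<in> UNIV \<rightarrow> S \<and> x = Fw w (\<pi> (\<omega> w))" by auto
    have "(\<lambda>w. prepend w (\<omega> w)) ` ?W \<subseteq> critical_set S F \<pi>"
    proof (rule image_subsetI)
      fix w assume w: "w \<in> ?W"
      then have sub: "set w \<subseteq> S" using cells_set by blast
      have "x = \<pi> (prepend w (\<omega> w))" using Fw_\<pi>[OF sub] \<omega>[OF w] by simp
      moreover have "prepend w (\<omega> w) \<in> UNIV \<rightarrow> S" unfolding prepend_Pi using \<omega>[OF w] sub by (intro conjI) simp_all
      ultimately show "prepend w (\<omega> w) \<in> critical_set S F \<pi>" using True by (simp add: critical_set_def)
    qed
    moreover have "inj_on (\<lambda>w. prepend w (\<omega> w)) ?W"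
    proof (rule inj_onI)
      fix w v assume "w \<in> ?W" "v \<in> ?W" "prepend w (\<omega> w) = prepend v (\<omega> v)"
      then show "w = v" using cells_prefix_free[of w T v "\<omega> w" "\<omega> v"] by simp
    qed
    ultimately have "card ?W \<le> card (critical_set S F \<pi>)"
      using finite_critical card_inj_on_le by blast
    then show ?thesis by (simp add: point_multiplicity_def)
  next
    case False
    show ?thesis
    proof (cases "?W = {}")
      case False2: False
      then obtain i y where i: "i \<in> S" and y: "x = F i y" by (auto simp: cells_go[OF 2(1)])
      have "?W \<subseteq> (#) i ` {w \<in> cells (T / \<rho> i). y \<in> range (Fw w)}"
      proof
        fix w assume w: "w \<in> ?W"
        then obtain j w' where j: "w = j # w'" "j \<in> S" "w' \<in> cells (T / \<rho> j)" by (auto simp: cells_go[OF 2(1)])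
        then obtain y' where y': "x = F j (Fw w' y')" using w by auto
        then have "j = i" using False i j(2) y by blast
        then have "y = Fw w' y'" using y y' F_inj[OF i] by (auto dest: injD)
        then show "w \<in> (#) i ` {w \<in> cells (T / \<rho> i). y \<in> range (Fw w)}" using j \<open>j = i\<close> by auto
      qed
      then have "card ?W \<le> card ((#) i ` {w \<in> cells (T / \<rho> i). y \<in> range (Fw w)})"
        using finite_cells by (intro card_mono) auto
      also have "\<dots> = card {w \<in> cells (T / \<rho> i). y \<in> range (Fw w)}" by (intro card_image) auto
      also have "\<dots> \<le> point_multiplicity" using 2(2)[OF i] .
      finally show ?thesis .
    next
      case True
      then show ?thesis unfolding True by simp
    qed
  qed
qed

definition neighbours :: "real \<Rightarrow> 'i list \<Rightarrow> 'i list set" where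
  "neighbours T w = {v \<in> cells T. range (Fw w) \<inter> range (Fw v) \<noteq> {}}"

definition neighbour_bound :: nat where
  "neighbour_bound = 1 + card V0 * point_multiplicity"

lemma neighbours_self: "w \<in> cells T \<Longrightarrow> w \<in> neighbours T w"
  by (auto simp: neighbours_def)

lemma neighbours_sub: "neighbours T w \<subseteq> cells T"
  by (auto simp: neighbours_def)

lemma finite_neighbours: "finite (neighbours T w)"
  using finite_subset[OF neighbours_sub finite_cells] .

lemma card_neighbours: "w \<in> cells T \<Longrightarrow> card (neighbours T w) \<le> neighbour_bound"
proof -
  assume w: "w \<in> cells T"
  let ?W = "\<lambda>x. {v \<in> cells T. x \<in> range (Fw v)}"
  have "neighbours T w \<subseteq> {w} \<union> (\<Union>z\<in>V0. ?W (Fw w z))"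
  proof
    fix v assume v: "v \<in> neighbours T w"
    then obtain x y where xy: "Fw w x = Fw v y" "v \<in> cells T" by (force simp: neighbours_def)
    then have "v \<noteq> w \<Longrightarrow> x \<in> V0" using cells_intersect[OF w, of v x y] by blast
    then show "v \<in> {w} \<union> (\<Union>z\<in>V0. ?W (Fw w z))" using xy by auto
  qed
  then have "card (neighbours T w) \<le> card ({w} \<union> (\<Union>z\<in>V0. ?W (Fw w z)))"
    using finite_V0 finite_cells by (intro card_mono) auto
  also have "\<dots> \<le> card {w} + card (\<Union>z\<in>V0. ?W (Fw w z))" by (rule card_Un_le)
  also have "card (\<Union>z\<in>V0. ?W (Fw w z)) \<le> (\<Sum>z\<in>V0. card (?W (Fw w z)))"
    by (rule card_UN_le[OF finite_V0])
  also have "\<dots> \<le> card V0 * point_multiplicity"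
    using sum_bounded_above[of V0 "\<lambda>z. card (?W (Fw w z))" point_multiplicity] card_cells_at_point by simp
  finally show ?thesis by (simp add: neighbour_bound_def)
qed

text \<open>A product of normalized functions separating \<open>z\<close> from the other vertices.\<close>

lemma bump_exists:
  assumes "z \<in> V0"
  shows "\<exists>\<psi>\<in>\<F>. \<psi> z = 1 \<and> (\<forall>y\<in>V0 - {z}. \<psi> y = 0)"
proof -
  have "\<exists>\<psi>\<in>\<F>. \<psi> z = 1 \<and> (\<forall>y\<in>A. \<psi> y = 0)" if "finite A" "z \<notin> A" for A using that
  proof (induction A rule: finite_induct)
    case empty
    then show ?case by (intro bexI[of _ "\<lambda>_. 1"] const_mem) auto
  next
    case (insert y A)
    then obtain \<psi> where \<psi>: "\<psi> \<in> \<F>" "\<psi> z = 1" "\<forall>y\<in>A. \<psi> y = 0" by auto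
    obtain u where u: "u \<in> \<F>" "u z \<noteq> u y" using separates[of z y] insert by auto
    have "(\<lambda>x. \<psi> x * (inverse (u z - u y) * (u x - u y))) \<in> \<F>"
      by (intro mult_closed scale_mem diff_mem const_mem \<psi> u)
    then show ?case using \<psi> u by (intro bexI) auto
  qed
  then show ?thesis using finite_V0 by blast
qed

definition bump :: "'a \<Rightarrow> 'a \<Rightarrow> real" where
  "bump z = (SOME \<psi>. \<psi> \<in> \<F> \<and> \<psi> z = 1 \<and> (\<forall>y\<in>V0 - {z}. \<psi> y = 0))"

lemma bump:
  assumes "z \<in> V0"
  shows "bump z \<in> \<F>" "bump z z = 1" "y \<in> V0 \<Longrightarrow> y \<noteq> z \<Longrightarrow> bump z y = 0"
proof -
  have "bump z \<in> \<F> \<and> bump z z = 1 \<and> (\<forall>y\<in>V0 - {z}. bump z y = 0)"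
    unfolding bump_def by (rule someI_ex[of "\<lambda>\<psi>. \<psi> \<in> \<F> \<and> \<psi> z = 1 \<and> (\<forall>y\<in>V0 - {z}. \<psi> y = 0)"])
      (use bump_exists[OF assms] in blast)
  then show "bump z \<in> \<F>" "bump z z = 1" "y \<in> V0 \<Longrightarrow> y \<noteq> z \<Longrightarrow> bump z y = 0" by auto
qed

text \<open>Written as a deviation from \<open>c\<close>, so that energy and distance from \<open>c\<close> are both controlled by the
  differences \<open>a z - c\<close> at the vertices.\<close>

definition interpolate :: "real \<Rightarrow> ('a \<Rightarrow> real) \<Rightarrow> 'a \<Rightarrow> real" where
  "interpolate c a = (\<lambda>x. c + (\<Sum>z\<in>V0. (a z - c) * bump z x))"

lemma interpolate_vertex: "z \<in> V0 \<Longrightarrow> interpolate c a z = a z"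
proof -
  assume z: "z \<in> V0"
  have "(\<Sum>y\<in>V0. (a y - c) * bump y z) = (\<Sum>y\<in>V0. if y = z then a z - c else 0)"
    using bump z by (intro sum.cong) auto
  then show ?thesis using z finite_V0 by (simp add: interpolate_def)
qed

lemma interpolate_mem: "interpolate c a \<in> \<F>"
  unfolding interpolate_def using finite_V0 bump by (intro add_mem sum_mem scale_mem const_mem) auto

definition interp_const :: real where
  "interp_const = 1 + (real (card V0) * (\<Sum>z\<in>V0. seminorm (bump z))) powr p"

lemma interp_const_pos: "0 < interp_const"
  by (simp add: interp_const_def add_pos_nonneg)

lemma interpolate_energy: "\<E> (interpolate c a) \<le> interp_const * (\<Sum>z\<in>V0. \<bar>a z - c\<bar> powr p)"
proof -
  define B where "B = (\<Sum>z\<in>V0. seminorm (bump z))"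
  have B0: "0 \<le> B" by (simp add: B_def sum_nonneg seminorm_nonneg)
  have B: "seminorm (bump z) \<le> B" if "z \<in> V0" for z
    unfolding B_def using that finite_V0 seminorm_nonneg by (intro member_le_sum) auto
  let ?g = "\<lambda>x. \<Sum>z\<in>V0. (a z - c) * bump z x"
  have g: "?g \<in> \<F>" using finite_V0 bump by (intro sum_mem scale_mem) auto
  have "interpolate c a = (\<lambda>x. ?g x + c)" by (auto simp: interpolate_def)
  then have *: "\<E> (interpolate c a) = seminorm ?g powr p"
    using energy_add_const[OF g] energy_eq_seminorm[OF g] by simp
  have "seminorm ?g \<le> (\<Sum>z\<in>V0. seminorm (\<lambda>x. (a z - c) * bump z x))"
    using finite_V0 bump by (intro seminorm_sum scale_mem) auto
  also have "\<dots> = (\<Sum>z\<in>V0. \<bar>a z - c\<bar> * seminorm (bump z))"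
    using bump by (intro sum.cong refl seminorm_scale) auto
  also have "\<dots> \<le> (\<Sum>z\<in>V0. \<bar>a z - c\<bar> * B)"
    using B by (intro sum_mono mult_left_mono) auto
  also have "\<dots> = B * (\<Sum>z\<in>V0. \<bar>a z - c\<bar>)" by (simp add: sum_distrib_left mult.commute)
  finally have "seminorm ?g \<le> B * (\<Sum>z\<in>V0. \<bar>a z - c\<bar>)" .
  with * have "\<E> (interpolate c a) \<le> (B * (\<Sum>z\<in>V0. \<bar>a z - c\<bar>)) powr p"
    using p_gt_1 seminorm_nonneg by (simp add: powr_mono2)
  also have "\<dots> = B powr p * (\<Sum>z\<in>V0. \<bar>a z - c\<bar>) powr p"
    using B0 by (simp add: powr_mult sum_nonneg)
  also have "\<dots> \<le> B powr p * (real (card V0) powr p * (\<Sum>z\<in>V0. \<bar>a z - c\<bar> powr p))"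
    using finite_V0 p_gt_1 by (intro mult_left_mono powr_sum_le_card) auto
  also have "\<dots> = (interp_const - 1) * (\<Sum>z\<in>V0. \<bar>a z - c\<bar> powr p)"
    using B0 by (simp add: interp_const_def B_def[symmetric] powr_mult)
  also have "\<dots> \<le> interp_const * (\<Sum>z\<in>V0. \<bar>a z - c\<bar> powr p)"
    by (intro mult_right_mono) (auto simp: sum_nonneg)
  finally show ?thesis .
qed

text \<open>Since distinct cells meet only in vertices, functions on the cells that take prescribed
  values at the vertices fit together.\<close>

lemma glue:
  "\<exists>h\<in>\<F>. \<forall>w\<in>cells T. h \<circ> Fw w = interpolate (c w) (\<lambda>z. a (Fw w z))"
proof -
  define g where "g = (\<lambda>w. interpolate (c w) (\<lambda>z. a (Fw w z)))"
  have agree: "g w x = g v y" if "w \<in> cells T" "v \<in> cells T" "Fw w x = Fw v y" for w v x y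
  proof (cases "w = v")
    case True
    then show ?thesis using that Fw_inj[OF cells_set[OF that(1)]] by (auto dest: injD)
  next
    case False
    have "x \<in> V0" "y \<in> V0"
      using cells_intersect[OF that(1,2) False that(3)] cells_intersect[OF that(2,1) _ that(3)[symmetric]] False by auto
    then show ?thesis using that(3) by (simp add: g_def interpolate_vertex)
  qed
  have "\<exists>w y. w \<in> cells T \<and> x = Fw w y" for x using cells_cover[of T x] by blast
  then obtain cell pos where cp: "\<And>x. cell x \<in> cells T" "\<And>x. x = Fw (cell x) (pos x)" by metis
  define h where "h = (\<lambda>x. g (cell x) (pos x))"
  have h: "h (Fw w y) = g w y" if "w \<in> cells T" for w y
    unfolding h_def using agree[OF cp(1) that, of "Fw w y" "pos (Fw w y)" y] cp(2)[of "Fw w y"] by simp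
  have hw: "h \<circ> Fw w = g w" if "w \<in> cells T" for w using h[OF that] by auto
  have gF: "g w \<in> \<F>" for w unfolding g_def by (rule interpolate_mem)
  \<comment> \<open>preimages of closed sets are finite unions of compact sets\<close>
  have "continuous_on UNIV h"
    unfolding continuous_on_closed_vimage[OF closed_UNIV]
  proof (intro allI impI)
    fix B :: "real set" assume B: "closed B"
    have "h -` B \<inter> UNIV = (\<Union>w\<in>cells T. Fw w ` (g w -` B))"
    proof (intro equalityI subsetI)
      fix x assume "x \<in> h -` B \<inter> UNIV"
      then show "x \<in> (\<Union>w\<in>cells T. Fw w ` (g w -` B))"
        using cp[of x] by (auto simp: h_def intro!: bexI[of _ "cell x"] image_eqI[of _ _ "pos x"])
    qed (use h in auto)
    moreover have "closed (Fw w ` (g w -` B))" if "w \<in> cells T" for w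
    proof (intro compact_imp_closed compact_continuous_image)
      have "closed (g w -` B)" using mem_cont[OF gF, of w] B by (auto simp: continuous_on_closed_vimage)
      then show "compact (g w -` B)" using compact_Int_closed[OF compact_UNIV] by auto
      show "continuous_on (g w -` B) (Fw w)" using Fw_cont[OF cells_set[OF that]] continuous_on_subset by blast
    qed
    ultimately show "closed (h -` B \<inter> UNIV)" using finite_cells by auto
  qed
  then have "h \<in> \<F>" using mem_cells[of h T] hw gF by auto
  then show ?thesis using hw unfolding g_def by blast
qed

text \<open>Give the value 1 to the cells of \<open>A\<close> and to their vertices, and 0 to everything else. Energy arises
  only in the cells adjacent to \<open>A\<close>, and there all differences are at most 1.\<close>

lemma cutoff:
  assumes A: "A \<subseteq> cells T"
  shows "\<exists>\<phi>\<in>\<F>. (\<forall>w\<in>A. \<forall>x\<in>range (Fw w). \<phi> x = 1) \<and>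
    (\<forall>v\<in>cells T - (\<Union>w\<in>A. neighbours T w). \<forall>x\<in>range (Fw v). \<phi> x = 0) \<and>
    \<E> \<phi> \<le> (\<Sum>v\<in>(\<Union>w\<in>A. neighbours T w). \<rho>w v) * (interp_const * real (card V0))"
proof -
  define c :: "'i list \<Rightarrow> real" where "c = (\<lambda>w. if w \<in> A then 1 else 0)"
  define a :: "'a \<Rightarrow> real" where "a = (\<lambda>q. if \<exists>w\<in>A. q \<in> range (Fw w) then 1 else 0)"
  define N where "N = (\<Union>w\<in>A. neighbours T w)"
  have NT: "N \<subseteq> cells T" using neighbours_sub by (auto simp: N_def)
  obtain \<phi> where \<phi>: "\<phi> \<in> \<F>" "\<And>w. w \<in> cells T \<Longrightarrow> \<phi> \<circ> Fw w = interpolate (c w) (\<lambda>z. a (Fw w z))"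
    using glue by blast
  have "\<phi> x = 1" if wx: "w \<in> A" "x \<in> range (Fw w)" for w x
  proof -
    obtain y where y: "x = Fw w y" using wx(2) by auto
    have "\<phi> x = interpolate (c w) (\<lambda>z. a (Fw w z)) y" using fun_cong[OF \<phi>(2), of w y] A wx y by auto
    moreover have "a (Fw w z) = 1" "c w = 1" for z using wx by (auto simp: a_def c_def)
    ultimately show ?thesis by (simp add: interpolate_def)
  qed
  moreover have far: "c v = 0 \<and> a (Fw v z) = 0" if "v \<in> cells T - N" for v z
    using that A neighbours_self by (force simp: c_def a_def N_def neighbours_def)
  have "\<phi> x = 0" if vx: "v \<in> cells T - N" "x \<in> range (Fw v)" for v x
  proof -
    obtain y where y: "x = Fw v y" using vx(2) by auto
    have "\<phi> x = interpolate (c v) (\<lambda>z. a (Fw v z)) y" using fun_cong[OF \<phi>(2), of v y] vx y by auto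
    then show ?thesis using far[OF vx(1)] by (simp add: interpolate_def)
  qed
  moreover have "\<E> \<phi> \<le> (\<Sum>v\<in>N. \<rho>w v) * (interp_const * real (card V0))"
  proof -
    have le: "\<E> (\<phi> \<circ> Fw v) \<le> interp_const * real (card V0)" if "v \<in> cells T" for v
    proof -
      have "\<E> (\<phi> \<circ> Fw v) \<le> interp_const * (\<Sum>z\<in>V0. \<bar>a (Fw v z) - c v\<bar> powr p)"
        using \<phi>(2)[OF that] interpolate_energy by simp
      also have "\<dots> \<le> interp_const * (\<Sum>z\<in>V0. 1)"
        using interp_const_pos p_gt_1 by (intro mult_left_mono sum_mono) (auto simp: a_def c_def)
      finally show ?thesis by simp
    qed
    have zero: "\<E> (\<phi> \<circ> Fw v) = 0" if "v \<in> cells T - N" for v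
      using \<phi>(2)[of v] that far[OF that] by (simp add: interpolate_def energy_const)
    have "\<E> \<phi> = (\<Sum>v\<in>cells T. \<rho>w v * \<E> (\<phi> \<circ> Fw v))" by (rule energy_cells[OF \<phi>(1)])
    also have "\<dots> = (\<Sum>v\<in>N. \<rho>w v * \<E> (\<phi> \<circ> Fw v))"
      using zero NT finite_cells by (intro sum.mono_neutral_right) auto
    also have "\<dots> \<le> (\<Sum>v\<in>N. \<rho>w v * (interp_const * real (card V0)))"
      using le NT \<rho>w_pos[OF cells_set] by (intro sum_mono mult_left_mono) (auto simp: less_imp_le subset_iff)
    finally show ?thesis by (simp add: sum_distrib_right)
  qed
  ultimately show ?thesis using \<phi>(1) unfolding N_def by blast
qed

definition separation :: real where
  "separation = 1 / (1 + real neighbour_bound * \<rho>max * (interp_const * real (card V0)))"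

lemma separation_pos: "0 < separation"
  using \<rho>max(2) interp_const_pos by (simp add: separation_def add_pos_nonneg)

text \<open>Conversely to the upper bound on the diameter of cells, leaving the neighbourhood of a cell
  costs a resistance comparable to that of the cell.\<close>

lemma close_points_neighbours:
  assumes w: "w \<in> cells T" "x \<in> range (Fw w)" and T: "1 \<le> T" and r: "res x y < separation / T"
  shows "\<exists>v\<in>neighbours T w. y \<in> range (Fw v)"
proof (rule ccontr)
  assume *: "\<not> ?thesis"
  obtain \<phi> where \<phi>: "\<phi> \<in> \<F>" "\<And>x. x \<in> range (Fw w) \<Longrightarrow> \<phi> x = 1"
    "\<And>v x. v \<in> cells T - neighbours T w \<Longrightarrow> x \<in> range (Fw v) \<Longrightarrow> \<phi> x = 0"
    "\<E> \<phi> \<le> (\<Sum>v\<in>neighbours T w. \<rho>w v) * (interp_const * real (card V0))"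
    using cutoff[of "{w}" T] w by auto
  obtain v where "v \<in> cells T" "y \<in> range (Fw v)" using cells_cover by blast
  then have "\<phi> y = 0" using * \<phi>(3)[of v y] by blast
  define D where "D = 1 + real neighbour_bound * \<rho>max * (interp_const * real (card V0))"
  have D: "0 < D" using \<rho>max(2) interp_const_pos by (simp add: D_def add_pos_nonneg)
  have "(\<Sum>v\<in>neighbours T w. \<rho>w v) \<le> (\<Sum>v\<in>neighbours T w. T * \<rho>max)"
  proof (rule sum_mono)
    fix v assume "v \<in> neighbours T w"
    then have "\<rho>w v \<le> max 1 (T * \<rho>max)" using cells_weight_upper neighbours_sub by blast
    moreover have "1 * 1 \<le> T * \<rho>max" using T \<rho>max by (intro mult_mono) auto
    ultimately show "\<rho>w v \<le> T * \<rho>max" by simp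
  qed
  also have "\<dots> \<le> real neighbour_bound * (T * \<rho>max)"
    using card_neighbours[OF w(1)] T \<rho>max by (simp add: mult_right_mono)
  finally have "\<E> \<phi> \<le> real neighbour_bound * (T * \<rho>max) * (interp_const * real (card V0))"
    using \<phi>(4) interp_const_pos by (meson mult_right_mono order_trans less_imp_le mult_nonneg_nonneg of_nat_0_le_iff)
  also have "\<dots> = T * (D - 1)" by (simp add: D_def)
  also have "\<dots> \<le> T * D" using T by simp
  finally have "1 / (T * D) \<le> res x y" using res_lower[OF \<phi>(1) \<phi>(2)[OF w(2)] \<open>\<phi> y = 0\<close>] by blast
  moreover have "separation / T = 1 / (T * D)" by (simp add: separation_def D_def)
  ultimately show False using r by simp
qed

end

section \<open>Resistance and topology\<close>

context self_similar_form
begin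

text \<open>The resistance is bounded below by finitely many continuous functions on a compact set of pairs
  of distinct points.\<close>

lemma res_separated:
  assumes A: "closed A" and B: "closed B" and AB: "A \<inter> B = {}"
  shows "\<exists>\<epsilon>>0. \<forall>x\<in>A. \<forall>y\<in>B. \<epsilon> \<le> res x y"
proof -
  \<comment> \<open>the resistance exceeds \<open>c\<close> on the open set \<open>G (u, c)\<close>\<close>
  define G where "G = (\<lambda>(u, c). {z :: 'a \<times> 'a. c * \<E> u < \<bar>u (fst z) - u (snd z)\<bar> powr p})"
  have compact: "compact (A \<times> B)"
    using compact_Int_closed[OF compact_UNIV A] compact_Int_closed[OF compact_UNIV B] by (intro compact_Times) auto
  have open_G: "open (G z)" if "z \<in> \<F> \<times> {0<..}" for z
  proof -
    obtain u c where z: "z = (u, c)" "u \<in> \<F>" using \<open>z \<in> \<F> \<times> {0<..}\<close> by auto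
    have "continuous_on UNIV (\<lambda>z. u (fst z))" "continuous_on UNIV (\<lambda>z. u (snd z))"
      by (intro continuous_on_compose2[OF mem_cont[OF z(2)]] continuous_intros; simp)+
    then show ?thesis unfolding z G_def prod.case
      using p_gt_1 by (intro open_Collect_less continuous_intros continuous_on_powr') auto
  qed
  have cover: "A \<times> B \<subseteq> (\<Union>z\<in>\<F> \<times> {0<..}. G z)"
  proof
    fix z assume "z \<in> A \<times> B"
    then have "fst z \<noteq> snd z" using AB by auto
    then obtain u where u: "u \<in> \<F>" "u (fst z) \<noteq> u (snd z)" using separates by blast
    then have E: "0 < \<E> u" using energy_pos by blast
    define c where "c = \<bar>u (fst z) - u (snd z)\<bar> powr p / (2 * \<E> u)"
    have "0 < c" using u E by (simp add: c_def)
    moreover have "c * \<E> u < \<bar>u (fst z) - u (snd z)\<bar> powr p" using u E by (simp add: c_def)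
    ultimately show "z \<in> (\<Union>z\<in>\<F> \<times> {0<..}. G z)" using u by (auto simp: G_def intro!: bexI[of _ "(u, c)"])
  qed
  obtain D where D: "D \<subseteq> \<F> \<times> {0<..}" "finite D" "A \<times> B \<subseteq> (\<Union>z\<in>D. G z)"
    using compactE_image[OF compact open_G cover] by blast
  define \<epsilon> where "\<epsilon> = Min (insert 1 (snd ` D))"
  have "0 < \<epsilon>" using D by (auto simp: \<epsilon>_def)
  moreover have "\<epsilon> \<le> res x y" if xy: "x \<in> A" "y \<in> B" for x y
  proof -
    obtain u c where uc: "(u, c) \<in> D" "c * \<E> u < \<bar>u x - u y\<bar> powr p"
      using D(3) xy by (fastforce simp: G_def)
    have u: "u \<in> \<F>" "0 < c" using uc D(1) by auto
    then have "0 \<le> c * \<E> u" using energy_nonneg by simp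
    then have "u x \<noteq> u y" using uc(2) p_gt_1 by auto
    then have E: "0 < \<E> u" using energy_pos u by blast
    have "c * \<E> u < res x y * \<E> u" using uc(2) diff_powr_le_res[OF u(1), of x y] by linarith
    then have "c \<le> res x y" using E by simp
    moreover have "\<epsilon> \<le> c" using uc(1) D(2) by (force simp: \<epsilon>_def intro: Min_le)
    ultimately show ?thesis by linarith
  qed
  ultimately show ?thesis by blast
qed

lemma small_cell_subset:
  assumes "open V" "x \<in> V"
  shows "\<exists>T. \<exists>w\<in>cells T. range (Fw w) \<subseteq> V"
proof -
  obtain \<epsilon> where \<epsilon>: "0 < \<epsilon>" "\<And>y. y \<notin> V \<Longrightarrow> \<epsilon> \<le> res x y"
    using res_separated[of "{x}" "- V"] assms by auto
  define T where "T = 2 * res_bound / \<epsilon>"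
  have T: "0 < T" "res_bound / T < \<epsilon>" using \<epsilon> res_bound(1) by (auto simp: T_def)
  obtain w where w: "w \<in> cells T" "x \<in> range (Fw w)" using cells_cover by blast
  have "y \<in> V" if "y \<in> range (Fw w)" for y
    using res_cells[OF w(1) T(1) w(2) that] \<epsilon>(2)[of y] T(2) by force
  then show ?thesis using w by blast
qed

end

section \<open>The self-similar measure\<close>

locale self_similar_measure_form = self_similar_form p \<E> \<F> S F \<rho> \<pi>
  for p :: real and \<E> :: "('a::polish_space \<Rightarrow> real) \<Rightarrow> real" and \<F>
    and S :: "'i set" and F :: "'i \<Rightarrow> 'a \<Rightarrow> 'a" and \<rho> :: "'i \<Rightarrow> real" and \<pi> :: "(nat \<Rightarrow> 'i) \<Rightarrow> 'a" +
  fixes d :: real and m :: "'a measure"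
  assumes d_pos: "0 < d"
    and measure: "self_similar_measure S F (\<lambda>i. \<rho> i powr (- d / (p - 1))) m"
begin

definition \<theta>w :: "'i list \<Rightarrow> real" where
  "\<theta>w w = \<rho>w w powr (- d / (p - 1))"

lemma sets_m [measurable_cong, simp]: "sets m = sets borel"
  using measure by (simp add: self_similar_measure_def)

lemma space_m [simp]: "space m = UNIV"
  using sets_eq_imp_space_eq[OF sets_m] by simp

lemma emeasure_UNIV: "emeasure m UNIV = 1"
  using measure by (simp add: self_similar_measure_def)

lemma finite_m: "finite_measure m"
  by (rule finite_measureI) (simp add: emeasure_UNIV)

lemma F_measurable [measurable]: "i \<in> S \<Longrightarrow> F i \<in> borel_measurable borel"
  using F_cont by (rule borel_measurable_continuous_onI)

lemma Fw_measurable [measurable]: "set w \<subseteq> S \<Longrightarrow> Fw w \<in> borel_measurable borel"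
  using Fw_cont by (rule borel_measurable_continuous_onI)

lemma mem_measurable: "u \<in> \<F> \<Longrightarrow> u \<in> borel_measurable borel"
  using mem_cont by (rule borel_measurable_continuous_onI)

lemma range_Fw_borel: "set w \<subseteq> S \<Longrightarrow> range (Fw w) \<in> sets borel"
  using compact_continuous_image[OF Fw_cont compact_UNIV] by (intro borel_compact)

lemma \<theta>w_pos: "set w \<subseteq> S \<Longrightarrow> 0 < \<theta>w w"
  using \<rho>w_pos[of w] by (simp add: \<theta>w_def)

lemma \<theta>w_Cons: "set (i # w) \<subseteq> S \<Longrightarrow> \<theta>w (i # w) = \<rho> i powr (- d / (p - 1)) * \<theta>w w"
  using \<rho>_gt_1[of i] \<rho>w_pos[of w] by (simp add: \<theta>w_def powr_mult)

lemma borel_measurable_m: "h \<in> borel_measurable borel \<Longrightarrow> h \<in> borel_measurable m"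
  using measurable_cong_sets[OF sets_m refl, of borel] by simp

lemma comp_F_measurable:
  "h \<in> borel_measurable borel \<Longrightarrow> i \<in> S \<Longrightarrow> (\<lambda>x. h (F i x)) \<in> borel_measurable m"
  by (intro borel_measurable_m measurable_compose[OF F_measurable])

lemma nn_integral_step:
  assumes "h \<in> borel_measurable borel"
  shows "(\<integral>\<^sup>+x. h x \<partial>m) = (\<Sum>i\<in>S. ennreal (\<rho> i powr (- d / (p - 1))) * (\<integral>\<^sup>+x. h (F i x) \<partial>m))"
  using assms
proof (induction h rule: borel_measurable_induct)
  case (cong f g)
  then have "f = g" by auto
  then show ?case using cong by simp
next
  case (set A)
  have "emeasure m A = (\<Sum>i\<in>S. ennreal (\<rho> i powr (- d / (p - 1))) * emeasure (distr m borel (F i)) A)"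
    using measure set by (auto simp: self_similar_measure_def)
  also have "\<dots> = (\<Sum>i\<in>S. ennreal (\<rho> i powr (- d / (p - 1))) * (\<integral>\<^sup>+x. indicator A (F i x) \<partial>m))"
  proof (intro sum.cong refl arg_cong2[where f = "(*)"])
    fix i assume i: "i \<in> S"
    have "emeasure (distr m borel (F i)) A = (\<integral>\<^sup>+x. indicator A x \<partial>distr m borel (F i))"
      using set by simp
    also have "\<dots> = (\<integral>\<^sup>+x. indicator A (F i x) \<partial>m)"
      using set i by (intro nn_integral_distr) auto
    finally show "emeasure (distr m borel (F i)) A = (\<integral>\<^sup>+x. indicator A (F i x) \<partial>m)" .
  qed
  finally show ?case using set by simp
next
  case (mult u c)
  have "(\<integral>\<^sup>+x. c * u (F i x) \<partial>m) = c * (\<integral>\<^sup>+x. u (F i x) \<partial>m)" if "i \<in> S" for i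
    using mult that by (intro nn_integral_cmult comp_F_measurable)
  moreover have "(\<integral>\<^sup>+x. c * u x \<partial>m) = c * (\<integral>\<^sup>+x. u x \<partial>m)"
    using mult by (intro nn_integral_cmult borel_measurable_m)
  ultimately show ?case using mult by (simp add: sum_distrib_left mult.left_commute)
next
  case (add u v)
  have "(\<integral>\<^sup>+x. v (F i x) + u (F i x) \<partial>m) = (\<integral>\<^sup>+x. v (F i x) \<partial>m) + (\<integral>\<^sup>+x. u (F i x) \<partial>m)" if "i \<in> S" for i
    using add that by (intro nn_integral_add comp_F_measurable)
  moreover have "(\<integral>\<^sup>+x. v x + u x \<partial>m) = (\<integral>\<^sup>+x. v x \<partial>m) + (\<integral>\<^sup>+x. u x \<partial>m)"
    using add by (intro nn_integral_add borel_measurable_m)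
  ultimately show ?case using add by (simp add: sum.distrib distrib_left)
next
  case (seq U)
  have meas: "(\<lambda>x. U k (F i x)) \<in> borel_measurable m" if "i \<in> S" for i k
    using seq(1) that by (intro comp_F_measurable)
  have inc: "incseq (\<lambda>k x. U k (F i x))" for i using \<open>incseq U\<close> by (auto simp: incseq_def le_fun_def)
  have incI: "incseq (\<lambda>k. ennreal (\<rho> i powr (- d / (p - 1))) * (\<integral>\<^sup>+x. U k (F i x) \<partial>m))" for i
    using inc[of i] by (auto simp: incseq_def le_fun_def intro!: mult_left_mono nn_integral_mono)
  have "(\<integral>\<^sup>+x. (SUP k. U k x) \<partial>m) = (SUP k. \<integral>\<^sup>+x. U k x \<partial>m)"
    using seq by (intro nn_integral_monotone_convergence_SUP borel_measurable_m)
  also have "\<dots> = (SUP k. \<Sum>i\<in>S. ennreal (\<rho> i powr (- d / (p - 1))) * (\<integral>\<^sup>+x. U k (F i x) \<partial>m))"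
    using seq by simp
  also have "\<dots> = (\<Sum>i\<in>S. SUP k. ennreal (\<rho> i powr (- d / (p - 1))) * (\<integral>\<^sup>+x. U k (F i x) \<partial>m))"
    using incI by (intro ennreal_SUP_sum) auto
  also have "\<dots> = (\<Sum>i\<in>S. ennreal (\<rho> i powr (- d / (p - 1))) * (\<integral>\<^sup>+x. (SUP k. U k (F i x)) \<partial>m))"
    using inc meas by (intro sum.cong refl)
      (simp add: SUP_mult_left_ennreal nn_integral_monotone_convergence_SUP)
  finally show ?case by (simp add: image_comp)
qed

lemma nn_integral_cells:
  "h \<in> borel_measurable borel \<Longrightarrow>
    (\<integral>\<^sup>+x. h x \<partial>m) = (\<Sum>w\<in>cells T. ennreal (\<theta>w w) * (\<integral>\<^sup>+x. h (Fw w x) \<partial>m))"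
proof (induction T arbitrary: h rule: level_induct)
  case (1 T)
  then show ?case by (simp add: cells_stop \<theta>w_def)
next
  case (2 T)
  have "(\<integral>\<^sup>+x. h x \<partial>m) = (\<Sum>i\<in>S. ennreal (\<rho> i powr (- d / (p - 1))) * (\<integral>\<^sup>+x. h (F i x) \<partial>m))"
    by (rule nn_integral_step[OF 2(3)])
  also have "\<dots> = (\<Sum>i\<in>S. \<Sum>w\<in>cells (T / \<rho> i). ennreal (\<theta>w (i # w)) * (\<integral>\<^sup>+x. h (Fw (i # w) x) \<partial>m))"
  proof (intro sum.cong refl)
    fix i assume i: "i \<in> S"
    have "(\<lambda>x. h (F i x)) \<in> borel_measurable borel"
      using measurable_comp[OF F_measurable[OF i] 2(3)] by (simp add: o_def)
    from 2(2)[OF i this]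
    have "ennreal (\<rho> i powr (- d / (p - 1))) * (\<integral>\<^sup>+x. h (F i x) \<partial>m)
      = (\<Sum>w\<in>cells (T / \<rho> i). ennreal (\<rho> i powr (- d / (p - 1))) * (ennreal (\<theta>w w) * (\<integral>\<^sup>+x. h (F i (Fw w x)) \<partial>m)))"
      by (simp add: sum_distrib_left)
    also have "\<dots> = (\<Sum>w\<in>cells (T / \<rho> i). ennreal (\<theta>w (i # w)) * (\<integral>\<^sup>+x. h (Fw (i # w) x) \<partial>m))"
    proof (intro sum.cong refl)
      fix w assume "w \<in> cells (T / \<rho> i)"
      then have "set (i # w) \<subseteq> S" using cells_set i by auto
      then show "ennreal (\<rho> i powr (- d / (p - 1))) * (ennreal (\<theta>w w) * (\<integral>\<^sup>+x. h (F i (Fw w x)) \<partial>m))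
        = ennreal (\<theta>w (i # w)) * (\<integral>\<^sup>+x. h (Fw (i # w) x) \<partial>m)"
        using \<theta>w_pos[of w] by (simp add: \<theta>w_Cons ennreal_mult mult.assoc less_imp_le)
    qed
    finally show "ennreal (\<rho> i powr (- d / (p - 1))) * (\<integral>\<^sup>+x. h (F i x) \<partial>m)
      = (\<Sum>w\<in>cells (T / \<rho> i). ennreal (\<theta>w (i # w)) * (\<integral>\<^sup>+x. h (Fw (i # w) x) \<partial>m))" .
  qed
  also have "\<dots> = (\<Sum>w\<in>cells T. ennreal (\<theta>w w) * (\<integral>\<^sup>+x. h (Fw w x) \<partial>m))"
    by (rule sum_cells_go[OF 2(1), symmetric])
  finally show ?case .
qed

lemma emeasure_cell_lower:
  assumes w: "w \<in> cells T" and A: "A \<in> sets borel" "range (Fw w) \<subseteq> A"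
  shows "ennreal (\<theta>w w) \<le> emeasure m A"
proof -
  have "ennreal (\<theta>w w) = ennreal (\<theta>w w) * (\<integral>\<^sup>+x. indicator A (Fw w x) \<partial>m)"
    using A(2) emeasure_UNIV by (simp add: indicator_def image_subset_iff cong: if_cong)
  also have "\<dots> \<le> (\<Sum>w\<in>cells T. ennreal (\<theta>w w) * (\<integral>\<^sup>+x. indicator A (Fw w x) \<partial>m))"
    using w finite_cells by (intro member_le_sum) auto
  also have "\<dots> = (\<integral>\<^sup>+x. indicator A x \<partial>m)"
    using A by (intro nn_integral_cells[symmetric]) auto
  finally show ?thesis using A by simp
qed

text \<open>Decomposing the measure over the partition, only cells meeting the union contribute; there are at most \<open>neighbour_bound\<close>
  of them for each cell of \<open>N\<close>, and the weight of each is at most \<open>T powr (- d / (p - 1))\<close>.\<close>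

lemma emeasure_cells_upper:
  assumes N: "N \<subseteq> cells T" "card N \<le> n" and T: "1 \<le> T"
  shows "emeasure m (\<Union>w\<in>N. range (Fw w)) \<le> ennreal (real n * real neighbour_bound * T powr (- d / (p - 1)))"
proof -
  define A where "A = (\<Union>w\<in>N. range (Fw w))"
  define M where "M = (\<Union>w\<in>N. neighbours T w)"
  have fN: "finite N" using N finite_cells finite_subset by blast
  have A: "A \<in> sets borel" unfolding A_def using fN N(1) range_Fw_borel[OF cells_set] by auto
  have M: "M \<subseteq> cells T" "finite M" using neighbours_sub finite_neighbours fN by (auto simp: M_def)
  have "real (card M) \<le> real n * real neighbour_bound"
  proof -
    have "card M \<le> (\<Sum>w\<in>N. card (neighbours T w))" unfolding M_def by (rule card_UN_le[OF fN])
    also have "\<dots> \<le> card N * neighbour_bound" using sum_bounded_above[of N "\<lambda>w. card (neighbours T w)" neighbour_bound] card_neighbours N by auto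
    also have "\<dots> \<le> n * neighbour_bound" using N(2) by simp
    finally show ?thesis by (simp flip: of_nat_mult)
  qed
  have "emeasure m A = (\<integral>\<^sup>+x. indicator A x \<partial>m)" using A by simp
  also have "\<dots> = (\<Sum>w\<in>cells T. ennreal (\<theta>w w) * (\<integral>\<^sup>+x. indicator A (Fw w x) \<partial>m))"
    using A by (intro nn_integral_cells) auto
  also have "\<dots> = (\<Sum>w\<in>M. ennreal (\<theta>w w) * (\<integral>\<^sup>+x. indicator A (Fw w x) \<partial>m))"
  proof (intro sum.mono_neutral_right finite_cells M ballI)
    fix v assume v: "v \<in> cells T - M"
    have "Fw v x \<notin> A" for x
      using v by (force simp: A_def M_def neighbours_def)
    then show "ennreal (\<theta>w v) * (\<integral>\<^sup>+x. indicator A (Fw v x) \<partial>m) = 0" by simp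
  qed
  also have "\<dots> \<le> (\<Sum>w\<in>M. ennreal (T powr (- d / (p - 1))))"
  proof (rule sum_mono)
    fix w assume "w \<in> M"
    then have w: "w \<in> cells T" using M by blast
    have "(\<integral>\<^sup>+x. indicator A (Fw w x) \<partial>m) \<le> (\<integral>\<^sup>+x. 1 \<partial>m)" by (intro nn_integral_mono) (simp add: indicator_def)
    then have le1: "(\<integral>\<^sup>+x. indicator A (Fw w x) \<partial>m) \<le> 1" by (simp add: emeasure_UNIV)
    have "\<theta>w w \<le> T powr (- d / (p - 1))"
      unfolding \<theta>w_def using cells_weight_lower[OF w] T d_pos p_gt_1 by (intro powr_mono2') (auto simp: divide_nonpos_pos)
    then have "ennreal (\<theta>w w) \<le> ennreal (T powr (- d / (p - 1)))" by (rule ennreal_leI)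
    then show "ennreal (\<theta>w w) * (\<integral>\<^sup>+x. indicator A (Fw w x) \<partial>m) \<le> ennreal (T powr (- d / (p - 1)))"
      using mult_mono[OF _ le1] by (metis mult.right_neutral zero_le)
  qed
  also have "\<dots> = ennreal (real (card M) * T powr (- d / (p - 1)))"
    by (simp add: ennreal_mult ennreal_of_nat_eq_real_of_nat)
  also have "\<dots> \<le> ennreal (real n * real neighbour_bound * T powr (- d / (p - 1)))"
    using \<open>real (card M) \<le> _\<close> by (intro ennreal_leI mult_right_mono) auto
  finally show ?thesis unfolding A_def .
qed

lemma emeasure_ball_upper:
  assumes T: "1 \<le> T"
  shows "emeasure m {y. res x y < separation / T} \<le> ennreal ((real neighbour_bound)\<^sup>2 * T powr (- d / (p - 1)))"
proof -
  obtain w where w: "w \<in> cells T" "x \<in> range (Fw w)" using cells_cover by blast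
  have "{y. res x y < separation / T} \<subseteq> (\<Union>v\<in>neighbours T w. range (Fw v))"
    using close_points_neighbours[OF w T] by blast
  then have "emeasure m {y. res x y < separation / T} \<le> emeasure m (\<Union>v\<in>neighbours T w. range (Fw v))"
  proof (intro emeasure_mono)
    have "range (Fw v) \<in> sets m" if "v \<in> neighbours T w" for v
      using range_Fw_borel[OF cells_set, of v T] neighbours_sub[of T w] that by auto
    then show "(\<Union>v\<in>neighbours T w. range (Fw v)) \<in> sets m"
      using finite_neighbours by (intro sets.finite_UN) auto
  qed
  also have "\<dots> \<le> ennreal (real neighbour_bound * real neighbour_bound * T powr (- d / (p - 1)))"
    by (intro emeasure_cells_upper neighbours_sub card_neighbours w T)
  finally show ?thesis by (simp add: power2_eq_square)
qed

text \<open>The measure has full support because every non-empty open set contains a cell; so each class has at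
  most one representative in the domain.\<close>

lemma AE_equal_imp_equal:
  assumes uv: "u \<in> \<F>" "v \<in> \<F>" and ae: "AE x in m. u x = v x"
  shows "u = v"
proof (rule ccontr)
  assume "u \<noteq> v"
  then obtain x where x: "u x \<noteq> v x" by auto
  define V where "V = {y. u y \<noteq> v y}"
  have "open V" unfolding V_def using uv mem_cont by (intro open_Collect_neq)
  moreover have "x \<in> V" using x by (simp add: V_def)
  ultimately obtain T w where w: "w \<in> cells T" "range (Fw w) \<subseteq> V" using small_cell_subset by blast
  have V: "V \<in> sets borel" using \<open>open V\<close> by simp
  have "emeasure m V = 0" using ae V by (subst (asm) AE_iff_measurable[OF _ refl]) (auto simp: V_def)
  moreover have "ennreal (\<theta>w w) \<le> emeasure m V" by (rule emeasure_cell_lower[OF w(1) V w(2)])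
  ultimately show False using \<theta>w_pos[OF cells_set[OF w(1)]] by simp
qed

lemma extended_energy_eq:
  assumes u: "u \<in> \<F>" and ae: "AE x in m. f x = u x"
  shows "extended_energy m \<E> \<F> f = ennreal (\<E> u)"
proof -
  have "(SOME v. v \<in> \<F> \<and> (AE x in m. f x = v x)) = u"
  proof (rule some_equality)
    fix v assume v: "v \<in> \<F> \<and> (AE x in m. f x = v x)"
    then have "AE x in m. v x = u x" using ae by (auto elim: eventually_elim2)
    then show "v = u" using AE_equal_imp_equal u v by blast
  qed (use u ae in auto)
  then show ?thesis using u ae by (auto simp: extended_energy_def)
qed

section \<open>Lower semicontinuity of the energy\<close>

text \<open>The p-th power of the distance in \<open>L\<^sup>p\<close>; unlike the distance itself it is additive over cells.\<close>

definition lp_dist :: "('a \<Rightarrow> real) \<Rightarrow> ('a \<Rightarrow> real) \<Rightarrow> ennreal" where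
  "lp_dist f g = (\<integral>\<^sup>+x. ennreal (\<bar>f x - g x\<bar> powr p) \<partial>m)"

lemma lp_dist_commute: "lp_dist f g = lp_dist g f"
  by (simp add: lp_dist_def abs_minus_commute)

lemma lp_dist_triangle:
  assumes [measurable]: "f \<in> borel_measurable borel" "g \<in> borel_measurable borel" "h \<in> borel_measurable borel"
  shows "lp_dist f h \<le> ennreal (2 powr p) * (lp_dist f g + lp_dist g h)"
proof -
  have "lp_dist f h \<le> (\<integral>\<^sup>+x. ennreal (2 powr p) * (ennreal (\<bar>f x - g x\<bar> powr p) + ennreal (\<bar>g x - h x\<bar> powr p)) \<partial>m)"
    unfolding lp_dist_def
  proof (rule nn_integral_mono)
    fix x
    have "\<bar>f x - h x\<bar> powr p \<le> (\<bar>f x - g x\<bar> + \<bar>g x - h x\<bar>) powr p" using p_gt_1 by (intro powr_mono2) auto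
    also have "\<dots> \<le> 2 powr p * (\<bar>f x - g x\<bar> powr p + \<bar>g x - h x\<bar> powr p)" using p_gt_1 by (intro powr_add_le_two) auto
    finally show "ennreal (\<bar>f x - h x\<bar> powr p) \<le> ennreal (2 powr p) * (ennreal (\<bar>f x - g x\<bar> powr p) + ennreal (\<bar>g x - h x\<bar> powr p))"
      by (simp add: ennreal_mult[symmetric] ennreal_plus[symmetric] ennreal_leI del: ennreal_plus)
  qed
  also have "\<dots> = ennreal (2 powr p) * (lp_dist f g + lp_dist g h)"
    by (simp add: nn_integral_cmult nn_integral_add lp_dist_def)
  finally show ?thesis .
qed

lemma lp_dist_const: "lp_dist (\<lambda>x. f x + a) (\<lambda>x. f x + b) = ennreal (\<bar>a - b\<bar> powr p)"
  by (simp add: lp_dist_def emeasure_UNIV)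

lemma lp_dist_midpoint:
  assumes [measurable]: "f \<in> borel_measurable borel" "g \<in> borel_measurable borel" "h \<in> borel_measurable borel"
    and "lp_dist f h \<le> c" "lp_dist g h \<le> c"
  shows "lp_dist (\<lambda>x. (f x + g x) / 2) h \<le> c"
proof -
  have "lp_dist (\<lambda>x. (f x + g x) / 2) h \<le> (\<integral>\<^sup>+x. ennreal (1/2) * (ennreal (\<bar>f x - h x\<bar> powr p) + ennreal (\<bar>g x - h x\<bar> powr p)) \<partial>m)"
    unfolding lp_dist_def
  proof (rule nn_integral_mono)
    fix x
    have "\<bar>(f x + g x) / 2 - h x\<bar> = \<bar>(f x - h x) + (g x - h x)\<bar> / 2" by (simp add: field_simps)
    also have "\<dots> \<le> (1 - 1/2) * \<bar>f x - h x\<bar> + 1/2 * \<bar>g x - h x\<bar>"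
      using abs_triangle_ineq[of "f x - h x" "g x - h x"] by simp
    finally have "\<bar>(f x + g x) / 2 - h x\<bar> powr p \<le> ((1 - 1/2) * \<bar>f x - h x\<bar> + 1/2 * \<bar>g x - h x\<bar>) powr p"
      using p_gt_1 by (intro powr_mono2) auto
    also have "\<dots> \<le> (1 - 1/2) * \<bar>f x - h x\<bar> powr p + 1/2 * \<bar>g x - h x\<bar> powr p"
      using p_gt_1 by (intro powr_convex_nonneg) auto
    also have "\<dots> = 1/2 * (\<bar>f x - h x\<bar> powr p + \<bar>g x - h x\<bar> powr p)" by simp
    finally show "ennreal (\<bar>(f x + g x) / 2 - h x\<bar> powr p) \<le> ennreal (1/2) * (ennreal (\<bar>f x - h x\<bar> powr p) + ennreal (\<bar>g x - h x\<bar> powr p))"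
      by (subst ennreal_plus[symmetric], simp, simp, subst ennreal_mult[symmetric], simp, simp) (rule ennreal_leI)
  qed
  also have "\<dots> = ennreal (1/2) * (lp_dist f h + lp_dist g h)"
    by (simp add: nn_integral_cmult nn_integral_add lp_dist_def)
  also have "\<dots> \<le> ennreal (1/2) * (c + c)" using assms by (intro mult_left_mono add_mono) auto
  also have "\<dots> = ennreal (1/2 * 2) * c"
    by (subst ennreal_mult) (auto simp: mult_2[symmetric] mult.assoc)
  also have "\<dots> = c" by simp
  finally show ?thesis .
qed

lemma tendsto_ennreal_cmult_zero:
  "(X \<longlongrightarrow> 0) G \<Longrightarrow> ((\<lambda>n. ennreal c * X n) \<longlongrightarrow> 0) G"
  using ennreal_tendsto_cmult[of "ennreal c" X 0 G] by simp

text \<open>Convergence of the energy seminorm forces uniform convergence up to constants; the constants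
  converge because the sequence converges in the p-th mean.\<close>

lemma limit_up_to_constant:
  assumes g: "\<And>n. g n \<in> \<F>" and v: "v \<in> \<F>"
    and conv: "(\<lambda>n. seminorm (\<lambda>x. g n x - v x)) \<longlonglongrightarrow> 0"
    and f: "f \<in> borel_measurable borel" and dist: "(\<lambda>n. lp_dist (g n) f) \<longlonglongrightarrow> 0"
  shows "\<exists>c. AE x in m. f x = v x + c"
proof -
  note [measurable] = f mem_measurable[OF v] mem_measurable[OF g]
  define z :: 'a where "z = undefined"
  define c where "c = (\<lambda>n. g n z - v z)"
  define e where "e = (\<lambda>n. res_bound * seminorm (\<lambda>x. g n x - v x) powr p)"
  have e_lim: "(\<lambda>n. ennreal (e n)) \<longlonglongrightarrow> 0"
  proof -
    have "(\<lambda>n. seminorm (\<lambda>x. g n x - v x) powr p) \<longlonglongrightarrow> 0 powr p"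
      using p_gt_1 conv by (intro tendsto_powr') (auto simp: seminorm_nonneg)
    then have "e \<longlonglongrightarrow> res_bound * 0 powr p" unfolding e_def by (intro tendsto_mult_left)
    then show ?thesis using tendsto_ennrealI[of e 0] by simp
  qed
  have unif: "\<bar>g n x - (v x + c n)\<bar> powr p \<le> e n" for n x
  proof -
    have gv: "(\<lambda>x. g n x - v x) \<in> \<F>" by (intro diff_mem g v)
    have "\<bar>(g n x - v x) - (g n z - v z)\<bar> powr p \<le> res x z * \<E> (\<lambda>x. g n x - v x)"
      using diff_powr_le_res[OF gv, of x z] .
    also have "\<dots> \<le> res_bound * \<E> (\<lambda>x. g n x - v x)"
      using res_bound energy_nonneg[OF gv] by (intro mult_right_mono) auto
    finally show ?thesis by (simp add: c_def e_def energy_eq_seminorm[OF gv] algebra_simps)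
  qed
  have near: "lp_dist (g n) (\<lambda>x. v x + c n) \<le> ennreal (e n)" for n
  proof -
    have "lp_dist (g n) (\<lambda>x. v x + c n) \<le> (\<integral>\<^sup>+x. ennreal (e n) \<partial>m)"
      unfolding lp_dist_def using unif by (intro nn_integral_mono ennreal_leI)
    then show ?thesis by (simp add: emeasure_UNIV)
  qed
  define \<delta> where "\<delta> = (\<lambda>n. ennreal (2 powr p) * (lp_dist (g n) f + ennreal (e n)))"
  have \<delta>_lim: "\<delta> \<longlonglongrightarrow> 0"
    unfolding \<delta>_def using tendsto_add[OF dist e_lim] by (intro tendsto_ennreal_cmult_zero) simp
  have fv: "lp_dist f (\<lambda>x. v x + c n) \<le> \<delta> n" for n
  proof -
    have "lp_dist f (\<lambda>x. v x + c n) \<le> ennreal (2 powr p) * (lp_dist f (g n) + lp_dist (g n) (\<lambda>x. v x + c n))"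
      by (rule lp_dist_triangle) measurable
    also have "\<dots> \<le> \<delta> n" unfolding \<delta>_def lp_dist_commute[of f] by (intro mult_left_mono add_mono near) auto
    finally show ?thesis .
  qed
  have "Cauchy c"
  proof (rule metric_CauchyI)
    fix \<epsilon> :: real assume \<epsilon>: "\<epsilon> > 0"
    have "(\<lambda>n. ennreal (2 powr p) * \<delta> n) \<longlonglongrightarrow> 0" by (rule tendsto_ennreal_cmult_zero[OF \<delta>_lim])
    then have "\<forall>\<^sub>F n in sequentially. ennreal (2 powr p) * \<delta> n < ennreal (\<epsilon> powr p / 2)"
      using \<epsilon> by (intro order_tendstoD) auto
    then obtain N where N: "\<And>n. n \<ge> N \<Longrightarrow> ennreal (2 powr p) * \<delta> n < ennreal (\<epsilon> powr p / 2)"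
      by (auto simp: eventually_sequentially)
    show "\<exists>M. \<forall>k\<ge>M. \<forall>n\<ge>M. dist (c k) (c n) < \<epsilon>"
    proof (intro exI allI impI)
      fix k n assume kn: "k \<ge> N" "n \<ge> N"
      have "ennreal (\<bar>c k - c n\<bar> powr p) = lp_dist (\<lambda>x. v x + c k) (\<lambda>x. v x + c n)" by (simp add: lp_dist_const)
      also have "\<dots> \<le> ennreal (2 powr p) * (lp_dist (\<lambda>x. v x + c k) f + lp_dist f (\<lambda>x. v x + c n))"
        by (rule lp_dist_triangle) measurable
      also have "\<dots> \<le> ennreal (2 powr p) * (\<delta> k + \<delta> n)"
        unfolding lp_dist_commute[of "\<lambda>x. v x + c k"] by (intro mult_left_mono add_mono fv) auto
      also have "\<dots> = ennreal (2 powr p) * \<delta> k + ennreal (2 powr p) * \<delta> n" by (simp add: distrib_left)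
      also have "\<dots> < ennreal (\<epsilon> powr p / 2) + ennreal (\<epsilon> powr p / 2)"
        using N[OF kn(1)] N[OF kn(2)] by (rule add_strict_mono)
      also have "\<dots> = ennreal (\<epsilon> powr p)" by (simp flip: ennreal_plus)
      finally have "\<bar>c k - c n\<bar> powr p < \<epsilon> powr p" by (simp add: ennreal_less_iff)
      then have "\<bar>c k - c n\<bar> < \<epsilon>"
        using powr_mono2[of p \<epsilon> "\<bar>c k - c n\<bar>"] p_gt_1 \<epsilon> by (meson leI less_imp_le less_le_not_le less_trans zero_less_one)
      then show "dist (c k) (c n) < \<epsilon>" by (simp add: dist_real_def)
    qed
  qed
  then obtain l where l: "c \<longlonglongrightarrow> l" using real_Cauchy_convergent convergent_def by blast
  have "lp_dist f (\<lambda>x. v x + l) \<le> ennreal (2 powr p) * (\<delta> n + ennreal (\<bar>c n - l\<bar> powr p))" for n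
  proof -
    have "lp_dist f (\<lambda>x. v x + l) \<le> ennreal (2 powr p) * (lp_dist f (\<lambda>x. v x + c n) + lp_dist (\<lambda>x. v x + c n) (\<lambda>x. v x + l))"
      by (rule lp_dist_triangle) measurable
    also have "\<dots> \<le> ennreal (2 powr p) * (\<delta> n + ennreal (\<bar>c n - l\<bar> powr p))"
      unfolding lp_dist_const by (intro mult_left_mono add_mono fv) auto
    finally show ?thesis .
  qed
  moreover have "(\<lambda>n. ennreal (2 powr p) * (\<delta> n + ennreal (\<bar>c n - l\<bar> powr p))) \<longlonglongrightarrow> 0"
  proof (rule tendsto_ennreal_cmult_zero)
    have "(\<lambda>n. \<bar>c n - l\<bar> powr p) \<longlonglongrightarrow> 0 powr p"
      using l p_gt_1 by (intro tendsto_powr' tendsto_rabs_zero) (auto intro: LIM_zero)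
    then have "(\<lambda>n. ennreal (\<bar>c n - l\<bar> powr p)) \<longlonglongrightarrow> 0" using tendsto_ennrealI by fastforce
    from tendsto_add[OF \<delta>_lim this] show "(\<lambda>n. \<delta> n + ennreal (\<bar>c n - l\<bar> powr p)) \<longlonglongrightarrow> 0" by simp
  qed
  ultimately have "lp_dist f (\<lambda>x. v x + l) \<le> 0" by (intro LIMSEQ_le_const) auto
  then have "AE x in m. ennreal (\<bar>f x - (v x + l)\<bar> powr p) = 0"
    unfolding lp_dist_def by (subst (asm) le_zero_eq, subst (asm) nn_integral_0_iff_AE) auto
  then have "AE x in m. f x = v x + l" by eventually_elim auto
  then show ?thesis by blast
qed

text \<open>For \<open>r\<close> above the lower limit, elements of the domain with energy at most \<open>r\<close> lie in every \<open>L\<^sup>p\<close> ball around \<open>f\<close>. Almost minimal ones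
  converge in energy to some \<open>v\<close> of energy at most \<open>r\<close> and in \<open>L\<^sup>p\<close> to \<open>f\<close>, whence \<open>f\<close> and \<open>v\<close> differ by a constant.\<close>

lemma energy_lower_semicontinuous:
  assumes g: "\<And>n. g n \<in> \<F>" and f: "f \<in> borel_measurable borel"
    and dist: "(\<lambda>n. lp_dist (g n) f) \<longlonglongrightarrow> 0"
  shows "extended_energy m \<E> \<F> f \<le> liminf (\<lambda>n. ennreal (\<E> (g n)))"
proof (rule dense_ge)
  fix M assume M: "liminf (\<lambda>n. ennreal (\<E> (g n))) < M"
  show "extended_energy m \<E> \<F> f \<le> M"
  proof (cases M)
    case (real r)
    define C where "C = (\<lambda>k::nat. {h \<in> \<F>. lp_dist h f \<le> ennreal (1 / real (Suc k))})"
    have "\<exists>h. \<exists>v\<in>\<F>. (\<forall>k. h k \<in> C k) \<and> (\<lambda>k. seminorm (\<lambda>x. h k x - v x)) \<longlonglongrightarrow> 0 \<and> \<E> v \<le> r"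
    proof (rule nested_convex_minimizers)
      show "C n \<subseteq> \<F>" for n by (auto simp: C_def)
      fix n k :: nat assume "n \<le> k"
      then have "ennreal (1 / real (Suc k)) \<le> ennreal (1 / real (Suc n))" by (intro ennreal_leI) (simp add: field_simps)
      then show "C k \<subseteq> C n" unfolding C_def by (auto intro: order_trans simp del: of_nat_Suc)
    next
      fix n h h' assume "h \<in> C n" "h' \<in> C n"
      then show "(\<lambda>x. (h x + h' x) / 2) \<in> C n"
        using lp_dist_midpoint[of h h' f] mem_measurable f scale_mem[OF add_mem, of h h' "1/2"] by (simp add: C_def)
    next
      fix n :: nat
      have "\<forall>\<^sub>F k in sequentially. lp_dist (g k) f < ennreal (1 / real (Suc n))"
        using dist by (intro order_tendstoD) auto
      then obtain N where N: "\<And>k. k \<ge> N \<Longrightarrow> lp_dist (g k) f < ennreal (1 / real (Suc n))"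
        by (auto simp: eventually_sequentially)
      have "\<exists>k\<ge>N. ennreal (\<E> (g k)) < M"
      proof (rule ccontr)
        assume "\<not> ?thesis"
        then have "\<forall>\<^sub>F k in sequentially. M \<le> ennreal (\<E> (g k))"
          by (auto simp: eventually_sequentially not_less intro!: exI[of _ N])
        then have "M \<le> liminf (\<lambda>n. ennreal (\<E> (g n)))" by (rule Liminf_bounded)
        then show False using M by simp
      qed
      then obtain k where k: "k \<ge> N" "ennreal (\<E> (g k)) < M" by blast
      then have "\<E> (g k) \<le> r" using real by (simp add: ennreal_less_iff energy_nonneg g)
      then show "\<exists>h\<in>C n. \<E> h \<le> r" 
        using g less_imp_le[OF N[OF k(1)]] by (intro bexI[of _ "g k"]) (simp_all add: C_def)
    qed
    then obtain h v where h: "\<And>k. h k \<in> C k" "v \<in> \<F>" "(\<lambda>k. seminorm (\<lambda>x. h k x - v x)) \<longlonglongrightarrow> 0" "\<E> v \<le> r" by blast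
    have "(\<lambda>k. lp_dist (h k) f) \<longlonglongrightarrow> 0"
    proof (rule tendsto_sandwich[OF _ _ tendsto_const])
      show "(\<lambda>k. ennreal (1 / real (Suc k))) \<longlonglongrightarrow> 0"
        using tendsto_ennrealI[OF LIMSEQ_Suc[OF lim_1_over_n]] by simp
    qed (use h(1) in \<open>auto simp: C_def\<close>)
    then obtain c where c: "AE x in m. f x = v x + c"
      using limit_up_to_constant[OF _ h(2,3) f] h(1) by (auto simp: C_def)
    have "extended_energy m \<E> \<F> f = ennreal (\<E> (\<lambda>x. v x + c))"
      using c h(2) by (intro extended_energy_eq add_mem const_mem)
    also have "\<dots> \<le> M" using h real by (simp add: energy_add_const ennreal_leI)
    finally show ?thesis .
  qed simp
qed

end

section \<open>Energy measures of small cells\<close>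

context self_similar_form
begin

lemma energy_form_step:
  assumes u: "u \<in> \<F>" and v: "v \<in> \<F>"
  shows "energy_form p \<E> u v = (\<Sum>i\<in>S. \<rho> i * energy_form p \<E> (u \<circ> F i) (v \<circ> F i))"
proof -
  have split: "\<E> (\<lambda>x. u x + t * v x) = (\<Sum>i\<in>S. \<rho> i * \<E> (\<lambda>x. (u \<circ> F i) x + t * (v \<circ> F i) x))" for t
    using energy_step[OF add_mem[OF u scale_mem[OF v]], of t] by (simp add: o_def)
  have deriv: "((\<lambda>t. \<E> (\<lambda>x. (u \<circ> F i) x + t * (v \<circ> F i) x)) has_real_derivative
      deriv (\<lambda>t. \<E> (\<lambda>x. (u \<circ> F i) x + t * (v \<circ> F i) x)) 0) (at 0)" if "i \<in> S" for i
    using energy_differentiable[OF mem_step[OF u that] mem_step[OF v that]]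
    by (simp add: DERIV_deriv_iff_real_differentiable)
  have "((\<lambda>t. \<E> (\<lambda>x. u x + t * v x)) has_real_derivative
      (\<Sum>i\<in>S. \<rho> i * deriv (\<lambda>t. \<E> (\<lambda>x. (u \<circ> F i) x + t * (v \<circ> F i) x)) 0)) (at 0)"
    unfolding split by (intro DERIV_sum DERIV_cmult deriv)
  then show ?thesis
    by (simp add: energy_form_def DERIV_imp_deriv sum_distrib_left mult.left_commute)
qed

end

locale energy_measure_form = self_similar_form p \<E> \<F> S F \<rho> \<pi>
  for p :: real and \<E> :: "('a::polish_space \<Rightarrow> real) \<Rightarrow> real" and \<F>
    and S :: "'i set" and F :: "'i \<Rightarrow> 'a \<Rightarrow> 'a" and \<rho> :: "'i \<Rightarrow> real" and \<pi> :: "(nat \<Rightarrow> 'i) \<Rightarrow> 'a" +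
  fixes \<Gamma> :: "('a \<Rightarrow> real) \<Rightarrow> 'a measure"
  assumes energy_measure: "\<And>u. u \<in> \<F> \<Longrightarrow> is_energy_measure p \<E> \<F> u (\<Gamma> u)"
begin

lemma \<Gamma>_radon:
  assumes "u \<in> \<F>"
  shows "sets (\<Gamma> u) = sets borel" "space (\<Gamma> u) = UNIV" "finite_measure (\<Gamma> u)"
proof -
  have "radon_measure_on UNIV (\<Gamma> u)" using energy_measure[OF assms] by (simp add: is_energy_measure_def)
  then show "sets (\<Gamma> u) = sets borel" "space (\<Gamma> u) = UNIV" "finite_measure (\<Gamma> u)"
    using compact_UNIV by (auto simp: radon_measure_on_def sets_restrict_space intro!: finite_measureI)
qed

lemma \<Gamma>_integrable:
  assumes u: "u \<in> \<F>" and \<phi>: "\<phi> \<in> \<F>"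
  shows "integrable (\<Gamma> u) \<phi>"
proof -
  obtain M where "\<And>x. \<bar>\<phi> x\<bar> \<le> M" using mem_bounded[OF \<phi>] by blast
  then show ?thesis
    using \<Gamma>_radon[OF u] borel_measurable_continuous_onI[OF mem_cont[OF \<phi>]]
    by (intro finite_measure.integrable_const_bound[of _ _ M]) (auto cong: measurable_cong_sets)
qed

lemma \<Gamma>_integral:
  assumes "u \<in> \<F>" "\<phi> \<in> \<F>"
  shows "(\<integral>x. \<phi> x \<partial>\<Gamma> u) = energy_form p \<E> u (\<lambda>x. u x * \<phi> x)
        - ((p - 1) / p) powr (p - 1) * energy_form p \<E> (\<lambda>x. \<bar>u x\<bar> powr (p / (p - 1))) \<phi>"
  using energy_measure[OF assms(1)] assms(2) by (simp add: is_energy_measure_def)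

lemma power_mem: "u \<in> \<F> \<Longrightarrow> (\<lambda>x. \<bar>u x\<bar> powr (p / (p - 1))) \<in> \<F>"
proof -
  assume u: "u \<in> \<F>"
  then obtain M where "\<And>x. \<bar>u x\<bar> \<le> M" using mem_bounded by blast
  then show ?thesis using u p_gt_1 by (intro abs_powr_mem[of u M]) (auto simp: field_simps)
qed

text \<open>Self-similarity of the energy measures, tested against functions in the domain. It rests on
  differentiability of the energy, without which derivatives would not commute with the finite sum.\<close>

lemma \<Gamma>_step:
  assumes u: "u \<in> \<F>" and \<phi>: "\<phi> \<in> \<F>"
  shows "(\<integral>x. \<phi> x \<partial>\<Gamma> u) = (\<Sum>i\<in>S. \<rho> i * (\<integral>x. (\<phi> \<circ> F i) x \<partial>\<Gamma> (u \<circ> F i)))"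
proof -
  define k where "k = ((p - 1) / p) powr (p - 1)"
  have "(\<integral>x. \<phi> x \<partial>\<Gamma> u) = (\<Sum>i\<in>S. \<rho> i * energy_form p \<E> (u \<circ> F i) ((\<lambda>x. u x * \<phi> x) \<circ> F i))
     - k * (\<Sum>i\<in>S. \<rho> i * energy_form p \<E> ((\<lambda>x. \<bar>u x\<bar> powr (p / (p - 1))) \<circ> F i) (\<phi> \<circ> F i))"
    unfolding \<Gamma>_integral[OF u \<phi>] energy_form_step[OF u mult_closed[OF u \<phi>]] energy_form_step[OF power_mem[OF u] \<phi>] k_def ..
  also have "\<dots> = (\<Sum>i\<in>S. \<rho> i * (energy_form p \<E> (u \<circ> F i) ((\<lambda>x. u x * \<phi> x) \<circ> F i)
     - k * energy_form p \<E> ((\<lambda>x. \<bar>u x\<bar> powr (p / (p - 1))) \<circ> F i) (\<phi> \<circ> F i)))"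
    by (simp add: sum_subtractf[symmetric] sum_distrib_left right_diff_distrib mult.left_commute)
  also have "\<dots> = (\<Sum>i\<in>S. \<rho> i * (\<integral>x. (\<phi> \<circ> F i) x \<partial>\<Gamma> (u \<circ> F i)))"
    using \<Gamma>_integral[OF mem_step[OF u] mem_step[OF \<phi>]] by (intro sum.cong refl) (simp add: o_def k_def)
  finally show ?thesis .
qed

lemma \<Gamma>_cells:
  assumes "u \<in> \<F>" "\<phi> \<in> \<F>"
  shows "(\<integral>x. \<phi> x \<partial>\<Gamma> u) = (\<Sum>w\<in>cells T. \<rho>w w * (\<integral>x. (\<phi> \<circ> Fw w) x \<partial>\<Gamma> (u \<circ> Fw w)))"
proof -
  define G where "G = (\<lambda>w. \<rho>w w * (\<integral>x. (\<phi> \<circ> Fw w) x \<partial>\<Gamma> (u \<circ> Fw w)))"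
  have "G v = (\<Sum>i\<in>S. G (v @ [i]))" if "set v \<subseteq> S" for v
    using \<Gamma>_step[OF word_mem[OF assms(1) that] word_mem[OF assms(2) that]]
    by (simp add: G_def word_map_append word_weight_append comp_assoc sum_distrib_left mult.assoc)
  from additive_cells_sum[of G "[]" T, OF this] show ?thesis by (simp add: G_def)
qed

lemma \<Gamma>_total: "u \<in> \<F> \<Longrightarrow> (\<integral>x. 1 \<partial>\<Gamma> u) = \<E> u"
  using \<Gamma>_integral[OF _ const_mem, of u 1] power_mem[of u]
  by (simp add: energy_form_self energy_form_const)

text \<open>Test the self-similarity of the energy measure with the truncated cutoff of the cells that meet \<open>E\<close>. On
  each cell where it does not vanish it is at most 1, so that cell contributes at most the total
  mass of its own energy measure.\<close>

lemma \<Gamma>_le_energy: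
  assumes u: "u \<in> \<F>" and E: "E \<in> sets borel"
    and N: "N = (\<Union>w\<in>{w \<in> cells T. range (Fw w) \<inter> E \<noteq> {}}. neighbours T w)"
  shows "emeasure (\<Gamma> u) E \<le> ennreal (\<Sum>v\<in>N. \<rho>w v * \<E> (u \<circ> Fw v))"
proof -
  define A where "A = {w \<in> cells T. range (Fw w) \<inter> E \<noteq> {}}"
  have AT: "A \<subseteq> cells T" by (auto simp: A_def)
  have NA: "N = (\<Union>w\<in>A. neighbours T w)" by (simp add: N A_def)
  have NT: "N \<subseteq> cells T" using neighbours_sub by (auto simp: N)
  obtain \<psi> where \<psi>: "\<psi> \<in> \<F>" "\<And>w x. w \<in> A \<Longrightarrow> x \<in> range (Fw w) \<Longrightarrow> \<psi> x = 1"
    "\<And>v x. v \<in> cells T - N \<Longrightarrow> x \<in> range (Fw v) \<Longrightarrow> \<psi> x = 0"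
    using cutoff[OF AT] unfolding NA[symmetric] by blast
  define \<phi> where "\<phi> = (\<lambda>x. max 0 (min 1 (\<psi> x)))"
  obtain M where "\<And>x. \<bar>\<psi> x\<bar> \<le> M" using mem_bounded[OF \<psi>(1)] by blast
  then have \<phi>: "\<phi> \<in> \<F>" unfolding \<phi>_def using \<psi>(1) by (intro truncate_mem)
  have bounds: "0 \<le> \<phi> x" "\<phi> x \<le> 1" for x by (auto simp: \<phi>_def)
  have one: "\<phi> x = 1" if xE: "x \<in> E" for x
  proof -
    obtain w where w: "w \<in> cells T" "x \<in> range (Fw w)" using cells_cover by blast
    then have "w \<in> A" using xE by (auto simp: A_def)
    then show ?thesis using \<psi>(2) w by (simp add: \<phi>_def)
  qed
  have "emeasure (\<Gamma> u) E = (\<integral>\<^sup>+x. indicator E x \<partial>\<Gamma> u)" using E \<Gamma>_radon[OF u] by simp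
  also have "\<dots> \<le> (\<integral>\<^sup>+x. ennreal (\<phi> x) \<partial>\<Gamma> u)"
    using one by (intro nn_integral_mono) (auto simp: indicator_def)
  also have "\<dots> = ennreal (\<integral>x. \<phi> x \<partial>\<Gamma> u)"
    using \<Gamma>_integrable[OF u \<phi>] bounds by (intro nn_integral_eq_integral) auto
  also have "(\<integral>x. \<phi> x \<partial>\<Gamma> u) \<le> (\<Sum>v\<in>N. \<rho>w v * \<E> (u \<circ> Fw v))"
  proof -
    have "(\<integral>x. \<phi> x \<partial>\<Gamma> u) = (\<Sum>w\<in>cells T. \<rho>w w * (\<integral>x. (\<phi> \<circ> Fw w) x \<partial>\<Gamma> (u \<circ> Fw w)))" by (rule \<Gamma>_cells[OF u \<phi>])
    also have "\<dots> = (\<Sum>w\<in>N. \<rho>w w * (\<integral>x. (\<phi> \<circ> Fw w) x \<partial>\<Gamma> (u \<circ> Fw w)))"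
    proof (intro sum.mono_neutral_right finite_cells NT ballI)
      fix v assume v: "v \<in> cells T - N"
      have "\<psi> (Fw v x) = 0" for x using \<psi>(3)[OF v] by blast
      then show "\<rho>w v * (\<integral>x. (\<phi> \<circ> Fw v) x \<partial>\<Gamma> (u \<circ> Fw v)) = 0" by (simp add: \<phi>_def)
    qed
    also have "\<dots> \<le> (\<Sum>v\<in>N. \<rho>w v * \<E> (u \<circ> Fw v))"
    proof (intro sum_mono mult_left_mono)
      fix v assume "v \<in> N"
      then have v: "set v \<subseteq> S" using NT cells_set by blast
      note uv = word_mem[OF u v]
      have "(\<integral>x. (\<phi> \<circ> Fw v) x \<partial>\<Gamma> (u \<circ> Fw v)) \<le> (\<integral>x. 1 \<partial>\<Gamma> (u \<circ> Fw v))"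
        using bounds by (intro integral_mono \<Gamma>_integrable uv word_mem \<phi> v const_mem) auto
      then show "(\<integral>x. (\<phi> \<circ> Fw v) x \<partial>\<Gamma> (u \<circ> Fw v)) \<le> \<E> (u \<circ> Fw v)" using \<Gamma>_total[OF uv] by simp
      show "0 \<le> \<rho>w v" using \<rho>w_pos[OF v] by simp
    qed
    finally show ?thesis .
  qed
  finally show ?thesis by (simp add: ennreal_leI)
qed

end

section \<open>Comparison of the energy with the Korevaar-Schoen functional\<close>

lemma inverse_antimono_ennreal: "a \<le> b \<Longrightarrow> inverse b \<le> inverse (a :: ennreal)"
proof (cases "a = 0 \<or> b = top")
  case False
  assume "a \<le> b"
  with False obtain r t where "a = ennreal r" "b = ennreal t" "0 < r" "r \<le> t"
    by (cases a; cases b) (auto simp: top_unique)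
  then show ?thesis by (simp add: inverse_ennreal ennreal_leI le_imp_inverse_le)
qed auto

context self_similar_measure_form
begin

text \<open>At \<open>level s\<close> any two points of adjacent cells are at resistance at most half of \<open>s powr (p - 1)\<close>, the
  bound that defines balls of radius \<open>s\<close>.\<close>

definition scale_const :: real where
  "scale_const = 2 powr p * (2 * res_bound) * 2"

definition level :: "real \<Rightarrow> real" where
  "level s = scale_const / s powr (p - 1)"

definition ball_const :: real where
  "ball_const = (real neighbour_bound)\<^sup>2 * separation powr (- d / (p - 1))"

definition cell_const :: real where
  "cell_const = (scale_const * \<rho>max) powr (- d / (p - 1))"

lemma scale_const_pos: "0 < scale_const"
  using res_bound(1) by (simp add: scale_const_def)

lemma level_pos: "0 < s \<Longrightarrow> 0 < level s"
  using scale_const_pos by (simp add: level_def)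

lemma ball_const_pos: "0 < ball_const"
proof -
  have "0 < neighbour_bound" by (simp add: neighbour_bound_def)
  then have "0 < real neighbour_bound" by simp
  then show ?thesis using separation_pos by (simp add: ball_const_def)
qed

lemma cell_const_pos: "0 < cell_const"
  using scale_const_pos \<rho>max(2) by (simp add: cell_const_def)

lemma res_neighbours:
  assumes "w \<in> cells T" "w' \<in> neighbours T w" "0 < T" "x \<in> range (Fw w)" "y \<in> range (Fw w')"
  shows "res x y \<le> 2 powr p * (2 * (res_bound / T))"
proof -
  obtain z where z: "z \<in> range (Fw w)" "z \<in> range (Fw w')" using assms by (auto simp: neighbours_def)
  have "w' \<in> cells T" using assms neighbours_sub by blast
  then show ?thesis
    using res_cells[OF assms(1,3,4) z(1)] res_cells[OF _ assms(3) z(2) assms(5)] by (intro res_triangle_bound) auto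
qed

lemma neighbours_in_ball:
  assumes "0 < s" "w \<in> cells (level s)" "w' \<in> neighbours (level s) w" "x \<in> range (Fw w)" "y \<in> range (Fw w')"
  shows "y \<in> resistance_ball p \<E> \<F> x s"
proof -
  have "res x y \<le> 2 powr p * (2 * (res_bound / level s))"
    using res_neighbours assms level_pos by blast
  also have "\<dots> = s powr (p - 1) / 2"
    using res_bound(1) by (simp add: level_def scale_const_def)
  also have "\<dots> < s powr (p - 1)" using assms by simp
  finally show ?thesis using resistance_metric_less_iff[OF assms(1)] by (simp add: resistance_ball_def)
qed

lemma ball_measure_upper:
  assumes s: "0 < s" "s powr (p - 1) \<le> separation"
  shows "emeasure m (resistance_ball p \<E> \<F> x s) \<le> ennreal (ball_const * s powr d)"
proof -
  define T where "T = separation / s powr (p - 1)"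
  have T: "1 \<le> T" "separation / T = s powr (p - 1)" using s separation_pos by (auto simp: T_def)
  have "T powr (- d / (p - 1)) = separation powr (- d / (p - 1)) / s powr (- d)"
    using separation_pos s p_gt_1 by (simp add: T_def powr_divide powr_powr)
  also have "\<dots> = separation powr (- d / (p - 1)) * s powr d"
    by (simp add: powr_minus_divide)
  finally show ?thesis
    using emeasure_ball_upper[OF T(1), of x] resistance_metric_less_iff[OF s(1)]
    by (simp add: resistance_ball_def T(2) ball_const_def mult.assoc)
qed

text \<open>The weight of a word of the partition exceeds its level at most by the factor \<open>\<rho>max\<close>.\<close>

lemma cell_measure_lower:
  assumes s: "0 < s" "s powr (p - 1) \<le> scale_const" and w: "w \<in> cells (level s)"
  shows "cell_const * s powr d \<le> \<theta>w w"
proof -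
  have "1 \<le> level s" using s by (simp add: level_def)
  then have "1 * 1 \<le> level s * \<rho>max" using \<rho>max(2) by (intro mult_mono) auto
  then have "\<rho>w w \<le> level s * \<rho>max" using cells_weight_upper[OF w] by simp
  then have "(level s * \<rho>max) powr (- d / (p - 1)) \<le> \<theta>w w"
    unfolding \<theta>w_def using \<rho>w_pos[OF cells_set[OF w]] d_pos p_gt_1
    by (intro powr_mono2') (auto simp: divide_nonpos_pos)
  moreover have "(level s * \<rho>max) powr (- d / (p - 1)) = cell_const / s powr (- d)"
  proof -
    have "level s * \<rho>max = (scale_const * \<rho>max) / s powr (p - 1)" by (simp add: level_def)
    then show ?thesis using scale_const_pos \<rho>max(2) s p_gt_1
      by (simp add: powr_divide powr_powr cell_const_def)
  qed
  moreover have "cell_const / s powr (- d) = cell_const * s powr d" by (simp add: powr_minus_divide)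
  ultimately show ?thesis by simp
qed

definition cell_difference :: "('a \<Rightarrow> real) \<Rightarrow> 'i list \<Rightarrow> 'i list \<Rightarrow> ennreal" where
  "cell_difference f w w' = (\<integral>\<^sup>+x. \<integral>\<^sup>+y. ennreal (\<bar>f (Fw w x) - f (Fw w' y)\<bar> powr p) \<partial>m \<partial>m)"

lemma comp_Fw_measurable:
  "f \<in> borel_measurable borel \<Longrightarrow> set w \<subseteq> S \<Longrightarrow> (\<lambda>x. f (Fw w x)) \<in> borel_measurable borel"
  by (intro measurable_compose[OF Fw_measurable])

lemma sigma_finite_m: "sigma_finite_measure m"
  using finite_m by (simp add: finite_measure_def)

text \<open>Restrict the double integral to pairs of adjacent cells, all of which lie in the balls of radius \<open>s\<close>. The
  denominators are at most of order \<open>s powr d\<close> and each of the two cells has mass at least of that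
  order, so that the powers \<open>s powr d\<close> cancel and \<open>s powr (p - 1)\<close> remains.\<close>

lemma cell_differences_le_ks:
  assumes s: "0 < s" "s powr (p - 1) \<le> scale_const" "s powr (p - 1) \<le> separation"
    and f: "f \<in> borel_measurable borel"
    and B: "B \<subseteq> cells (level s)" "\<And>w. w \<in> B \<Longrightarrow> range (Fw w) \<subseteq> U"
    and uf: "\<And>w w' x. w \<in> B \<Longrightarrow> w' \<in> neighbours (level s) w \<Longrightarrow> x \<in> range (Fw w') \<Longrightarrow> u x = f x"
  shows "(\<Sum>w\<in>B. \<Sum>w'\<in>neighbours (level s) w. cell_difference f w w')
    \<le> ennreal (ball_const / cell_const\<^sup>2 * s powr (p - 1)) * ks_functional p \<E> \<F> d m U u s"
proof -
  define T where "T = level s"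
  note [measurable] = f
  have fB: "finite B" using B(1) finite_cells finite_subset by blast
  \<comment> \<open>a measurable stand-in for the region of integration, which need not be measurable itself\<close>
  define Q where "Q = (\<Union>w\<in>B. \<Union>w'\<in>neighbours T w. range (Fw w) \<times> range (Fw w'))"
  define q where "q = (\<lambda>x y. ennreal (\<bar>f x - f y\<bar> powr p) * indicator Q (x, y))"
  have Q: "Q \<in> sets (borel \<Otimes>\<^sub>M borel)"
    unfolding Q_def
  proof (intro sets.finite_UN fB finite_neighbours pair_measureI)
    fix w w' assume "w \<in> B" "w' \<in> neighbours T w"
    then have "w \<in> cells T" "w' \<in> cells T" using B(1) neighbours_sub by (auto simp: T_def)
    then have "set w \<subseteq> S" "set w' \<subseteq> S" using cells_set by blast+
    then show "range (Fw w) \<in> sets borel" "range (Fw w') \<in> sets borel" by (auto intro: range_Fw_borel)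
  qed
  then have q: "case_prod q \<in> borel_measurable (borel \<Otimes>\<^sub>M borel)"
    unfolding q_def by measurable
  have qy: "q x \<in> borel_measurable borel" for x
    using measurable_compose[OF measurable_Pair1' q, of x] by simp
  define H where "H = (\<lambda>x. \<integral>\<^sup>+y. q x y \<partial>m)"
  have H: "H \<in> borel_measurable borel"
    unfolding H_def
  proof (rule sigma_finite_measure.borel_measurable_nn_integral[OF sigma_finite_m])
    show "case_prod q \<in> borel_measurable (borel \<Otimes>\<^sub>M m)"
      using q measurable_cong_sets[OF sets_pair_measure_cong[OF refl sets_m] refl] by blast
  qed
  define K where "K = 1 / (ball_const * s powr d) * (1 / s powr (d + p - 1))"
  have K: "0 < K" using ball_const_pos s by (simp add: K_def)
  have le: "ennreal K * H x \<le> 1 / emeasure m (resistance_ball p \<E> \<F> x s) *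
        (\<integral>\<^sup>+y\<in>resistance_ball p \<E> \<F> x s. ennreal (\<bar>u x - u y\<bar> powr p / s powr (d + p - 1)) \<partial>m) * indicator U x" for x
  proof (cases "\<exists>w\<in>B. x \<in> range (Fw w)")
    case False
    then have "q x = (\<lambda>_. 0)" by (auto simp: q_def Q_def)
    then show ?thesis by (simp add: H_def)
  next
    case True
    then have xU: "x \<in> U" and ux: "u x = f x" using B uf neighbours_self by blast+
    have "ennreal (1 / (ball_const * s powr d)) \<le> 1 / emeasure m (resistance_ball p \<E> \<F> x s)"
    proof -
      have "ennreal (1 / (ball_const * s powr d)) = 1 / ennreal (ball_const * s powr d)"
        using ball_const_pos s divide_ennreal[of 1 "ball_const * s powr d"] by simp
      also have "\<dots> \<le> 1 / emeasure m (resistance_ball p \<E> \<F> x s)"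
        unfolding divide_ennreal_def using ball_measure_upper[OF s(1,3)]
        by (intro mult_left_mono inverse_antimono_ennreal) auto
      finally show ?thesis .
    qed
    moreover have "ennreal (1 / s powr (d + p - 1)) * H x
      \<le> (\<integral>\<^sup>+y\<in>resistance_ball p \<E> \<F> x s. ennreal (\<bar>u x - u y\<bar> powr p / s powr (d + p - 1)) \<partial>m)"
    proof -
      have "ennreal (1 / s powr (d + p - 1)) * H x = (\<integral>\<^sup>+y. ennreal (1 / s powr (d + p - 1)) * q x y \<partial>m)"
        unfolding H_def by (intro nn_integral_cmult[symmetric] borel_measurable_m qy)
      also have "\<dots> \<le> (\<integral>\<^sup>+y\<in>resistance_ball p \<E> \<F> x s. ennreal (\<bar>u x - u y\<bar> powr p / s powr (d + p - 1)) \<partial>m)"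
      proof (rule nn_integral_mono)
        fix y
        show "ennreal (1 / s powr (d + p - 1)) * q x y
          \<le> ennreal (\<bar>u x - u y\<bar> powr p / s powr (d + p - 1)) * indicator (resistance_ball p \<E> \<F> x s) y"
        proof (cases "(x, y) \<in> Q")
          case True
          then obtain w w' where w: "w \<in> B" "w' \<in> neighbours T w" "x \<in> range (Fw w)" "y \<in> range (Fw w')"
            by (auto simp: Q_def)
          have "y \<in> resistance_ball p \<E> \<F> x s"
            using neighbours_in_ball[OF s(1) _ _ w(3,4)] w(1,2) B(1) unfolding T_def by blast
          moreover have "u y = f y" using uf w unfolding T_def by blast
          ultimately show ?thesis using True ux s by (simp add: q_def ennreal_mult[symmetric])
        qed (simp add: q_def)
      qed
      finally show ?thesis .
    qed
    ultimately have "ennreal (1 / (ball_const * s powr d)) * (ennreal (1 / s powr (d + p - 1)) * H x)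
      \<le> 1 / emeasure m (resistance_ball p \<E> \<F> x s) *
        (\<integral>\<^sup>+y\<in>resistance_ball p \<E> \<F> x s. ennreal (\<bar>u x - u y\<bar> powr p / s powr (d + p - 1)) \<partial>m)"
      by (rule mult_mono) auto
    then show ?thesis using xU ball_const_pos s unfolding K_def
      by (simp add: ennreal_mult[symmetric] mult.assoc[symmetric])
  qed
  have "ennreal K * (\<integral>\<^sup>+x. H x \<partial>m) \<le> ks_functional p \<E> \<F> d m U u s"
    unfolding ks_functional_def
    by (subst nn_integral_cmult[symmetric, OF borel_measurable_m[OF H]]) (intro nn_integral_mono le)
  moreover have "ennreal ((cell_const * s powr d)\<^sup>2) * (\<Sum>w\<in>B. \<Sum>w'\<in>neighbours T w. cell_difference f w w')
      \<le> (\<integral>\<^sup>+x. H x \<partial>m)"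
  proof -
    define \<theta> where "\<theta> = ennreal (cell_const * s powr d)"
    have \<theta>: "\<theta> \<le> ennreal (\<theta>w w)" if "w \<in> cells T" for w
      unfolding \<theta>_def using that cell_measure_lower[OF s(1,2)] by (intro ennreal_leI) (simp add: T_def)
    have HF: "(\<Sum>w'\<in>neighbours T w. \<theta> * (\<integral>\<^sup>+y. ennreal (\<bar>f (Fw w x) - f (Fw w' y)\<bar> powr p) \<partial>m)) \<le> H (Fw w x)"
      if w: "w \<in> B" for w x
    proof -
      have "(\<Sum>w'\<in>neighbours T w. \<theta> * (\<integral>\<^sup>+y. ennreal (\<bar>f (Fw w x) - f (Fw w' y)\<bar> powr p) \<partial>m))
        \<le> (\<Sum>w'\<in>neighbours T w. ennreal (\<theta>w w') * (\<integral>\<^sup>+y. q (Fw w x) (Fw w' y) \<partial>m))"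
      proof (intro sum_mono mult_mono \<theta> nn_integral_mono)
        fix w' y assume w': "w' \<in> neighbours T w"
        then show "w' \<in> cells T" using neighbours_sub by blast
        have "(Fw w x, Fw w' y) \<in> Q" using w w' by (auto simp: Q_def)
        then show "ennreal (\<bar>f (Fw w x) - f (Fw w' y)\<bar> powr p) \<le> q (Fw w x) (Fw w' y)" by (simp add: q_def)
      qed auto
      also have "\<dots> \<le> (\<Sum>w'\<in>cells T. ennreal (\<theta>w w') * (\<integral>\<^sup>+y. q (Fw w x) (Fw w' y) \<partial>m))"
        by (intro sum_mono2 finite_cells neighbours_sub) auto
      also have "\<dots> = H (Fw w x)" unfolding H_def by (rule nn_integral_cells[OF qy, symmetric])
      finally show ?thesis .
    qed
    have fw: "set w \<subseteq> S" if "w \<in> cells T" for w using that cells_set by blast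
    have inner: "(\<lambda>x. \<integral>\<^sup>+y. ennreal (\<bar>f (Fw w x) - f (Fw w' y)\<bar> powr p) \<partial>m) \<in> borel_measurable m"
      if "w \<in> cells T" "w' \<in> cells T" for w w'
    proof (rule sigma_finite_measure.borel_measurable_nn_integral[OF sigma_finite_m])
      have [measurable]: "(\<lambda>x. f (Fw w x)) \<in> borel_measurable m" "(\<lambda>x. f (Fw w' x)) \<in> borel_measurable m"
        using that f fw by (auto intro!: borel_measurable_m comp_Fw_measurable)
      show "(\<lambda>(x, y). ennreal (\<bar>f (Fw w x) - f (Fw w' y)\<bar> powr p)) \<in> borel_measurable (m \<Otimes>\<^sub>M m)"
        by measurable
    qed
    have "ennreal ((cell_const * s powr d)\<^sup>2) * (\<Sum>w\<in>B. \<Sum>w'\<in>neighbours T w. cell_difference f w w')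
      = (\<Sum>w\<in>B. \<theta> * (\<Sum>w'\<in>neighbours T w. \<theta> * cell_difference f w w'))"
      unfolding \<theta>_def using cell_const_pos
      by (simp add: power2_eq_square ennreal_mult sum_distrib_left mult.assoc)
    also have "\<dots> \<le> (\<Sum>w\<in>B. ennreal (\<theta>w w) * (\<integral>\<^sup>+x. H (Fw w x) \<partial>m))"
    proof (intro sum_mono mult_mono \<theta>)
      fix w assume w: "w \<in> B"
      then show wT: "w \<in> cells T" using B(1) by (auto simp: T_def)
      have nT: "w' \<in> cells T" if "w' \<in> neighbours T w" for w' using that neighbours_sub by blast
      have "(\<Sum>w'\<in>neighbours T w. \<theta> * cell_difference f w w')
        = (\<Sum>w'\<in>neighbours T w. \<integral>\<^sup>+x. \<theta> * (\<integral>\<^sup>+y. ennreal (\<bar>f (Fw w x) - f (Fw w' y)\<bar> powr p) \<partial>m) \<partial>m)"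
        unfolding cell_difference_def using inner[OF wT nT] by (intro sum.cong refl nn_integral_cmult[symmetric]) auto
      also have "\<dots> = (\<integral>\<^sup>+x. (\<Sum>w'\<in>neighbours T w. \<theta> * (\<integral>\<^sup>+y. ennreal (\<bar>f (Fw w x) - f (Fw w' y)\<bar> powr p) \<partial>m)) \<partial>m)"
        using inner[OF wT nT] by (intro nn_integral_sum[symmetric]) auto
      also have "\<dots> \<le> (\<integral>\<^sup>+x. H (Fw w x) \<partial>m)" by (intro nn_integral_mono HF w)
      finally show "(\<Sum>w'\<in>neighbours T w. \<theta> * cell_difference f w w') \<le> (\<integral>\<^sup>+x. H (Fw w x) \<partial>m)" .
    qed auto
    also have "\<dots> \<le> (\<Sum>w\<in>cells T. ennreal (\<theta>w w) * (\<integral>\<^sup>+x. H (Fw w x) \<partial>m))"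
      using B(1) by (intro sum_mono2 finite_cells) (auto simp: T_def)
    also have "\<dots> = (\<integral>\<^sup>+x. H x \<partial>m)" by (rule nn_integral_cells[OF H, symmetric])
    finally show ?thesis .
  qed
  ultimately have main: "ennreal K * (ennreal ((cell_const * s powr d)\<^sup>2) * (\<Sum>w\<in>B. \<Sum>w'\<in>neighbours T w. cell_difference f w w'))
     \<le> ks_functional p \<E> \<F> d m U u s"
    by (meson mult_left_mono order_trans zero_le)
  \<comment> \<open>the constant in the claim is the reciprocal of the one just obtained\<close>
  have one: "(ball_const / cell_const\<^sup>2 * s powr (p - 1)) * (K * (cell_const * s powr d)\<^sup>2) = 1"
  proof -
    have "s powr (d + p - 1) = s powr d * s powr (p - 1)" by (simp add: powr_add[symmetric] algebra_simps)
    then show ?thesis using ball_const_pos cell_const_pos s by (simp add: K_def power2_eq_square field_simps)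
  qed
  have "(\<Sum>w\<in>B. \<Sum>w'\<in>neighbours T w. cell_difference f w w')
    = ennreal ((ball_const / cell_const\<^sup>2 * s powr (p - 1)) * (K * (cell_const * s powr d)\<^sup>2))
       * (\<Sum>w\<in>B. \<Sum>w'\<in>neighbours T w. cell_difference f w w')" unfolding one by simp
  also have "\<dots> = ennreal (ball_const / cell_const\<^sup>2 * s powr (p - 1)) *
    (ennreal K * (ennreal ((cell_const * s powr d)\<^sup>2) * (\<Sum>w\<in>B. \<Sum>w'\<in>neighbours T w. cell_difference f w w')))"
  proof -
    have "ennreal ((ball_const / cell_const\<^sup>2 * s powr (p - 1)) * (K * (cell_const * s powr d)\<^sup>2))
      = ennreal (ball_const / cell_const\<^sup>2 * s powr (p - 1)) * (ennreal K * ennreal ((cell_const * s powr d)\<^sup>2))"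
      using K ball_const_pos by (subst ennreal_mult, simp, simp, subst ennreal_mult, auto)
    then show ?thesis by (simp add: mult.assoc)
  qed
  also have "\<dots> \<le> ennreal (ball_const / cell_const\<^sup>2 * s powr (p - 1)) * ks_functional p \<E> \<F> d m U u s"
    by (intro mult_left_mono main) auto
  finally show ?thesis unfolding T_def .
qed

text \<open>Averages over cells are replaced by values at the images of one well-chosen point of \<open>K\<close>; by
  Fubini's theorem some point is at least as good as the average.\<close>

lemma good_base_point:
  assumes f: "f \<in> borel_measurable borel" and B: "finite B" "\<And>w w'. (w, w') \<in> B \<Longrightarrow> set w \<subseteq> S \<and> set w' \<subseteq> S"
  shows "\<exists>y. (\<Sum>(w, w')\<in>B. lp_dist (\<lambda>x. f (Fw w x)) (\<lambda>_. f (Fw w' y))) \<le> (\<Sum>(w, w')\<in>B. cell_difference f w w')"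
proof (rule ccontr)
  interpret sigma_finite_measure m by (rule sigma_finite_m)
  interpret pair_sigma_finite m m by standard
  define G where "G = (\<lambda>y. \<Sum>(w, w')\<in>B. lp_dist (\<lambda>x. f (Fw w x)) (\<lambda>_. f (Fw w' y)))"
  define X where "X = (\<Sum>(w, w')\<in>B. cell_difference f w w')"
  assume "\<not> ?thesis"
  then have gt: "X < G y" for y by (auto simp: G_def X_def not_le)
  have prod: "(\<lambda>(x, y). ennreal (\<bar>f (Fw w x) - f (Fw w' y)\<bar> powr p)) \<in> borel_measurable (m \<Otimes>\<^sub>M m)"
    if "(w, w') \<in> B" for w w'
  proof -
    have [measurable]: "(\<lambda>x. f (Fw w x)) \<in> borel_measurable m" "(\<lambda>x. f (Fw w' x)) \<in> borel_measurable m"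
      using B(2)[OF that] f by (auto intro!: borel_measurable_m comp_Fw_measurable)
    show ?thesis by measurable
  qed
  have meas: "(\<lambda>y. lp_dist (\<lambda>x. f (Fw w x)) (\<lambda>_. f (Fw w' y))) \<in> borel_measurable m" if "(w, w') \<in> B" for w w'
    unfolding lp_dist_def
  proof (rule sigma_finite_measure.borel_measurable_nn_integral[OF sigma_finite_m])
    have "(\<lambda>z. (case z of (x, y) \<Rightarrow> ennreal (\<bar>f (Fw w x) - f (Fw w' y)\<bar> powr p))) \<circ> (\<lambda>(y, x). (x, y)) \<in> borel_measurable (m \<Otimes>\<^sub>M m)"
      by (rule measurable_comp[OF measurable_pair_swap' prod[OF that]])
    then show "(\<lambda>(y, x). ennreal (\<bar>f (Fw w x) - f (Fw w' y)\<bar> powr p)) \<in> borel_measurable (m \<Otimes>\<^sub>M m)"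
      by (simp add: o_def case_prod_beta')
  qed
  have "(\<integral>\<^sup>+y. G y \<partial>m) = (\<Sum>(w, w')\<in>B. \<integral>\<^sup>+y. lp_dist (\<lambda>x. f (Fw w x)) (\<lambda>_. f (Fw w' y)) \<partial>m)"
    unfolding G_def case_prod_beta' using meas by (intro nn_integral_sum) auto
  also have "\<dots> = X"
    unfolding X_def cell_difference_def lp_dist_def
    using Fubini'[OF prod] by (intro sum.cong refl) auto
  finally have GX: "(\<integral>\<^sup>+y. G y \<partial>m) = X" .
  have "X < top" using gt[of undefined] top_greatest[of "G undefined"] by (rule less_le_trans)
  have "(\<integral>\<^sup>+y. X \<partial>m) < (\<integral>\<^sup>+y. G y \<partial>m)"
  proof (rule nn_integral_less)
    show "G \<in> borel_measurable m" unfolding G_def case_prod_beta' using meas by (intro borel_measurable_sum) auto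
    show "(\<integral>\<^sup>+y. X \<partial>m) \<noteq> \<infinity>" using \<open>X < top\<close> by (simp add: emeasure_UNIV)
    show "AE y in m. X \<le> G y" using gt by (simp add: less_imp_le)
    show "\<not> (AE y in m. G y \<le> X)"
    proof
      assume "AE y in m. G y \<le> X"
      then have "AE y in m. False" using gt by (auto simp: not_le[symmetric] elim: eventually_mono)
      then have "emeasure m UNIV = 0" using AE_iff_measurable[of UNIV m "\<lambda>_. False"] by simp
      then show False using emeasure_UNIV by simp
    qed
  qed simp
  then show False using GX by (simp add: emeasure_UNIV)
qed

end

context self_similar_measure_form
begin

definition bump_bound :: real where
  "bump_bound = (SOME M. 1 \<le> M \<and> (\<forall>z\<in>V0. \<forall>x. \<bar>bump z x\<bar> \<le> M))"

lemma bump_bound: "1 \<le> bump_bound" "z \<in> V0 \<Longrightarrow> \<bar>bump z x\<bar> \<le> bump_bound"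
proof -
  have "\<exists>M. 1 \<le> M \<and> (\<forall>z\<in>V0. \<forall>x. \<bar>bump z x\<bar> \<le> M)"
  proof -
    have "\<forall>z\<in>V0. \<exists>M. \<forall>x. \<bar>bump z x\<bar> \<le> M" using bump(1) mem_bounded by blast
    then obtain M where M: "\<And>z x. z \<in> V0 \<Longrightarrow> \<bar>bump z x\<bar> \<le> M z" by metis
    have "M z \<le> Max (insert 1 (M ` V0))" if "z \<in> V0" for z using that finite_V0 by (intro Max_ge) auto
    then show ?thesis using M finite_V0
      by (intro exI[of _ "Max (insert 1 (M ` V0))"]) (fastforce intro: order_trans)
  qed
  from someI_ex[OF this] show "1 \<le> bump_bound" "z \<in> V0 \<Longrightarrow> \<bar>bump z x\<bar> \<le> bump_bound"
    unfolding bump_bound_def[symmetric] by auto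
qed

definition interp_dist_const :: real where
  "interp_dist_const = (bump_bound * real (card V0)) powr p"

lemma interpolate_dist:
  "lp_dist (interpolate c a) (\<lambda>_. c) \<le> ennreal (interp_dist_const * (\<Sum>z\<in>V0. \<bar>a z - c\<bar> powr p))"
proof -
  have "\<bar>interpolate c a x - c\<bar> powr p \<le> interp_dist_const * (\<Sum>z\<in>V0. \<bar>a z - c\<bar> powr p)" for x
  proof -
    have "\<bar>interpolate c a x - c\<bar> \<le> (\<Sum>z\<in>V0. \<bar>(a z - c) * bump z x\<bar>)"
      by (simp add: interpolate_def sum_abs)
    also have "\<dots> \<le> (\<Sum>z\<in>V0. \<bar>a z - c\<bar> * bump_bound)"
      unfolding abs_mult using bump_bound(2) by (intro sum_mono mult_left_mono) auto
    finally have "\<bar>interpolate c a x - c\<bar> \<le> bump_bound * (\<Sum>z\<in>V0. \<bar>a z - c\<bar>)"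
      by (simp add: sum_distrib_left mult.commute)
    then have "\<bar>interpolate c a x - c\<bar> powr p \<le> (bump_bound * (\<Sum>z\<in>V0. \<bar>a z - c\<bar>)) powr p"
      using p_gt_1 by (intro powr_mono2) auto
    also have "\<dots> = bump_bound powr p * (\<Sum>z\<in>V0. \<bar>a z - c\<bar>) powr p"
      using bump_bound(1) by (intro powr_mult)
    also have "\<dots> \<le> bump_bound powr p * (real (card V0) powr p * (\<Sum>z\<in>V0. \<bar>a z - c\<bar> powr p))"
      using finite_V0 p_gt_1 by (intro mult_left_mono powr_sum_le_card) auto
    also have "\<dots> = interp_dist_const * (\<Sum>z\<in>V0. \<bar>a z - c\<bar> powr p)"
      by (simp add: interp_dist_const_def powr_mult mult.assoc)
    finally show ?thesis .
  qed
  then have "lp_dist (interpolate c a) (\<lambda>_. c) \<le> (\<integral>\<^sup>+x. ennreal (interp_dist_const * (\<Sum>z\<in>V0. \<bar>a z - c\<bar> powr p)) \<partial>m)"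
    unfolding lp_dist_def by (intro nn_integral_mono ennreal_leI)
  then show ?thesis by (simp add: emeasure_UNIV)
qed

definition approx_const :: real where
  "approx_const = 2 powr p * ((interp_const + interp_dist_const) * (2 powr p * (2 * real (card V0))) + 1)"

lemma approx_const_pos: "0 < approx_const"
  using interp_const_pos by (simp add: approx_const_def interp_dist_const_def add_nonneg_pos)

text \<open>Glue with the constant \<open>c w\<close> on the cell of \<open>w\<close> and with the constant of some cell containing it at each
  vertex. Both constants are compared through \<open>g\<close>: if \<open>g\<close> is close to each of them in the mean, they
  are close to each other.\<close>

lemma interpolation_of_constants:
  fixes c :: "'i list \<Rightarrow> real"
  shows "\<exists>h\<in>\<F>. \<forall>w\<in>cells T. \<forall>g \<in> borel_measurable borel.
    ennreal (\<E> (h \<circ> Fw w)) \<le> ennreal approx_const * (\<Sum>w'\<in>neighbours T w. lp_dist g (\<lambda>_. c w')) \<and>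
    lp_dist (h \<circ> Fw w) g \<le> ennreal approx_const * (\<Sum>w'\<in>neighbours T w. lp_dist g (\<lambda>_. c w'))"
proof -
  obtain cellof where cellof: "\<And>q. cellof q \<in> cells T" "\<And>q. q \<in> range (Fw (cellof q))"
    using cells_cover[of T] by metis
  obtain h where h: "h \<in> \<F>" "\<And>w. w \<in> cells T \<Longrightarrow> h \<circ> Fw w = interpolate (c w) (\<lambda>z. c (cellof (Fw w z)))"
    using glue[of T c "\<lambda>q. c (cellof q)"] by blast
  have "ennreal (\<E> (h \<circ> Fw w)) \<le> ennreal approx_const * (\<Sum>w'\<in>neighbours T w. lp_dist g (\<lambda>_. c w')) \<and>
    lp_dist (h \<circ> Fw w) g \<le> ennreal approx_const * (\<Sum>w'\<in>neighbours T w. lp_dist g (\<lambda>_. c w'))"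
    if w: "w \<in> cells T" and g: "g \<in> borel_measurable borel" for w g
  proof -
    note [measurable] = g
    define W where "W = (\<Sum>w'\<in>neighbours T w. lp_dist g (\<lambda>_. c w'))"
    have leW: "lp_dist g (\<lambda>_. c w') \<le> W" if "w' \<in> neighbours T w" for w'
      unfolding W_def using that finite_neighbours by (intro member_le_sum) auto
    define a where "a = (\<lambda>z. c (cellof (Fw w z)))"
    define X where "X = (\<Sum>z\<in>V0. \<bar>a z - c w\<bar> powr p)"
    have X0: "0 \<le> X" by (simp add: X_def sum_nonneg)
    have "ennreal (\<bar>a z - c w\<bar> powr p) \<le> ennreal (2 powr p) * (W + W)" if "z \<in> V0" for z
    proof -
      have nb: "cellof (Fw w z) \<in> neighbours T w"
        using cellof[of "Fw w z"] by (auto simp: neighbours_def)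
      have "ennreal (\<bar>a z - c w\<bar> powr p) = lp_dist (\<lambda>_. a z) (\<lambda>_. c w)"
        by (simp add: lp_dist_def emeasure_UNIV)
      also have "\<dots> \<le> ennreal (2 powr p) * (lp_dist (\<lambda>_. a z) g + lp_dist g (\<lambda>_. c w))"
        by (rule lp_dist_triangle) measurable
      also have "\<dots> \<le> ennreal (2 powr p) * (W + W)"
        using leW[OF nb] leW[OF neighbours_self[OF w]]
        unfolding a_def lp_dist_commute[of _ g] by (intro mult_left_mono add_mono) auto
      finally show ?thesis .
    qed
    then have "(\<Sum>z\<in>V0. ennreal (\<bar>a z - c w\<bar> powr p)) \<le> (\<Sum>z\<in>V0. ennreal (2 powr p) * (W + W))"
      by (rule sum_mono)
    then have "ennreal X \<le> of_nat (card V0) * (ennreal (2 powr p) * (W + W))"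
      by (simp add: X_def sum_ennreal)
    also have "\<dots> = ennreal (2 powr p * (2 * real (card V0))) * W"
    proof -
      have "W + W = ennreal 2 * W" by (simp add: mult_2)
      then show ?thesis
        by (simp add: ennreal_mult ennreal_of_nat_eq_real_of_nat[symmetric] mult_ac)
    qed
    finally have XW: "ennreal X \<le> ennreal (2 powr p * (2 * real (card V0))) * W" .
    define k where "k = 2 powr p * (2 * real (card V0))"
    have k0: "0 \<le> k" by (simp add: k_def)
    have i0: "0 \<le> interp_const" "0 \<le> interp_dist_const"
      using interp_const_pos by (auto simp: interp_dist_const_def)
    have p2: "1 \<le> (2::real) powr p" using p_gt_1 by (intro ge_one_powr_ge_zero) auto
    have hw: "h \<circ> Fw w = interpolate (c w) a" using h(2)[OF w] by (simp add: a_def)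
    have energy: "ennreal (\<E> (h \<circ> Fw w)) \<le> ennreal approx_const * W"
    proof -
      have "ennreal (\<E> (h \<circ> Fw w)) \<le> ennreal (interp_const * X)"
        unfolding hw X_def by (intro ennreal_leI interpolate_energy)
      also have "\<dots> = ennreal interp_const * ennreal X" using i0 X0 by (simp add: ennreal_mult)
      also have "\<dots> \<le> ennreal interp_const * (ennreal k * W)" using XW unfolding k_def by (intro mult_left_mono) auto
      also have "\<dots> = ennreal (interp_const * k) * W" using i0 k0 by (simp add: ennreal_mult mult.assoc)
      also have "\<dots> \<le> ennreal approx_const * W"
      proof (intro mult_right_mono ennreal_leI)
        have "interp_const * k \<le> (interp_const + interp_dist_const) * k + 1"
          using i0 k0 by (simp add: distrib_right)
        also have "\<dots> = 1 * ((interp_const + interp_dist_const) * k + 1)" by simp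
        also have "\<dots> \<le> approx_const"
          unfolding approx_const_def k_def[symmetric] using p2 i0 k0 by (intro mult_right_mono) auto
        finally show "interp_const * k \<le> approx_const" .
      qed auto
      finally show ?thesis .
    qed
    have "lp_dist (h \<circ> Fw w) g \<le> ennreal (2 powr p) * (lp_dist (h \<circ> Fw w) (\<lambda>_. c w) + lp_dist (\<lambda>_. c w) g)"
      using mem_measurable[OF word_mem[OF h(1) cells_set[OF w]]] by (intro lp_dist_triangle) auto
    also have "\<dots> \<le> ennreal (2 powr p) * (ennreal interp_dist_const * (ennreal k * W) + W)"
    proof (intro mult_left_mono add_mono)
      have "lp_dist (h \<circ> Fw w) (\<lambda>_. c w) \<le> ennreal (interp_dist_const * X)"
        unfolding hw X_def by (rule interpolate_dist)
      also have "\<dots> = ennreal interp_dist_const * ennreal X" using i0 X0 by (simp add: ennreal_mult)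
      also have "\<dots> \<le> ennreal interp_dist_const * (ennreal k * W)" using XW unfolding k_def by (intro mult_left_mono) auto
      finally show "lp_dist (h \<circ> Fw w) (\<lambda>_. c w) \<le> ennreal interp_dist_const * (ennreal k * W)" .
      show "lp_dist (\<lambda>_. c w) g \<le> W" using leW[OF neighbours_self[OF w]] by (simp add: lp_dist_commute)
    qed auto
    also have "\<dots> = ennreal (2 powr p * (interp_dist_const * k + 1)) * W"
    proof -
      have "ennreal (2 powr p * (interp_dist_const * k + 1)) = ennreal (2 powr p) * (ennreal interp_dist_const * ennreal k + 1)"
        using i0 k0 by (simp add: ennreal_mult ennreal_plus)
      then show ?thesis by (simp add: distrib_right mult.assoc)
    qed
    also have "\<dots> \<le> ennreal approx_const * W"
      unfolding approx_const_def k_def[symmetric] using i0 k0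
      by (intro mult_right_mono ennreal_leI mult_left_mono) (auto simp: distrib_right)
    finally show ?thesis using energy unfolding W_def by blast
  qed
  then show ?thesis using h(1) by blast
qed

definition ks_const :: real where
  "ks_const = approx_const * (ball_const / cell_const\<^sup>2)"

lemma ks_const_pos: "0 < ks_const"
  using approx_const_pos ball_const_pos cell_const_pos by (simp add: ks_const_def)

text \<open>Choosing as constants the values of \<open>f\<close> at the images of a good base point turns the cell differences
  into bounds for energy and distance.\<close>

lemma ks_approximation:
  assumes s: "0 < s" "s powr (p - 1) \<le> scale_const" "s powr (p - 1) \<le> separation"
    and f: "f \<in> borel_measurable borel"
    and B: "B \<subseteq> cells (level s)" "\<And>w. w \<in> B \<Longrightarrow> range (Fw w) \<subseteq> U"
    and uf: "\<And>w w' x. w \<in> B \<Longrightarrow> w' \<in> neighbours (level s) w \<Longrightarrow> x \<in> range (Fw w') \<Longrightarrow> u x = f x"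
  shows "\<exists>h\<in>\<F>. (\<Sum>w\<in>B. ennreal (\<E> (h \<circ> Fw w)))
        \<le> ennreal (ks_const * s powr (p - 1)) * ks_functional p \<E> \<F> d m U u s \<and>
      (\<forall>w\<in>B. lp_dist (h \<circ> Fw w) (f \<circ> Fw w) \<le> ennreal (ks_const * s powr (p - 1)) * ks_functional p \<E> \<F> d m U u s)"
proof -
  define T where "T = level s"
  define KS where "KS = ks_functional p \<E> \<F> d m U u s"
  have fB: "finite B" using B(1) finite_cells finite_subset by blast
  have sets: "set w \<subseteq> S" if "w \<in> cells T" for w using cells_set that by blast
  define P where "P = (SIGMA w:B. neighbours T w)"
  have finP: "finite P" unfolding P_def using fB finite_neighbours by (intro finite_SigmaI) auto
  have subP: "w \<in> cells T \<and> w' \<in> cells T" if "(w, w') \<in> P" for w w'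
    using that B(1) neighbours_sub by (auto simp: P_def T_def)
  have "\<exists>y. (\<Sum>(w, w')\<in>P. lp_dist (\<lambda>x. f (Fw w x)) (\<lambda>_. f (Fw w' y))) \<le> (\<Sum>(w, w')\<in>P. cell_difference f w w')"
    using f finP subP sets by (intro good_base_point) auto
  then obtain y where y: "(\<Sum>(w, w')\<in>P. lp_dist (\<lambda>x. f (Fw w x)) (\<lambda>_. f (Fw w' y))) \<le> (\<Sum>(w, w')\<in>P. cell_difference f w w')" by blast
  define c where "c = (\<lambda>w. f (Fw w y))"
  define W where "W = (\<lambda>w. \<Sum>w'\<in>neighbours T w. lp_dist (f \<circ> Fw w) (\<lambda>_. c w'))"
  have "(\<Sum>w\<in>B. W w) = (\<Sum>(w, w')\<in>P. lp_dist (\<lambda>x. f (Fw w x)) (\<lambda>_. f (Fw w' y)))"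
    unfolding W_def P_def c_def using fB finite_neighbours by (simp add: sum.Sigma o_def)
  also have "\<dots> \<le> (\<Sum>w\<in>B. \<Sum>w'\<in>neighbours T w. cell_difference f w w')"
    using y unfolding P_def using fB finite_neighbours by (simp add: sum.Sigma)
  also have "\<dots> \<le> ennreal (ball_const / cell_const\<^sup>2 * s powr (p - 1)) * KS"
    unfolding T_def KS_def by (rule cell_differences_le_ks[OF s f B uf])
  finally have WK: "(\<Sum>w\<in>B. W w) \<le> ennreal (ball_const / cell_const\<^sup>2 * s powr (p - 1)) * KS" .
  have const: "ennreal approx_const * (\<Sum>w\<in>B. W w) \<le> ennreal (ks_const * s powr (p - 1)) * KS"
  proof -
    have "ennreal approx_const * (\<Sum>w\<in>B. W w) \<le> ennreal approx_const * (ennreal (ball_const / cell_const\<^sup>2 * s powr (p - 1)) * KS)"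
      using WK by (intro mult_left_mono) auto
    also have "\<dots> = ennreal (approx_const * (ball_const / cell_const\<^sup>2 * s powr (p - 1))) * KS"
      using approx_const_pos ball_const_pos by (subst ennreal_mult) (auto simp: mult.assoc)
    finally show ?thesis by (simp add: ks_const_def mult.assoc)
  qed
  obtain h where h: "h \<in> \<F>" "\<And>w g. w \<in> cells T \<Longrightarrow> g \<in> borel_measurable borel \<Longrightarrow>
      ennreal (\<E> (h \<circ> Fw w)) \<le> ennreal approx_const * (\<Sum>w'\<in>neighbours T w. lp_dist g (\<lambda>_. c w')) \<and>
      lp_dist (h \<circ> Fw w) g \<le> ennreal approx_const * (\<Sum>w'\<in>neighbours T w. lp_dist g (\<lambda>_. c w'))"
    using interpolation_of_constants[of T c] by blast
  have hB: "ennreal (\<E> (h \<circ> Fw w)) \<le> ennreal approx_const * W w \<and> lp_dist (h \<circ> Fw w) (f \<circ> Fw w) \<le> ennreal approx_const * W w"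
    if "w \<in> B" for w
  proof -
    have "w \<in> cells T" using that B(1) by (auto simp: T_def)
    moreover then have "f \<circ> Fw w \<in> borel_measurable borel"
      unfolding o_def using f sets by (intro comp_Fw_measurable) auto
    ultimately show ?thesis unfolding W_def by (rule h(2))
  qed
  have "(\<Sum>w\<in>B. ennreal (\<E> (h \<circ> Fw w))) \<le> (\<Sum>w\<in>B. ennreal approx_const * W w)"
    using hB by (intro sum_mono) auto
  also have "\<dots> = ennreal approx_const * (\<Sum>w\<in>B. W w)" by (simp add: sum_distrib_left)
  also note const
  finally have "(\<Sum>w\<in>B. ennreal (\<E> (h \<circ> Fw w))) \<le> ennreal (ks_const * s powr (p - 1)) * KS" .
  moreover have "lp_dist (h \<circ> Fw w) (f \<circ> Fw w) \<le> ennreal (ks_const * s powr (p - 1)) * KS" if w: "w \<in> B" for w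
  proof -
    have "W w \<le> (\<Sum>w\<in>B. W w)" using w fB by (intro member_le_sum) auto
    then have "ennreal approx_const * W w \<le> ennreal approx_const * (\<Sum>w\<in>B. W w)" by (intro mult_left_mono) auto
    then show ?thesis using hB[OF w] const by (meson order_trans)
  qed
  ultimately show ?thesis using h(1) unfolding KS_def by blast
qed

lemma sum_\<theta>w: "(\<Sum>w\<in>cells T. ennreal (\<theta>w w)) = 1"
  using nn_integral_cells[of "\<lambda>_. 1" T] by (simp add: emeasure_UNIV)

definition total_const :: real where
  "total_const = ks_const * (scale_const * \<rho>max)"

lemma total_const_pos: "0 < total_const"
  using ks_const_pos scale_const_pos \<rho>max(2) by (simp add: total_const_def)

text \<open>Regrouping the fine cells by the coarse cells of \<open>A\<close> that contain them: by scaling, the fine energies carry weights of order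
  \<open>1 / s powr (p - 1)\<close>, which cancels the factor \<open>s powr (p - 1)\<close> in the energy bound but leaves it in the distance.\<close>

lemma ks_approximation_coarse:
  assumes s: "0 < s" "s powr (p - 1) \<le> scale_const" "s powr (p - 1) \<le> separation" "T0 \<le> level s"
    and f: "f \<in> borel_measurable borel"
    and A: "A \<subseteq> cells T0" "\<And>v. v \<in> A \<Longrightarrow> range (Fw v) \<subseteq> U"
    and uf: "\<And>v v' x. v \<in> A \<Longrightarrow> v' \<in> neighbours T0 v \<Longrightarrow> x \<in> range (Fw v') \<Longrightarrow> u x = f x"
  shows "\<exists>h\<in>\<F>. (\<Sum>v\<in>A. ennreal (\<rho>w v) * ennreal (\<E> (h \<circ> Fw v)))
        \<le> ennreal total_const * ks_functional p \<E> \<F> d m U u s \<and>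
      (\<forall>v\<in>A. lp_dist (h \<circ> Fw v) (f \<circ> Fw v) \<le> ennreal (ks_const * s powr (p - 1)) * ks_functional p \<E> \<F> d m U u s)"
proof -
  define T where "T = level s"
  define KS where "KS = ks_functional p \<E> \<F> d m U u s"
  have fA: "finite A" using A(1) finite_cells finite_subset by blast
  define C where "C = (\<lambda>v. cells (T / \<rho>w v))"
  define B where "B = (\<lambda>(v, w). v @ w) ` (SIGMA v:A. C v)"
  have fP: "finite (SIGMA v:A. C v)" unfolding C_def using fA finite_cells by (intro finite_SigmaI) auto
  have inj: "inj_on (\<lambda>(v, w). v @ w) (SIGMA v:A. C v)"
  proof (rule inj_onI, clarify)
    fix v w v' w' assume "v \<in> A" "v' \<in> A" "v @ w = v' @ w'"
    then show "v = v' \<and> w = w'" using A(1) cells_append_inject[of v T0 v' w w'] by blast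
  qed
  have sumB: "(\<Sum>w\<in>B. G w) = (\<Sum>v\<in>A. \<Sum>w\<in>C v. G (v @ w))" for G :: "'i list \<Rightarrow> ennreal"
  proof -
    have "(\<Sum>w\<in>B. G w) = (\<Sum>(v, w)\<in>(SIGMA v:A. C v). G (v @ w))"
      unfolding B_def by (subst sum.reindex[OF inj]) (simp add: case_prod_beta' o_def)
    also have "\<dots> = (\<Sum>v\<in>A. \<Sum>w\<in>C v. G (v @ w))"
      using fA finite_cells by (intro sum.Sigma[symmetric]) (auto simp: C_def)
    finally show ?thesis .
  qed
  have BT: "B \<subseteq> cells T"
    using A(1) s(4) cells_append[of _ T0 _ T] by (auto simp: B_def C_def T_def)
  have AS: "set v \<subseteq> S" if "v \<in> A" for v using that A(1) cells_set by blast
  have BS: "set w \<subseteq> S" if "w \<in> B" for w using that BT cells_set by blast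
  have CS: "set w \<subseteq> S" if "w \<in> C v" for v w using that cells_set by (auto simp: C_def)
  have range_sub: "range (Fw (v @ w)) \<subseteq> range (Fw v)" for v w by (auto simp: word_map_append)
  have "\<exists>h\<in>\<F>. (\<Sum>w\<in>B. ennreal (\<E> (h \<circ> Fw w))) \<le> ennreal (ks_const * s powr (p - 1)) * KS \<and>
      (\<forall>w\<in>B. lp_dist (h \<circ> Fw w) (f \<circ> Fw w) \<le> ennreal (ks_const * s powr (p - 1)) * KS)"
    unfolding KS_def
  proof (rule ks_approximation[OF s(1-3) f])
    show "B \<subseteq> cells (level s)" using BT by (simp add: T_def)
    show "range (Fw w) \<subseteq> U" if wB: "w \<in> B" for w
    proof -
      obtain v w1 where "w = v @ w1" "v \<in> A" using wB by (auto simp: B_def)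
      then show ?thesis using range_sub A(2) by blast
    qed
    fix w w' x assume w: "w \<in> B" "w' \<in> neighbours (level s) w" "x \<in> range (Fw w')"
    obtain v w1 where v: "w = v @ w1" "v \<in> A" using w(1) by (auto simp: B_def)
    have "w' \<in> cells T" using w(2) neighbours_sub by (auto simp: T_def)
    then obtain v' w1' where v': "v' \<in> cells T0" "w' = v' @ w1'"
      using cells_split[of w' T T0] s(4) by (auto simp: T_def)
    have "range (Fw v) \<inter> range (Fw v') \<noteq> {}"
      using w(2) v v' range_sub[of v w1] range_sub[of v' w1'] by (auto simp: neighbours_def)
    then have "v' \<in> neighbours T0 v" using v' by (auto simp: neighbours_def)
    then show "u x = f x" using uf[OF v(2)] w(3) v'(2) range_sub by blast
  qed
  then obtain h where h: "h \<in> \<F>" "(\<Sum>w\<in>B. ennreal (\<E> (h \<circ> Fw w))) \<le> ennreal (ks_const * s powr (p - 1)) * KS"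
      "\<And>w. w \<in> B \<Longrightarrow> lp_dist (h \<circ> Fw w) (f \<circ> Fw w) \<le> ennreal (ks_const * s powr (p - 1)) * KS" by blast
  have T1: "1 \<le> T" using s by (simp add: T_def level_def)
  have weight: "\<rho>w w \<le> T * \<rho>max" if "w \<in> B" for w
  proof -
    have "1 * 1 \<le> T * \<rho>max" using T1 \<rho>max(2) by (intro mult_mono) auto
    then show ?thesis using cells_weight_upper[of w T] that BT by auto
  qed
  have "(\<Sum>v\<in>A. ennreal (\<rho>w v) * ennreal (\<E> (h \<circ> Fw v))) = (\<Sum>v\<in>A. \<Sum>w\<in>C v. ennreal (\<rho>w (v @ w)) * ennreal (\<E> (h \<circ> Fw (v @ w))))"
  proof (intro sum.cong refl)
    fix v assume v: "v \<in> A"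
    have hv: "h \<circ> Fw v \<in> \<F>" using h(1) AS[OF v] by (rule word_mem)
    have nn: "0 \<le> \<rho>w w * \<E> (h \<circ> Fw v \<circ> Fw w)" "0 \<le> \<E> (h \<circ> Fw v \<circ> Fw w)" "0 \<le> \<rho>w w" if "w \<in> C v" for w
      using \<rho>w_pos[OF CS[OF that]] energy_nonneg[OF word_mem[OF hv CS[OF that]]] by auto
    have "\<E> (h \<circ> Fw v) = (\<Sum>w\<in>C v. \<rho>w w * \<E> (h \<circ> Fw v \<circ> Fw w))"
      unfolding C_def by (rule energy_cells[OF hv])
    also have "ennreal \<dots> = (\<Sum>w\<in>C v. ennreal (\<rho>w w * \<E> (h \<circ> Fw v \<circ> Fw w)))"
      using nn(1) by (rule sum_ennreal[symmetric])
    finally have "ennreal (\<rho>w v) * ennreal (\<E> (h \<circ> Fw v)) = (\<Sum>w\<in>C v. ennreal (\<rho>w v) * ennreal (\<rho>w w * \<E> (h \<circ> Fw v \<circ> Fw w)))"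
      by (simp only: sum_distrib_left)
    also have "\<dots> = (\<Sum>w\<in>C v. ennreal (\<rho>w (v @ w)) * ennreal (\<E> (h \<circ> Fw (v @ w))))"
      using nn \<rho>w_pos[OF AS[OF v]]
      by (intro sum.cong refl) (simp add: ennreal_mult[symmetric] word_weight_append word_map_append mult.assoc comp_assoc)
    finally show "ennreal (\<rho>w v) * ennreal (\<E> (h \<circ> Fw v)) = (\<Sum>w\<in>C v. ennreal (\<rho>w (v @ w)) * ennreal (\<E> (h \<circ> Fw (v @ w))))" .
  qed
  also have "\<dots> = (\<Sum>w\<in>B. ennreal (\<rho>w w) * ennreal (\<E> (h \<circ> Fw w)))" by (rule sumB[symmetric])
  also have "\<dots> \<le> (\<Sum>w\<in>B. ennreal (T * \<rho>max) * ennreal (\<E> (h \<circ> Fw w)))"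
    using weight by (intro sum_mono mult_right_mono ennreal_leI) auto
  also have "\<dots> = ennreal (T * \<rho>max) * (\<Sum>w\<in>B. ennreal (\<E> (h \<circ> Fw w)))" by (simp add: sum_distrib_left)
  also have "\<dots> \<le> ennreal (T * \<rho>max) * (ennreal (ks_const * s powr (p - 1)) * KS)"
    using h(2) by (intro mult_left_mono) auto
  also have "\<dots> = ennreal (T * \<rho>max * (ks_const * s powr (p - 1))) * KS"
    using T1 \<rho>max(2) ks_const_pos by (subst ennreal_mult[of "T * \<rho>max"]) (auto simp: mult.assoc)
  also have "T * \<rho>max * (ks_const * s powr (p - 1)) = total_const"
    using s(1) by (simp add: T_def level_def total_const_def)
  finally have first: "(\<Sum>v\<in>A. ennreal (\<rho>w v) * ennreal (\<E> (h \<circ> Fw v))) \<le> ennreal total_const * KS" .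
  have second: "lp_dist (h \<circ> Fw v) (f \<circ> Fw v) \<le> ennreal (ks_const * s powr (p - 1)) * KS" if v: "v \<in> A" for v
  proof -
    have [measurable]: "h \<circ> Fw v \<in> borel_measurable borel" "f \<circ> Fw v \<in> borel_measurable borel"
      using mem_measurable[OF word_mem[OF h(1) AS[OF v]]] comp_Fw_measurable[OF f AS[OF v]] by (auto simp: o_def)
    have "lp_dist (h \<circ> Fw v) (f \<circ> Fw v) = (\<Sum>w\<in>C v. ennreal (\<theta>w w) * (\<integral>\<^sup>+x. ennreal (\<bar>(h \<circ> Fw v) (Fw w x) - (f \<circ> Fw v) (Fw w x)\<bar> powr p) \<partial>m))"
      unfolding lp_dist_def C_def by (rule nn_integral_cells) measurable
    also have "\<dots> = (\<Sum>w\<in>C v. ennreal (\<theta>w w) * lp_dist (h \<circ> Fw (v @ w)) (f \<circ> Fw (v @ w)))"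
      by (simp add: lp_dist_def word_map_append)
    also have "\<dots> \<le> (\<Sum>w\<in>C v. ennreal (\<theta>w w) * (ennreal (ks_const * s powr (p - 1)) * KS))"
      using v by (intro sum_mono mult_left_mono h(3)) (auto simp: B_def)
    also have "\<dots> = (\<Sum>w\<in>C v. ennreal (\<theta>w w)) * (ennreal (ks_const * s powr (p - 1)) * KS)"
      by (simp add: sum_distrib_right)
    also have "(\<Sum>w\<in>C v. ennreal (\<theta>w w)) = 1" unfolding C_def by (rule sum_\<theta>w)
    finally show ?thesis by (simp only: mult_1_left)
  qed
  show ?thesis using h(1) first second unfolding KS_def by blast
qed

lemma powr_small: "0 < c \<Longrightarrow> \<exists>s0>0. \<forall>s. 0 < s \<and> s < s0 \<longrightarrow> s powr (p - 1) \<le> c"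
proof (intro exI[of _ "c powr (1 / (p - 1))"] conjI allI impI)
  fix s assume c: "0 < c" and s: "0 < s \<and> s < c powr (1 / (p - 1))"
  then have "s powr (p - 1) \<le> (c powr (1 / (p - 1))) powr (p - 1)" using p_gt_1 by (intro powr_mono2) auto
  then show "s powr (p - 1) \<le> c" using c p_gt_1 by (simp add: powr_powr)
qed simp

text \<open>Let \<open>s\<close> tend to zero along a sequence on which the functional stays below a fixed number above its lower
  limit. Semicontinuity applies on each coarse
  cell separately, and Fatou's lemma for the counting measure combines the cells.\<close>

lemma local_energy_le_ks:
  assumes f: "f \<in> borel_measurable borel"
    and A: "A \<subseteq> cells T0" "\<And>v. v \<in> A \<Longrightarrow> range (Fw v) \<subseteq> U"
    and uf: "\<And>v v' x. v \<in> A \<Longrightarrow> v' \<in> neighbours T0 v \<Longrightarrow> x \<in> range (Fw v') \<Longrightarrow> u x = f x"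
  shows "(\<Sum>v\<in>A. ennreal (\<rho>w v) * extended_energy m \<E> \<F> (f \<circ> Fw v))
    \<le> ennreal total_const * Liminf (at_right 0) (\<lambda>s. ks_functional p \<E> \<F> d m U u s)"
proof -
  define KS where "KS = (\<lambda>s. ks_functional p \<E> \<F> d m U u s)"
  define L where "L = Liminf (at_right 0) KS"
  define X where "X = (\<Sum>v\<in>A. ennreal (\<rho>w v) * extended_energy m \<E> \<F> (f \<circ> Fw v))"
  have fA: "finite A" using A(1) finite_cells finite_subset by blast
  have AS: "set v \<subseteq> S" if "v \<in> A" for v using that A(1) cells_set by blast
  have step: "X \<le> ennreal total_const * ennreal r" if r: "L < ennreal r" for r
  proof -
    obtain s0 where s0: "0 < s0" "\<And>s. 0 < s \<Longrightarrow> s < s0 \<Longrightarrow> s powr (p - 1) \<le> min (min scale_const separation) (scale_const / max 1 T0)"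
      using powr_small[of "min (min scale_const separation) (scale_const / max 1 T0)"] scale_const_pos separation_pos by auto
    have small: "s powr (p - 1) \<le> scale_const" "s powr (p - 1) \<le> separation" "T0 \<le> level s" if "0 < s" "s < s0" for s
    proof -
      note * = s0(2)[OF that]
      show "s powr (p - 1) \<le> scale_const" "s powr (p - 1) \<le> separation" using * by auto
      have "s powr (p - 1) \<le> scale_const / max 1 T0" using * by auto
      then have "max 1 T0 * s powr (p - 1) \<le> scale_const" by (subst (asm) pos_le_divide_eq) (auto simp: mult.commute)
      moreover have "T0 * s powr (p - 1) \<le> max 1 T0 * s powr (p - 1)" by (intro mult_right_mono) auto
      ultimately have "T0 * s powr (p - 1) \<le> scale_const" by (rule order_trans[rotated])
      then show "T0 \<le> level s" using \<open>0 < s\<close> by (simp add: level_def pos_le_divide_eq)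
    qed
    have "\<exists>s. 0 < s \<and> s < min s0 (1 / real (Suc n)) \<and> KS s < ennreal r" for n
    proof (rule ccontr)
      assume none: "\<not> ?thesis"
      have "\<forall>\<^sub>F s in at_right 0. ennreal r \<le> KS s"
      proof (rule eventually_at_rightI[of 0 "min s0 (1 / real (Suc n))"])
        fix s assume "s \<in> {0<..<min s0 (1 / real (Suc n))}"
        then show "ennreal r \<le> KS s" using none by (meson greaterThanLessThan_iff not_less)
      qed (use s0(1) in simp)
      then have "ennreal r \<le> L" unfolding L_def by (rule Liminf_bounded)
      then show False using r by simp
    qed
    then obtain s where s: "\<And>n. 0 < s n" "\<And>n. s n < s0" "\<And>n. s n < 1 / real (Suc n)" "\<And>n. KS (s n) < ennreal r"
      by (metis min_less_iff_conj)
    have "\<forall>n. \<exists>h\<in>\<F>. (\<Sum>v\<in>A. ennreal (\<rho>w v) * ennreal (\<E> (h \<circ> Fw v))) \<le> ennreal total_const * KS (s n) \<and>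
      (\<forall>v\<in>A. lp_dist (h \<circ> Fw v) (f \<circ> Fw v) \<le> ennreal (ks_const * s n powr (p - 1)) * KS (s n))"
      unfolding KS_def by (intro allI ks_approximation_coarse[OF s(1) small[OF s(1,2)] f A uf])
    from this[unfolded Bex_def, THEN choice] obtain h where h: "\<And>n. h n \<in> \<F>"
      "\<And>n. (\<Sum>v\<in>A. ennreal (\<rho>w v) * ennreal (\<E> (h n \<circ> Fw v))) \<le> ennreal total_const * KS (s n)"
      "\<And>n v. v \<in> A \<Longrightarrow> lp_dist (h n \<circ> Fw v) (f \<circ> Fw v) \<le> ennreal (ks_const * s n powr (p - 1)) * KS (s n)" by auto
    have s_lim: "s \<longlonglongrightarrow> 0"
    proof (rule tendsto_sandwich[OF _ _ tendsto_const])
      show "(\<lambda>n. 1 / real (Suc n)) \<longlonglongrightarrow> 0" by (rule LIMSEQ_Suc[OF lim_1_over_n])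
    qed (use s in \<open>auto simp: less_imp_le\<close>)
    have bound_lim: "(\<lambda>n. ennreal (ks_const * s n powr (p - 1)) * ennreal r) \<longlonglongrightarrow> 0"
    proof -
      have "(\<lambda>n. s n powr (p - 1)) \<longlonglongrightarrow> 0 powr (p - 1)"
        using s_lim s(1) p_gt_1 by (intro tendsto_powr' tendsto_const) (auto simp: less_imp_le)
      then have "(\<lambda>n. ennreal (ks_const * s n powr (p - 1))) \<longlonglongrightarrow> 0"
        using tendsto_ennrealI[OF tendsto_mult_left[of "\<lambda>n. s n powr (p - 1)" 0 sequentially ks_const]] p_gt_1 by simp
      from tendsto_ennreal_cmult_zero[OF this, of r] show ?thesis by (subst mult.commute)
    qed
    have lsc: "extended_energy m \<E> \<F> (f \<circ> Fw v) \<le> liminf (\<lambda>n. ennreal (\<E> (h n \<circ> Fw v)))" if v: "v \<in> A" for v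
    proof (rule energy_lower_semicontinuous)
      show "h n \<circ> Fw v \<in> \<F>" for n using h(1) AS[OF v] by (rule word_mem)
      show "f \<circ> Fw v \<in> borel_measurable borel" using comp_Fw_measurable[OF f AS[OF v]] by (simp add: o_def)
      show "(\<lambda>n. lp_dist (h n \<circ> Fw v) (f \<circ> Fw v)) \<longlonglongrightarrow> 0"
      proof (rule tendsto_sandwich[OF _ _ tendsto_const bound_lim])
        have "lp_dist (h n \<circ> Fw v) (f \<circ> Fw v) \<le> ennreal (ks_const * s n powr (p - 1)) * ennreal r" for n
          using h(3)[OF v, of n] s(4)[of n] by (meson less_imp_le mult_left_mono order_trans zero_le)
        then show "\<forall>\<^sub>F n in sequentially. lp_dist (h n \<circ> Fw v) (f \<circ> Fw v) \<le> ennreal (ks_const * s n powr (p - 1)) * ennreal r"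
          by simp
      qed simp
    qed
    have "X \<le> (\<Sum>v\<in>A. liminf (\<lambda>n. ennreal (\<rho>w v) * ennreal (\<E> (h n \<circ> Fw v))))"
      unfolding X_def
    proof (rule sum_mono)
      fix v assume v: "v \<in> A"
      have "ennreal (\<rho>w v) * extended_energy m \<E> \<F> (f \<circ> Fw v) \<le> ennreal (\<rho>w v) * liminf (\<lambda>n. ennreal (\<E> (h n \<circ> Fw v)))"
        by (intro mult_left_mono lsc v) auto
      also have "\<dots> = liminf (\<lambda>n. ennreal (\<rho>w v) * ennreal (\<E> (h n \<circ> Fw v)))"
      proof (rule Liminf_compose_continuous_mono[symmetric])
        show "continuous_on UNIV ((*) (ennreal (\<rho>w v)))"
          unfolding continuous_on_def by (intro ballI ennreal_tendsto_cmult tendsto_ident_at) simp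
      qed (auto intro!: monoI mult_left_mono)
      finally show "ennreal (\<rho>w v) * extended_energy m \<E> \<F> (f \<circ> Fw v) \<le> liminf (\<lambda>n. ennreal (\<rho>w v) * ennreal (\<E> (h n \<circ> Fw v)))" .
    qed
    also have "\<dots> = (\<integral>\<^sup>+v. liminf (\<lambda>n. ennreal (\<rho>w v) * ennreal (\<E> (h n \<circ> Fw v))) \<partial>count_space A)"
      using fA by (simp add: nn_integral_count_space_finite)
    also have "\<dots> \<le> liminf (\<lambda>n. \<integral>\<^sup>+v. ennreal (\<rho>w v) * ennreal (\<E> (h n \<circ> Fw v)) \<partial>count_space A)"
      by (rule nn_integral_liminf) simp
    also have "\<dots> = liminf (\<lambda>n. \<Sum>v\<in>A. ennreal (\<rho>w v) * ennreal (\<E> (h n \<circ> Fw v)))"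
      using fA by (simp add: nn_integral_count_space_finite)
    also have "\<dots> \<le> liminf (\<lambda>n. ennreal total_const * ennreal r)"
    proof (intro Liminf_mono always_eventually allI)
      fix n
      have "(\<Sum>v\<in>A. ennreal (\<rho>w v) * ennreal (\<E> (h n \<circ> Fw v))) \<le> ennreal total_const * KS (s n)" by (rule h(2))
      also have "\<dots> \<le> ennreal total_const * ennreal r" using s(4)[of n] by (intro mult_left_mono) auto
      finally show "(\<Sum>v\<in>A. ennreal (\<rho>w v) * ennreal (\<E> (h n \<circ> Fw v))) \<le> ennreal total_const * ennreal r" .
    qed
    also have "\<dots> = ennreal total_const * ennreal r" by (simp add: Liminf_const)
    finally show ?thesis .
  qed
  have "X \<le> ennreal total_const * L"
  proof (rule ennreal_le_epsilon)
    fix e :: real assume fin: "ennreal total_const * L < top" and e: "0 < e"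
    have "L < top" using fin total_const_pos by (auto simp: ennreal_mult_less_top)
    then obtain l where l: "L = ennreal l" "0 \<le> l" by (cases L) auto
    have "X \<le> ennreal total_const * ennreal (l + e / total_const)"
      using l e total_const_pos by (intro step) (auto simp: ennreal_less_iff)
    also have "\<dots> = ennreal total_const * L + ennreal e"
      using l e total_const_pos by (simp add: ennreal_mult[symmetric] ennreal_plus[symmetric] distrib_left del: ennreal_plus)
    finally show "X \<le> ennreal total_const * L + ennreal e" .
  qed
  then show ?thesis unfolding X_def L_def KS_def .
qed

end

section \<open>Local and global estimate\<close>

lemma tendsto_Inf_at_right:
  fixes L :: "real \<Rightarrow> ennreal"
  assumes "\<And>a b. 0 < a \<Longrightarrow> a \<le> b \<Longrightarrow> L a \<le> L b"
  shows "(L \<longlongrightarrow> (INF \<delta>\<in>{0<..}. L \<delta>)) (at_right 0)"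
proof (rule order_tendstoI)
  fix a assume "a < (INF \<delta>\<in>{0<..}. L \<delta>)"
  then show "\<forall>\<^sub>F \<delta> in at_right 0. a < L \<delta>"
    by (intro eventually_at_rightI[of 0 1]) (auto intro: less_INF_D)
next
  fix a assume "(INF \<delta>\<in>{0<..}. L \<delta>) < a"
  then obtain b where b: "0 < b" "L b < a" by (auto simp: INF_less_iff)
  then show "\<forall>\<^sub>F \<delta> in at_right 0. L \<delta> < a"
    using assms by (intro eventually_at_rightI[of 0 b]) (auto intro: le_less_trans less_imp_le)
qed

lemma ks_functional_mono:
  "A \<subseteq> B \<Longrightarrow> ks_functional p \<E> \<F> d m A u s \<le> ks_functional p \<E> \<F> d m B u s"
  unfolding ks_functional_def by (intro nn_integral_mono mult_left_mono) (auto simp: indicator_def)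

locale ks_setting = self_similar_measure_form p \<E> \<F> S F \<rho> \<pi> d m + energy_measure_form p \<E> \<F> S F \<rho> \<pi> \<Gamma>
  for p :: real and \<E> :: "('a::polish_space \<Rightarrow> real) \<Rightarrow> real" and \<F>
    and S :: "'i set" and F :: "'i \<Rightarrow> 'a \<Rightarrow> 'a" and \<rho> :: "'i \<Rightarrow> real" and \<pi> :: "(nat \<Rightarrow> 'i) \<Rightarrow> 'a"
    and d :: real and m :: "'a measure" and \<Gamma> :: "('a \<Rightarrow> real) \<Rightarrow> 'a measure"
begin

lemma closure_neighbourhood:
  fixes E :: "'a set"
  assumes "open V" "closure E \<subseteq> V"
  shows "\<exists>A. open A \<and> closure E \<subseteq> A \<and> closure A \<subseteq> V"
proof -
  have "compact (closure E)" using compact_Int_closed[OF compact_UNIV closed_closure] by simp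
  then obtain e where e: "0 < e" "(\<Union>x\<in>closure E. ball x e) \<subseteq> V"
    using compact_subset_open_imp_ball_epsilon_subset assms by metis
  define A where "A = (\<Union>x\<in>closure E. ball x (e / 2))"
  have "closure A \<subseteq> V"
  proof
    fix z assume "z \<in> closure A"
    then obtain a where a: "a \<in> A" "dist a z < e / 2" using e(1) by (metis closure_approachable half_gt_zero)
    then obtain x where x: "x \<in> closure E" "dist x a < e / 2" by (auto simp: A_def)
    then have "dist x z < e" using a dist_triangle[of x z a] by (simp add: dist_commute)
    then have "z \<in> ball x e" by simp
    then show "z \<in> V" using e(2) x(1) by blast
  qed
  moreover have "closure E \<subseteq> A" using e(1) by (auto simp: A_def)
  moreover have "open A" by (auto simp: A_def)
  ultimately show ?thesis by blast
qed

text \<open>Choose a partition so fine that the cells adjacent to cells meeting \<open>E\<close> lie in the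
  \<open>\<delta>\<close>-neighbourhood of \<open>E\<close> and that their neighbours still lie where \<open>u\<close> agrees with an element of the domain.\<close>

lemma energy_measure_le_ks:
  assumes E: "E \<in> sets borel" and E': "open E'" "closure E \<subseteq> E'" and u: "u \<in> local_domain \<F> E'"
    and \<mu>: "is_local_energy_measure \<Gamma> \<F> E' u \<mu>" and \<delta>: "0 < \<delta>"
  shows "emeasure \<mu> E \<le> ennreal total_const * Liminf (at_right 0)
      (\<lambda>s. ks_functional p \<E> \<F> d m (\<Union>x\<in>E. resistance_ball p \<E> \<F> x \<delta>) u s)"
proof -
  have rc: "relatively_compact_in A V" if "closure A \<subseteq> V" for A V :: "'a set"
    using that compact_Int_closed[OF compact_UNIV closed_closure] by (simp add: relatively_compact_in_def)
  obtain A where A: "open A" "closure E \<subseteq> A" "closure A \<subseteq> E'"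
    using closure_neighbourhood[OF E'] by blast
  obtain g where g: "g \<in> \<F>" "\<And>x. x \<in> A \<Longrightarrow> u x = g x"
    using u A(1) rc[OF A(3)] unfolding local_domain_def by blast
  have "emeasure \<mu> E = emeasure (\<Gamma> g) E"
  proof -
    have "E \<subseteq> A" using closure_subset[of E] A(2) by blast
    with \<mu>[unfolded is_local_energy_measure_def, THEN conjunct2, rule_format, of E A g]
    show ?thesis using E rc[OF E'(2)] A(1) rc[OF A(3)] g by simp
  qed
  define U where "U = (\<Union>x\<in>E. resistance_ball p \<E> \<F> x \<delta>)"
  have "\<exists>\<epsilon>>0. \<forall>x\<in>closure E. \<forall>y\<in>- A. \<epsilon> \<le> res x y"
    using A by (intro res_separated) auto
  then obtain \<epsilon> where \<epsilon>: "0 < \<epsilon>" "\<And>x y. x \<in> E \<Longrightarrow> y \<notin> A \<Longrightarrow> \<epsilon> \<le> res x y"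
    using closure_subset[of E] by blast
  \<comment> \<open>two steps between adjacent cells stay inside the set where the functions agree, one step
    stays in the neighbourhood over which the functional integrates\<close>
  define \<eta> where "\<eta> = min (\<delta> powr (p - 1)) (\<epsilon> / (2 powr p * 4))"
  have \<eta>: "0 < \<eta>" using \<delta> \<epsilon> by (simp add: \<eta>_def)
  define T where "T = 2 powr p * (2 * res_bound) * 2 / \<eta>"
  have T: "0 < T" "2 powr p * (2 * (res_bound / T)) = \<eta> / 2" using \<eta> res_bound(1) by (auto simp: T_def)
  have near: "res x y < \<eta>" if "w \<in> cells T" "w' \<in> neighbours T w" "x \<in> range (Fw w)" "y \<in> range (Fw w')" for w w' x y
    using res_neighbours[OF that(1,2) T(1) that(3,4)] T(2) \<eta> by simp
  define N where "N = (\<Union>w\<in>{w \<in> cells T. range (Fw w) \<inter> E \<noteq> {}}. neighbours T w)"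
  have NT: "N \<subseteq> cells T" using neighbours_sub by (auto simp: N_def)
  have close: "\<exists>x\<in>E. \<forall>y\<in>range (Fw v). res x y < \<eta>" if "v \<in> N" for v
  proof -
    obtain w where w: "w \<in> cells T" "v \<in> neighbours T w" "range (Fw w) \<inter> E \<noteq> {}" using \<open>v \<in> N\<close> by (auto simp: N_def)
    then obtain x where "x \<in> range (Fw w)" "x \<in> E" by auto
    then show ?thesis using near[OF w(1,2)] by blast
  qed
  have NU: "range (Fw v) \<subseteq> U" if "v \<in> N" for v
  proof
    fix y assume y: "y \<in> range (Fw v)"
    obtain x where x: "x \<in> E" "res x y < \<eta>" using close[OF \<open>v \<in> N\<close>] y by blast
    then have "res x y < \<delta> powr (p - 1)" by (simp add: \<eta>_def)
    then show "y \<in> U" using x(1) resistance_metric_less_iff[OF \<delta>] by (auto simp: U_def resistance_ball_def)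
  qed
  have ug: "u y = g y" if v: "v \<in> N" "v' \<in> neighbours T v" "y \<in> range (Fw v')" for v v' y
  proof -
    obtain x where x: "x \<in> E" "\<And>z. z \<in> range (Fw v) \<Longrightarrow> res x z < \<eta>" using close[OF v(1)] by blast
    obtain z where z: "z \<in> range (Fw v)" by blast
    have "res z y < \<eta>" using near[OF _ v(2) z v(3)] v(1) NT by blast
    then have "res x y \<le> 2 powr p * (2 * \<eta>)"
      using x(2)[OF z] by (intro res_triangle_bound[of x z]) auto
    also have "\<dots> \<le> 2 powr p * (2 * (\<epsilon> / (2 powr p * 4)))" by (intro mult_left_mono) (auto simp: \<eta>_def)
    also have "\<dots> < \<epsilon>" using \<epsilon>(1) by simp
    finally have "y \<in> A" using \<epsilon>(2)[OF x(1), of y] by force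
    then show ?thesis by (rule g(2))
  qed
  have "emeasure (\<Gamma> g) E \<le> ennreal (\<Sum>v\<in>N. \<rho>w v * \<E> (g \<circ> Fw v))"
    by (rule \<Gamma>_le_energy[OF g(1) E N_def])
  also have "\<dots> = (\<Sum>v\<in>N. ennreal (\<rho>w v) * extended_energy m \<E> \<F> (g \<circ> Fw v))"
  proof -
    have v: "set v \<subseteq> S" if "v \<in> N" for v using that NT cells_set by blast
    have gv: "g \<circ> Fw v \<in> \<F>" if "v \<in> N" for v using g(1) v[OF that] by (rule word_mem)
    have "ennreal (\<Sum>v\<in>N. \<rho>w v * \<E> (g \<circ> Fw v)) = (\<Sum>v\<in>N. ennreal (\<rho>w v * \<E> (g \<circ> Fw v)))"
      using \<rho>w_pos[OF v] energy_nonneg[OF gv] by (intro sum_ennreal[symmetric] mult_nonneg_nonneg) (auto simp: less_imp_le)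
    also have "\<dots> = (\<Sum>v\<in>N. ennreal (\<rho>w v) * extended_energy m \<E> \<F> (g \<circ> Fw v))"
      using \<rho>w_pos[OF v] energy_nonneg[OF gv] extended_energy_eq[OF gv]
      by (intro sum.cong refl) (simp add: ennreal_mult less_imp_le)
    finally show ?thesis .
  qed
  also have "\<dots> \<le> ennreal total_const * Liminf (at_right 0) (\<lambda>s. ks_functional p \<E> \<F> d m U u s)"
    by (rule local_energy_le_ks[OF mem_measurable[OF g(1)] NT NU ug])
  finally show ?thesis using \<open>emeasure \<mu> E = emeasure (\<Gamma> g) E\<close> by (simp add: U_def)
qed

text \<open>The limit as \<open>\<delta>\<close> decreases exists by monotonicity of the region of integration.\<close>

lemma energy_measure_le_lim_ks:
  assumes "E \<in> sets borel" "open E'" "closure E \<subseteq> E'" "u \<in> local_domain \<F> E'"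
    and "is_local_energy_measure \<Gamma> \<F> E' u \<mu>"
  shows "emeasure \<mu> E \<le> ennreal total_const * Lim (at_right 0) (\<lambda>\<delta>. Liminf (at_right 0)
      (\<lambda>s. ks_functional p \<E> \<F> d m (\<Union>x\<in>E. resistance_ball p \<E> \<F> x \<delta>) u s))"
proof -
  define L where "L = (\<lambda>\<delta>. Liminf (at_right 0)
      (\<lambda>s. ks_functional p \<E> \<F> d m (\<Union>x\<in>E. resistance_ball p \<E> \<F> x \<delta>) u s))"
  have "L a \<le> L b" if "0 < a" "a \<le> b" for a b
    unfolding L_def using that
    by (intro Liminf_mono always_eventually allI ks_functional_mono) (auto simp: resistance_ball_def)
  then have "(L \<longlongrightarrow> (INF \<delta>\<in>{0<..}. L \<delta>)) (at_right 0)" by (rule tendsto_Inf_at_right)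
  then have lim: "(L \<longlongrightarrow> Lim (at_right 0) L) (at_right 0)"
    using tendsto_Lim[OF trivial_limit_at_right_real] by metis
  have "((\<lambda>\<delta>. ennreal total_const * L \<delta>) \<longlongrightarrow> ennreal total_const * Lim (at_right 0) L) (at_right 0)"
    by (intro ennreal_tendsto_cmult lim) simp
  moreover have "\<forall>\<^sub>F \<delta> in at_right 0. emeasure \<mu> E \<le> ennreal total_const * L \<delta>"
    using energy_measure_le_ks[OF assms] unfolding L_def by (intro eventually_at_rightI[of 0 1]) auto
  ultimately have "emeasure \<mu> E \<le> ennreal total_const * Lim (at_right 0) L"
    by (rule tendsto_lowerbound) simp
  then show ?thesis unfolding L_def .
qed

text \<open>The case of the trivial partition with the single cell \<open>K\<close>.\<close>

lemma extended_energy_le_ks: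
  assumes "f \<in> borel_measurable m"
  shows "extended_energy m \<E> \<F> f \<le> ennreal total_const * Liminf (at_right 0) (\<lambda>s. ks_functional p \<E> \<F> d m UNIV f s)"
proof -
  have f: "f \<in> borel_measurable borel"
    using assms measurable_cong_sets[OF sets_m refl, of borel] by simp
  have "(\<Sum>v\<in>{[]}. ennreal (\<rho>w v) * extended_energy m \<E> \<F> (f \<circ> Fw v))
    \<le> ennreal total_const * Liminf (at_right 0) (\<lambda>s. ks_functional p \<E> \<F> d m UNIV f s)"
    by (rule local_energy_le_ks[OF f, where ?T0.0 = 1]) (auto simp: cells_stop)
  then show ?thesis by simp
qed

end

theorem proposition6p16:
  fixes p d\<^sub>f :: real
    and S :: "'i set"
    and F :: "'i \<Rightarrow> 'a::polish_space \<Rightarrow> 'a"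
    and \<rho> :: "'i \<Rightarrow> real"
    and \<E> :: "('a \<Rightarrow> real) \<Rightarrow> real"
    and \<F> :: "('a \<Rightarrow> real) set"
    and m :: "'a measure"
    and \<Gamma> :: "('a \<Rightarrow> real) \<Rightarrow> 'a measure"
  assumes "1 < p"
    and "pcf_self_similar_structure S F"
    and "connected (UNIV :: 'a set)"
    and "self_similar_p_resistance_form p S F \<rho> \<E> \<F>"
    and "Min (\<rho> ` S) > 1"
    and "d\<^sub>f > 0"
    and "(\<Sum>i\<in>S. \<rho> i powr (- d\<^sub>f / (p - 1))) = 1"
    and "self_similar_measure S F (\<lambda>i. \<rho> i powr (- d\<^sub>f / (p - 1))) m"
    and "\<And>u. u \<in> \<F> \<Longrightarrow> is_energy_measure p \<E> \<F> u (\<Gamma> u)"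
  shows "\<exists>C>0.
    (\<forall>E E' u \<mu>.
       E \<in> sets borel \<longrightarrow> open E' \<longrightarrow> closure E \<subseteq> E' \<longrightarrow> u \<in> local_domain \<F> E' \<longrightarrow>
       is_local_energy_measure \<Gamma> \<F> E' u \<mu> \<longrightarrow>
       emeasure \<mu> E \<le> ennreal C *
         Lim (at_right 0) (\<lambda>\<delta>. Liminf (at_right 0)
           (\<lambda>s. ks_functional p \<E> \<F> d\<^sub>f m (\<Union>x\<in>E. resistance_ball p \<E> \<F> x \<delta>) u s))) \<and>
    (\<forall>f. f \<in> borel_measurable m \<longrightarrow> integrable m (\<lambda>x. \<bar>f x\<bar> powr p) \<longrightarrow>
       extended_energy m \<E> \<F> f \<le> ennreal C *
         Liminf (at_right 0) (\<lambda>s. ks_functional p \<E> \<F> d\<^sub>f m UNIV f s))"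
proof -
  from assms(2) obtain \<pi> where str: "self_similar_structure S F" and \<pi>: "coding_map S F \<pi>" "finite (post_critical_set S F \<pi>)"
    by (auto simp: pcf_self_similar_structure_def)
  have "1 < \<rho> i" if "i \<in> S" for i
  proof -
    have "finite S" using str by (auto simp: self_similar_structure_def)
    then have "Min (\<rho> ` S) \<le> \<rho> i" using that by simp
    then show ?thesis using assms(5) by simp
  qed
  then interpret ks_setting p \<E> \<F> S F \<rho> \<pi> d\<^sub>f m \<Gamma>
    using assms str \<pi> by unfold_locales (auto simp: self_similar_p_resistance_form_def)
  show ?thesis
    using total_const_pos energy_measure_le_lim_ks extended_energy_le_ks by (intro exI[of _ total_const]) blast
qed

end
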